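(* Let $\Omega\subset\mathbb{R}^n$ be a bounded domain and let $\mathcal{M}\in L^\infty(\Omega,\mathcal{L}(\Lambda\mathbb{R}^n))$ satisfy $M:=\operatorname{ess\,sup}_{x\in\Omega}\Vert\mathcal{M}(x)\Vert<1$. Let $\{F_j\}_j\subset W^{1,2}_{loc}(\Omega,\Lambda\mathbb{R}^n)$ be a sequence of solutions of $$\mathcal{D}^-F_j(x)=\mathcal{M}(x)\,\mathcal{D}^+F_j(x)\quad\text{on }\Omega .$$ Assume that $\{F_j\}_j$ is locally bounded in $L^2$. Then for every smooth relatively compact open subset $U\Subset\Omega$ there exist a subsequence $\{F_{j_k}\}_k$ and some $F=F_U\in W^{1,2}(U,\Lambda\mathbb{R}^n)$ such that $F_{j_k}\to F_U$ in $W^{1,2}(U,\Lambda\mathbb{R}^n)$ as $k\to\infty$ and $$\mathcal{D}^-F_U(x)=\mathcal{M}(x)\,\mathcal{D}^+F_U(x)\quad\text{on }U .$$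
   Context: $\Lambda\mathbb{R}^n$ is the (real) exterior algebra of $\mathbb{R}^n$, of dimension $2^n$, with the Euclidean inner product induced from $\mathbb{R}^n$. $\mathcal{L}(\Lambda\mathbb{R}^n)$ is the space of linear maps $\Lambda\mathbb{R}^n\to\Lambda\mathbb{R}^n$, and $\Vert\mathcal{M}(x)\Vert$ is the operator norm. $W^{1,2}(U,\Lambda\mathbb{R}^n)$ and $W^{1,2}_{loc}(\Omega,\Lambda\mathbb{R}^n)$ are the usual Sobolev spaces of $\Lambda\mathbb{R}^n$-valued functions. Let $d$ be the exterior derivative, $dF=\sum_i e_i\wedge\partial_iF$, and let $\delta=-d^*$ be the interior derivative, the negative of the formal adjoint of $d$, so that $\delta F=\sum_i e_i\lrcorner\,\partial_iF$, where $e_i\lrcorner$ is the adjoint of $e_i\wedge$. The Hodge--Dirac operators are $\mathcal{D}^{\pm}=d\pm\delta$. Equations hold almost everywhere, with derivatives taken in the weak sense. A domain is a connected open set. $U\Subset\Omega$ means that $\overline{U}$ is a compact subset of $\Omega$; $U$ smooth means that $U$ has smooth boundary. "Locally bounded in $L^2$" means $\sup_j\Vert F_j\Vert_{L^2(K)}<\infty$ for every compact $K\subset\Omega$. *)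

theory Defs
  imports "HOL-Analysis.Analysis" "HOL-Probability.Essential_Supremum"
begin

section \<open>The exterior algebra of Euclidean space\<close>

text \<open>
  The exterior algebra of \<open>\<real>\<^sup>n\<close> is modelled on its standard orthonormal basis
  \<open>e\<^sub>S = e\<^sub>s\<^sub>1 \<and> \<dots> \<and> e\<^sub>s\<^sub>k\<close>, where \<open>S = {s\<^sub>1 < \<dots> < s\<^sub>k}\<close> ranges over the
  \<open>2\<^sup>n\<close> subsets of the index type. The inner product of the vector type makes the \<open>e\<^sub>S\<close>
  orthonormal, so it is the one induced from \<open>\<real>\<^sup>n\<close>. The order on the index type only
  serves to fix the signs.
\<close>

type_synonym 'n ext = "real ^ ('n set)"

definition ext_basis :: "'n::{finite,linorder} set \<Rightarrow> 'n ext" where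
  "ext_basis S = axis S 1"

text \<open>The sign of the permutation that sorts the concatenation of two disjoint index sets.\<close>

definition shuffle_sign :: "'n::{finite,linorder} set \<Rightarrow> 'n set \<Rightarrow> real" where
  "shuffle_sign S T = (- 1) ^ card {(s, t) \<in> S \<times> T. t < s}"

definition wedge :: "'n::{finite,linorder} ext \<Rightarrow> 'n ext \<Rightarrow> 'n ext" (infixr "\<and>\<^sub>e" 70) where
  "u \<and>\<^sub>e v = (\<chi> S. \<Sum>T\<in>Pow S. shuffle_sign T (S - T) * (u $ T) * (v $ (S - T)))"

definition ext_vec :: "real ^ 'n::{finite,linorder} \<Rightarrow> 'n ext" where
  "ext_vec a = (\<Sum>i\<in>UNIV. (a $ i) *\<^sub>R ext_basis {i})"

abbreviation ext_e :: "'n::{finite,linorder} \<Rightarrow> 'n ext" where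
  "ext_e i \<equiv> ext_vec (axis i 1)"

definition interior_mult :: "'n::{finite,linorder} \<Rightarrow> 'n ext \<Rightarrow> 'n ext" where
  "interior_mult i = adjoint (\<lambda>w. ext_e i \<and>\<^sub>e w)"

subsection \<open>The model is the exterior algebra\<close>

lemma bilinear_wedge: "bilinear (\<and>\<^sub>e)"
  unfolding bilinear_def wedge_def
  by (auto intro!: linearI simp: vec_eq_iff sum_distrib_left sum.distrib[symmetric] algebra_simps)

lemma linear_wedge_left: "linear (\<lambda>x. x \<and>\<^sub>e y)"
  using bilinear_wedge unfolding bilinear_def by blast

lemma linear_wedge_right: "linear (\<lambda>x. y \<and>\<^sub>e x)"
  using bilinear_wedge unfolding bilinear_def by blast

lemma ext_e_eq: "ext_e i = ext_basis {i}"
proof -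
  have "ext_e i = (\<Sum>k\<in>UNIV. if k = i then ext_basis {i} else 0)"
    unfolding ext_vec_def by (rule sum.cong) (auto simp: axis_def)
  then show ?thesis by simp
qed

lemma linear_ext_vec: "linear ext_vec"
  unfolding ext_vec_def
  by (rule linearI) (simp_all add: sum.distrib scaleR_sum_right algebra_simps)

lemma ext_basis_expansion: "u = (\<Sum>S\<in>UNIV. (u $ S) *\<^sub>R ext_basis S)"
  using basis_expansion[of u] by (simp add: ext_basis_def scalar_mult_eq_scaleR)

lemma wedge_ext_basis:
  "ext_basis S \<and>\<^sub>e ext_basis T = (if S \<inter> T = {} then shuffle_sign S T *\<^sub>R ext_basis (S \<union> T) else 0)"
proof -
  have "(ext_basis S \<and>\<^sub>e ext_basis T) $ R =
      (if S \<inter> T = {} then shuffle_sign S T *\<^sub>R ext_basis (S \<union> T) else 0) $ R" for R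
  proof -
    have "(ext_basis S \<and>\<^sub>e ext_basis T) $ R =
        (\<Sum>Q\<in>Pow R. if Q = S then (if R - S = T then shuffle_sign S T else 0) else 0)"
      unfolding wedge_def ext_basis_def vec_lambda_beta
      by (intro sum.cong refl) (simp add: axis_def)
    also have "\<dots> = (if S \<subseteq> R \<and> R - S = T then shuffle_sign S T else 0)"
      by (simp add: sum.delta)
    also have "S \<subseteq> R \<and> R - S = T \<longleftrightarrow> S \<inter> T = {} \<and> R = S \<union> T" by blast
    finally show ?thesis by (auto simp: ext_basis_def axis_def)
  qed
  then show ?thesis by (simp add: vec_eq_iff)
qed

lemma wedge_unit: "ext_basis {} \<and>\<^sub>e u = u" "u \<and>\<^sub>e ext_basis {} = u"
proof -
  have "ext_basis {} \<and>\<^sub>e (\<Sum>S\<in>UNIV. (u $ S) *\<^sub>R ext_basis S) = (\<Sum>S\<in>UNIV. (u $ S) *\<^sub>R ext_basis S)"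
    by (simp add: linear_sum[OF linear_wedge_right] linear_cmul[OF linear_wedge_right] wedge_ext_basis shuffle_sign_def)
  then show "ext_basis {} \<and>\<^sub>e u = u" by (simp flip: ext_basis_expansion)
  have "(\<Sum>S\<in>UNIV. (u $ S) *\<^sub>R ext_basis S) \<and>\<^sub>e ext_basis {} = (\<Sum>S\<in>UNIV. (u $ S) *\<^sub>R ext_basis S)"
    by (simp add: linear_sum[OF linear_wedge_left] linear_cmul[OF linear_wedge_left] wedge_ext_basis shuffle_sign_def)
  then show "u \<and>\<^sub>e ext_basis {} = u" by (simp flip: ext_basis_expansion)
qed

lemma ext_basis_insert:
  assumes "\<And>j. j \<in> S \<Longrightarrow> i < j"
  shows "ext_basis (insert i S) = ext_e i \<and>\<^sub>e ext_basis S"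
proof -
  have "{(s, t) \<in> {i} \<times> S. t < s} = {}" using assms by (auto dest: less_asym)
  then have "shuffle_sign {i} S = 1" by (simp only: shuffle_sign_def card.empty power_0)
  moreover have "i \<notin> S" using assms by blast
  ultimately show ?thesis by (simp add: ext_e_eq wedge_ext_basis)
qed

lemma shuffle_sign_Un_left:
  assumes "S \<inter> S' = {}"
  shows "shuffle_sign (S \<union> S') T = shuffle_sign S T * shuffle_sign S' T"
proof -
  have "{(s, t) \<in> (S \<union> S') \<times> T. t < s} = {(s, t) \<in> S \<times> T. t < s} \<union> {(s, t) \<in> S' \<times> T. t < s}"
    by auto
  moreover have "{(s, t) \<in> S \<times> T. t < s} \<inter> {(s, t) \<in> S' \<times> T. t < s} = {}" using assms by auto
  ultimately show ?thesis
    unfolding shuffle_sign_def by (simp add: card_Un_disjoint power_add)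
qed

lemma shuffle_sign_Un_right:
  assumes "T \<inter> T' = {}"
  shows "shuffle_sign S (T \<union> T') = shuffle_sign S T * shuffle_sign S T'"
proof -
  have "{(s, t) \<in> S \<times> (T \<union> T'). t < s} = {(s, t) \<in> S \<times> T. t < s} \<union> {(s, t) \<in> S \<times> T'. t < s}"
    by auto
  moreover have "{(s, t) \<in> S \<times> T. t < s} \<inter> {(s, t) \<in> S \<times> T'. t < s} = {}" using assms by auto
  ultimately show ?thesis
    unfolding shuffle_sign_def by (simp add: card_Un_disjoint power_add)
qed

lemma wedge_assoc: "(u \<and>\<^sub>e v) \<and>\<^sub>e w = u \<and>\<^sub>e (v \<and>\<^sub>e w)"
proof -
  note lc = linear_cmul[OF linear_wedge_left] linear_cmul[OF linear_wedge_right]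
    linear_0[OF linear_wedge_left] linear_0[OF linear_wedge_right]
  note ls = linear_sum[OF linear_wedge_left] linear_sum[OF linear_wedge_right]
  have basis: "(ext_basis S \<and>\<^sub>e ext_basis T) \<and>\<^sub>e ext_basis R = ext_basis S \<and>\<^sub>e (ext_basis T \<and>\<^sub>e ext_basis R)"
    for S T R :: "'a::{finite,linorder} set"
    by (auto simp: wedge_ext_basis lc shuffle_sign_Un_left shuffle_sign_Un_right Int_Un_distrib Int_Un_distrib2 Un_assoc)
  have "((\<Sum>S\<in>UNIV. (u $ S) *\<^sub>R ext_basis S) \<and>\<^sub>e (\<Sum>S\<in>UNIV. (v $ S) *\<^sub>R ext_basis S)) \<and>\<^sub>e (\<Sum>S\<in>UNIV. (w $ S) *\<^sub>R ext_basis S)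
    = (\<Sum>S\<in>UNIV. (u $ S) *\<^sub>R ext_basis S) \<and>\<^sub>e ((\<Sum>S\<in>UNIV. (v $ S) *\<^sub>R ext_basis S) \<and>\<^sub>e (\<Sum>S\<in>UNIV. (w $ S) *\<^sub>R ext_basis S))"
    by (simp only: ls lc basis)
  then show ?thesis by (simp flip: ext_basis_expansion)
qed

lemma wedge_ext_vec_self: "ext_vec a \<and>\<^sub>e ext_vec a = 0"
proof -
  have anti: "ext_basis {i} \<and>\<^sub>e ext_basis {j} = - (ext_basis {j} \<and>\<^sub>e ext_basis {i})" for i j :: "'a::{finite,linorder}"
  proof (cases i j rule: linorder_cases)
    case less
    then have "{(s, t) \<in> {i} \<times> {j}. t < s} = {}" "{(s, t) \<in> {j} \<times> {i}. t < s} = {(j, i)}" by auto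
    then have "shuffle_sign {i} {j} = 1" "shuffle_sign {j} {i} = - 1"
      by (simp_all only: shuffle_sign_def) simp_all
    then show ?thesis using less by (simp add: wedge_ext_basis insert_commute)
  next
    case equal
    then show ?thesis by (simp add: wedge_ext_basis)
  next
    case greater
    then have "{(s, t) \<in> {i} \<times> {j}. t < s} = {(i, j)}" "{(s, t) \<in> {j} \<times> {i}. t < s} = {}" by auto
    then have "shuffle_sign {i} {j} = - 1" "shuffle_sign {j} {i} = 1"
      by (simp_all only: shuffle_sign_def) simp_all
    then show ?thesis using greater by (simp add: wedge_ext_basis insert_commute)
  qed
  define X where "X = ext_vec a \<and>\<^sub>e ext_vec a"
  have e: "X = (\<Sum>i\<in>UNIV. \<Sum>j\<in>UNIV. (a $ i * a $ j) *\<^sub>R (ext_basis {j} \<and>\<^sub>e ext_basis {i}))"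
    by (simp add: X_def ext_vec_def linear_sum[OF linear_wedge_left] linear_sum[OF linear_wedge_right] linear_cmul[OF linear_wedge_left] linear_cmul[OF linear_wedge_right]
        scaleR_sum_right)
  also have "\<dots> = (\<Sum>j\<in>UNIV. \<Sum>i\<in>UNIV. (a $ i * a $ j) *\<^sub>R (ext_basis {j} \<and>\<^sub>e ext_basis {i}))"
    by (rule sum.swap)
  also have "\<dots> = (\<Sum>j\<in>UNIV. \<Sum>i\<in>UNIV. - ((a $ j * a $ i) *\<^sub>R (ext_basis {i} \<and>\<^sub>e ext_basis {j})))"
    by (intro sum.cong refl) (subst anti, simp add: mult.commute)
  also have "\<dots> = - X" unfolding e by (simp add: sum_negf)
  finally have "X $ S = - (X $ S)" for S by (metis vector_uminus_component)
  then have "X = 0" by (simp add: vec_eq_iff)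
  then show ?thesis by (simp add: X_def)
qed

lemma interior_mult_adjoint: "interior_mult i u \<bullet> v = u \<bullet> (ext_e i \<and>\<^sub>e v)"
  unfolding interior_mult_def by (rule adjoint_clauses(2)[OF linear_wedge_right])

section \<open>Smooth functions and smooth boundaries\<close>

text \<open>These notions are meant for open sets \<open>S\<close>.\<close>

primrec Ck_on :: "nat \<Rightarrow> 'a::euclidean_space set \<Rightarrow> ('a \<Rightarrow> 'b::real_normed_vector) \<Rightarrow> bool" where
  "Ck_on 0 S f \<longleftrightarrow> continuous_on S f"
| "Ck_on (Suc k) S f \<longleftrightarrow>
     (\<forall>x\<in>S. f differentiable (at x)) \<and> (\<forall>v. Ck_on k S (\<lambda>x. frechet_derivative f (at x) v))"

definition smooth_on :: "'a::euclidean_space set \<Rightarrow> ('a \<Rightarrow> 'b::real_normed_vector) \<Rightarrow> bool" where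
  "smooth_on S f \<longleftrightarrow> (\<forall>k. Ck_on k S f)"

text \<open>
  Smoothness of the boundary by local defining functions; in particular \<open>U\<close> lies locally on
  one side of its boundary.
\<close>

definition smooth_boundary :: "'a::euclidean_space set \<Rightarrow> bool" where
  "smooth_boundary U \<longleftrightarrow>
     (\<forall>p\<in>frontier U. \<exists>W (\<rho> :: 'a \<Rightarrow> real). open W \<and> p \<in> W \<and> smooth_on W \<rho> \<and>
        (\<forall>x\<in>W. \<exists>v. frechet_derivative \<rho> (at x) v \<noteq> 0) \<and>
        U \<inter> W = {x\<in>W. \<rho> x < 0} \<and> frontier U \<inter> W = {x\<in>W. \<rho> x = 0})"

definition relatively_compact_in :: "'a::euclidean_space set \<Rightarrow> 'a set \<Rightarrow> bool" (infix "\<Subset>" 50) where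
  "U \<Subset> \<Omega> \<longleftrightarrow> compact (closure U) \<and> closure U \<subseteq> \<Omega>"

section \<open>Lebesgue and Sobolev spaces\<close>

text \<open>
  Elements of the function spaces are represented by functions on the whole space whose
  values outside of the set in question are irrelevant.
\<close>

definition Linf :: "(real ^ 'n::finite) set \<Rightarrow> (real ^ 'n \<Rightarrow> 'b::real_normed_vector) set" where
  "Linf S = {f \<in> borel_measurable (lebesgue_on S).
     esssup (lebesgue_on S) (\<lambda>x. ereal (norm (f x))) < \<infinity>}"

definition L2 :: "(real ^ 'n::finite) set \<Rightarrow> (real ^ 'n \<Rightarrow> 'b::euclidean_space) set" where
  "L2 S = {f \<in> borel_measurable (lebesgue_on S). integrable (lebesgue_on S) (\<lambda>x. (norm (f x))\<^sup>2)}"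

definition L2_norm :: "(real ^ 'n::finite) set \<Rightarrow> (real ^ 'n \<Rightarrow> 'b::euclidean_space) \<Rightarrow> real" where
  "L2_norm S f = sqrt (integral\<^sup>L (lebesgue_on S) (\<lambda>x. (norm (f x))\<^sup>2))"

definition L2_loc :: "(real ^ 'n::finite) set \<Rightarrow> (real ^ 'n \<Rightarrow> 'b::euclidean_space) set" where
  "L2_loc \<Omega> = {f. \<forall>K. compact K \<and> K \<subseteq> \<Omega> \<longrightarrow> f \<in> L2 K}"

definition locally_bounded_L2 ::
    "(real ^ 'n::finite) set \<Rightarrow> (nat \<Rightarrow> real ^ 'n \<Rightarrow> 'b::euclidean_space) \<Rightarrow> bool" where
  "locally_bounded_L2 \<Omega> F \<longleftrightarrow> (\<forall>K. compact K \<and> K \<subseteq> \<Omega> \<longrightarrow>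
     (\<forall>j. F j \<in> L2 K) \<and> bdd_above (range (\<lambda>j. L2_norm K (F j))))"

definition test_function :: "(real ^ 'n::finite) set \<Rightarrow> (real ^ 'n \<Rightarrow> real) \<Rightarrow> bool" where
  "test_function \<Omega> \<phi> \<longleftrightarrow> smooth_on UNIV \<phi> \<and>
     compact (closure {x. \<phi> x \<noteq> 0}) \<and> closure {x. \<phi> x \<noteq> 0} \<subseteq> \<Omega>"

definition has_weak_partial ::
    "(real ^ 'n::finite) set \<Rightarrow> 'n \<Rightarrow> (real ^ 'n \<Rightarrow> 'b::euclidean_space) \<Rightarrow> (real ^ 'n \<Rightarrow> 'b) \<Rightarrow> bool" where
  "has_weak_partial \<Omega> i f g \<longleftrightarrow>
     (\<forall>K. compact K \<and> K \<subseteq> \<Omega> \<longrightarrow> integrable (lebesgue_on K) f \<and> integrable (lebesgue_on K) g) \<and>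
     (\<forall>\<phi>. test_function \<Omega> \<phi> \<longrightarrow>
        integral\<^sup>L (lebesgue_on \<Omega>) (\<lambda>x. frechet_derivative \<phi> (at x) (axis i 1) *\<^sub>R f x)
        = - integral\<^sup>L (lebesgue_on \<Omega>) (\<lambda>x. \<phi> x *\<^sub>R g x))"

text \<open>
  A representative of the weak partial derivative, which is unique up to null sets; it is
  unspecified if there is no weak partial derivative.
\<close>

definition weak_partial ::
    "(real ^ 'n::finite) set \<Rightarrow> 'n \<Rightarrow> (real ^ 'n \<Rightarrow> 'b::euclidean_space) \<Rightarrow> real ^ 'n \<Rightarrow> 'b" where
  "weak_partial \<Omega> i f = (SOME g. has_weak_partial \<Omega> i f g)"

definition W12 :: "(real ^ 'n::finite) set \<Rightarrow> (real ^ 'n \<Rightarrow> 'b::euclidean_space) set" where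
  "W12 U = {f \<in> L2 U. \<forall>i. \<exists>g\<in>L2 U. has_weak_partial U i f g}"

definition W12_loc :: "(real ^ 'n::finite) set \<Rightarrow> (real ^ 'n \<Rightarrow> 'b::euclidean_space) set" where
  "W12_loc \<Omega> = {f \<in> L2_loc \<Omega>. \<forall>i. \<exists>g\<in>L2_loc \<Omega>. has_weak_partial \<Omega> i f g}"

definition W12_norm :: "(real ^ 'n::finite) set \<Rightarrow> (real ^ 'n \<Rightarrow> 'b::euclidean_space) \<Rightarrow> real" where
  "W12_norm U f = sqrt ((L2_norm U f)\<^sup>2 + (\<Sum>i\<in>UNIV. (L2_norm U (weak_partial U i f))\<^sup>2))"

definition tendsto_W12 ::
    "(real ^ 'n::finite) set \<Rightarrow> (nat \<Rightarrow> real ^ 'n \<Rightarrow> 'b::euclidean_space) \<Rightarrow> (real ^ 'n \<Rightarrow> 'b) \<Rightarrow> bool" where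
  "tendsto_W12 U F G \<longleftrightarrow> (\<forall>k. F k \<in> W12 U) \<and> G \<in> W12 U \<and>
     (\<lambda>k. W12_norm U (\<lambda>x. F k x - G x)) \<longlonglongrightarrow> 0"

section \<open>Hodge--Dirac operators\<close>

definition ext_deriv ::
    "(real ^ 'n::{finite,linorder}) set \<Rightarrow> (real ^ 'n::{finite,linorder} \<Rightarrow> 'n ext) \<Rightarrow> real ^ 'n::{finite,linorder} \<Rightarrow> 'n ext" where
  "ext_deriv \<Omega> F x = (\<Sum>i\<in>UNIV. ext_e i \<and>\<^sub>e weak_partial \<Omega> i F x)"

definition int_deriv ::
    "(real ^ 'n::{finite,linorder}) set \<Rightarrow> (real ^ 'n::{finite,linorder} \<Rightarrow> 'n ext) \<Rightarrow> real ^ 'n::{finite,linorder} \<Rightarrow> 'n ext" where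
  "int_deriv \<Omega> F x = (\<Sum>i\<in>UNIV. interior_mult i (weak_partial \<Omega> i F x))"

definition dirac_plus ::
    "(real ^ 'n::{finite,linorder}) set \<Rightarrow> (real ^ 'n::{finite,linorder} \<Rightarrow> 'n ext) \<Rightarrow> real ^ 'n::{finite,linorder} \<Rightarrow> 'n ext" where
  "dirac_plus \<Omega> F x = ext_deriv \<Omega> F x + int_deriv \<Omega> F x"

definition dirac_minus ::
    "(real ^ 'n::{finite,linorder}) set \<Rightarrow> (real ^ 'n::{finite,linorder} \<Rightarrow> 'n ext) \<Rightarrow> real ^ 'n::{finite,linorder} \<Rightarrow> 'n ext" where
  "dirac_minus \<Omega> F x = ext_deriv \<Omega> F x - int_deriv \<Omega> F x"

definition beltrami_solution ::
    "(real ^ 'n::{finite,linorder}) set \<Rightarrow> (real ^ 'n::{finite,linorder} \<Rightarrow> 'n ext \<Rightarrow>\<^sub>L 'n ext)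
      \<Rightarrow> (real ^ 'n::{finite,linorder} \<Rightarrow> 'n ext) \<Rightarrow> bool" where
  "beltrami_solution \<Omega> M F \<longleftrightarrow>
     (AE x in lebesgue_on \<Omega>. dirac_minus \<Omega> F x = blinfun_apply (M x) (dirac_plus \<Omega> F x))"

end

theory Submission
  imports Defs "HOL-Library.Diagonal_Subsequence"
begin

text \<open>
  The compactness rests on an interior energy estimate. For a compactly supported field \<open>G\<close> in
  \<open>W\<^sup>1\<^sup>,\<^sup>2\<close> the three integrals of \<open>|\<D>\<^sup>+G|\<^sup>2\<close>, \<open>|\<D>\<^sup>-G|\<^sup>2\<close> and \<open>|\<nabla>G|\<^sup>2\<close> agree: the
  mixed products \<open>\<integral> \<partial>\<^sub>iu \<partial>\<^sub>jv\<close> are symmetric in \<open>i\<close> and \<open>j\<close>, so that \<open>\<integral> dG \<bullet> \<delta>G\<close> vanishes by the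
  antisymmetry of \<open>e\<^sub>i \<and> e\<^sub>j\<close>, while \<open>\<integral> |dG|\<^sup>2 + |\<delta>G|\<^sup>2\<close> reduces to \<open>\<integral> |\<nabla>G|\<^sup>2\<close> by the anticommutation rule of
  exterior and interior multiplication (\<open>integral_dirac_symbol\<close>). For a solution \<open>F\<close> and a cut-off
  \<open>\<zeta>\<close>, the field \<open>G = \<zeta>F\<close> satisfies \<open>|\<D>\<^sup>-G| \<le> m |\<D>\<^sup>+G| + c |F|\<close> with \<open>m < 1\<close>; since both sides
  contain the same energy, the first term on the right is absorbed and \<open>\<integral> |\<nabla>(\<zeta>F)|\<^sup>2\<close> is bounded by the
  integral of \<open>|F|\<^sup>2\<close> over the support of \<open>\<zeta>\<close> (\<open>caccioppoli\<close>).

  The estimate is used twice. Applied to the solutions \<open>F\<^sub>j\<close> it bounds the energies of \<open>\<eta>F\<^sub>j\<close> uniformly,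
  and a Rellich type argument gives a subsequence that is Cauchy in \<open>L\<^sup>2\<close> on any given compact set
  (\<open>dirac_bounded_L2_precompact\<close>). The equation is linear, so the differences \<open>F\<^sub>j - F\<^sub>k\<close> are solutions
  as well; applied to them the estimate turns convergence in \<open>L\<^sup>2\<close> on a slightly larger set into
  convergence of the gradients on \<open>U\<close> (\<open>dirac_bounded_gradient_estimate\<close>). Weak derivatives and the
  equation pass to the limit.

  The analysis of weak derivatives avoids mollification. Everything is tested against smooth functions
  of compact support, which are dense in \<open>L\<^sup>2\<close> (\<open>test_functions_dense_L2\<close>). Duality then gives the
  estimate \<open>|u(\<cdot> + h e\<^sub>i) - u| \<le> |h| |\<partial>\<^sub>iu|\<close> in \<open>L\<^sup>2\<close> norms (\<open>l2_translation_axis\<close>), hence the weak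
  convergence of difference quotients, from which both the symmetry of the mixed products
  (\<open>weak_deriv_mixed_commute\<close>) and the compactness (\<open>L2_precompact_if_equitranslatable\<close>) follow.

  Fields on \<open>\<real>\<^sup>n\<close> are Borel functions for the measure \<open>lborel\<close>, where translations and Fubini's
  theorem are available; \<open>borel_localization\<close> is the passage from Lebesgue measurable fields on
  \<open>\<Omega>\<close> to such functions.
\<close>

section \<open>Smooth functions and cut-offs\<close>

text \<open>
  A family of functions that is closed under taking derivatives consists of smooth functions. This
  replaces inductions over the order of differentiability by closure properties of a set.
\<close>

lemma smooth_on_coinduct:
  fixes f :: "'a::euclidean_space \<Rightarrow> 'b::real_normed_vector"
  assumes "f \<in> A"
    and step: "\<And>f. f \<in> A \<Longrightarrow> \<exists>f'. (\<forall>x. (f has_derivative f' x) (at x)) \<and> (\<forall>v. (\<lambda>x. f' x v) \<in> A)"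
  shows "smooth_on UNIV f"
proof -
  have "\<forall>f\<in>A. Ck_on k UNIV f" for k
  proof (induction k)
    case 0
    show ?case
      by (auto intro!: continuous_at_imp_continuous_on dest!: step intro: has_derivative_continuous)
  next
    case (Suc k)
    show ?case
    proof
      fix f assume "f \<in> A"
      then obtain f' where f': "\<And>x. (f has_derivative f' x) (at x)" "\<And>v. (\<lambda>x. f' x v) \<in> A"
        using step by blast
      have "frechet_derivative f (at x) = f' x" for x
        using f'(1) frechet_derivative_at by metis
      then show "Ck_on (Suc k) UNIV f"
        using f' Suc by (auto simp: differentiable_def)
    qed
  qed
  then show ?thesis using assms(1) by (auto simp: smooth_on_def)
qed

text \<open>
  All derivatives of \<open>exp (-1/t)\<close>, extended by 0 to \<open>t \<le> 0\<close>, are of this form for a polynomial \<open>p\<close>.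
\<close>

definition flat :: "real poly \<Rightarrow> real \<Rightarrow> real" where
  "flat p t = (if 0 < t then poly p (1 / t) * exp (- (1 / t)) else 0)"

lemma poly_times_exp_minus_tendsto_0: "((\<lambda>s. poly p s * exp (- s)) \<longlongrightarrow> (0::real)) at_top"
proof -
  have "((\<lambda>s. \<Sum>i\<le>degree p. coeff p i * (s ^ i / exp s)) \<longlongrightarrow> (\<Sum>i\<le>degree p. coeff p i * 0)) at_top"
    by (intro tendsto_intros tendsto_power_div_exp_0)
  then show ?thesis
    by (simp add: poly_altdef exp_minus sum_distrib_right divide_inverse mult.assoc)
qed

lemma flat_tendsto_0: "(flat p \<longlongrightarrow> 0) (at 0)"
proof -
  have "((\<lambda>t. flat p t) \<longlongrightarrow> 0) (at_left 0)"
    by (rule tendsto_eventually) (auto simp: flat_def eventually_at_filter)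
  moreover have "((\<lambda>t. flat p t) \<longlongrightarrow> 0) (at_right 0)"
  proof (rule Lim_transform_eventually)
    show "((\<lambda>t. poly p (inverse t) * exp (- inverse t)) \<longlongrightarrow> 0) (at_right (0::real))"
      by (rule filterlim_compose[OF poly_times_exp_minus_tendsto_0 filterlim_inverse_at_top_right])
    show "\<forall>\<^sub>F t in at_right 0. poly p (inverse t) * exp (- inverse t) = flat p t"
      by (auto simp: flat_def eventually_at_filter inverse_eq_divide)
  qed
  ultimately show ?thesis by (simp add: filterlim_split_at)
qed

text \<open>
  At 0 the difference quotient of \<open>flat p\<close> is \<open>flat\<close> of the polynomial multiplied by the variable,
  which tends to 0.
\<close>

lemma flat_has_derivative:
  "(flat p has_real_derivative flat ([:0, 0, 1:] * (p - pderiv p)) t) (at t)"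
proof (cases t "0::real" rule: linorder_cases)
  case less
  have "((\<lambda>_. 0) has_real_derivative 0) (at t)" by simp
  then have "(flat p has_real_derivative 0) (at t)"
    by (rule has_field_derivative_transform_within_open[of _ _ _ "{..<0}"]) (use less in \<open>auto simp: flat_def\<close>)
  then show ?thesis using less by (simp add: flat_def)
next
  case equal
  have "(\<lambda>h. (flat p (0 + h) - flat p 0) / h) = flat (pCons 0 p)"
    by (auto simp: flat_def)
  then have "(flat p has_real_derivative 0) (at 0)"
    using flat_tendsto_0[of "pCons 0 p"] unfolding DERIV_def by simp
  then show ?thesis using equal by (simp add: flat_def)
next
  case greater
  have inv: "((\<lambda>t. 1 / t) has_real_derivative - 1 / t\<^sup>2) (at t)"
    using greater by (auto intro!: derivative_eq_intros simp: power2_eq_square)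
  have "((\<lambda>t. poly p (1 / t)) has_real_derivative poly (pderiv p) (1 / t) * (- 1 / t\<^sup>2)) (at t)"
    by (rule DERIV_chain2[OF poly_DERIV inv])
  moreover have "((\<lambda>t. exp (- (1 / t))) has_real_derivative exp (- (1 / t)) * - (- 1 / t\<^sup>2)) (at t)"
    by (rule DERIV_chain2[OF DERIV_exp DERIV_minus[OF inv]])
  ultimately have "((\<lambda>t. poly p (1 / t) * exp (- (1 / t))) has_real_derivative
      poly (pderiv p) (1 / t) * (- 1 / t\<^sup>2) * exp (- (1 / t)) + exp (- (1 / t)) * - (- 1 / t\<^sup>2) * poly p (1 / t)) (at t)"
    by (rule DERIV_mult)
  moreover have "poly (pderiv p) (1 / t) * (- 1 / t\<^sup>2) * exp (- (1 / t)) + exp (- (1 / t)) * - (- 1 / t\<^sup>2) * poly p (1 / t)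
      = flat ([:0, 0, 1:] * (p - pderiv p)) t"
    using greater by (simp add: flat_def power2_eq_square field_simps)
  ultimately have "((\<lambda>t. poly p (1 / t) * exp (- (1 / t))) has_real_derivative
      flat ([:0, 0, 1:] * (p - pderiv p)) t) (at t)" by simp
  then show ?thesis
    by (rule has_field_derivative_transform_within_open[of _ _ _ "{0<..}"]) (use greater in \<open>auto simp: flat_def\<close>)
qed

text \<open>
  The closure of the smooth functions under the operations needed below. The derivative of a member is
  again a member, so \<open>smooth_on_coinduct\<close> gives the smoothness of all members at once.
\<close>

inductive_set smooth_algebra :: "('a::euclidean_space \<Rightarrow> real) set" where
  smooth: "smooth_on UNIV f \<Longrightarrow> f \<in> smooth_algebra"
| const: "(\<lambda>x. c) \<in> smooth_algebra"
| inner: "(\<lambda>x. x \<bullet> v) \<in> smooth_algebra"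
| add: "f \<in> smooth_algebra \<Longrightarrow> g \<in> smooth_algebra \<Longrightarrow> (\<lambda>x. f x + g x) \<in> smooth_algebra"
| mult: "f \<in> smooth_algebra \<Longrightarrow> g \<in> smooth_algebra \<Longrightarrow> (\<lambda>x. f x * g x) \<in> smooth_algebra"
| inverse: "f \<in> smooth_algebra \<Longrightarrow> (\<And>x. f x \<noteq> 0) \<Longrightarrow> (\<lambda>x. inverse (f x)) \<in> smooth_algebra"
| flat: "f \<in> smooth_algebra \<Longrightarrow> (\<lambda>x. flat p (f x)) \<in> smooth_algebra"
| shift: "f \<in> smooth_algebra \<Longrightarrow> (\<lambda>x. f (x + a)) \<in> smooth_algebra"

lemma smooth_on_frechet_derivative:
  assumes "smooth_on UNIV f"
  shows "(f has_derivative frechet_derivative f (at x)) (at x)"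
    and "smooth_on UNIV (\<lambda>x. frechet_derivative f (at x) v)"
proof -
  have "Ck_on (Suc k) UNIV f" for k using assms by (simp add: smooth_on_def)
  then have *: "f differentiable (at x)" "Ck_on k UNIV (\<lambda>x. frechet_derivative f (at x) v)" for k x v by auto
  show "(f has_derivative frechet_derivative f (at x)) (at x)" using *(1) frechet_derivative_works by blast
  show "smooth_on UNIV (\<lambda>x. frechet_derivative f (at x) v)" using *(2) by (simp add: smooth_on_def)
qed

lemmas smooth_algebra_intros =
  smooth_algebra.const smooth_algebra.inner smooth_algebra.add smooth_algebra.mult
  smooth_algebra.inverse smooth_algebra.flat

lemma smooth_algebra_smooth:
  assumes "f \<in> smooth_algebra"
  shows "smooth_on UNIV f"
proof (rule smooth_on_coinduct[OF assms])
  fix f :: "'a \<Rightarrow> real" assume "f \<in> smooth_algebra"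
  then show "\<exists>f'. (\<forall>x. (f has_derivative f' x) (at x)) \<and> (\<forall>v. (\<lambda>x. f' x v) \<in> smooth_algebra)"
  proof (induction rule: smooth_algebra.induct)
    case (smooth f)
    show ?case
    proof (intro exI conjI allI)
      show "(f has_derivative frechet_derivative f (at x)) (at x)" for x
        by (rule smooth_on_frechet_derivative(1)[OF smooth])
      show "(\<lambda>x. frechet_derivative f (at x) v) \<in> smooth_algebra" for v
        by (rule smooth_algebra.smooth[OF smooth_on_frechet_derivative(2)[OF smooth]])
    qed
  next
    case (const c)
    show ?case by (intro exI[of _ "\<lambda>x v. 0"] conjI allI has_derivative_const smooth_algebra.const)
  next
    case (inner w)
    show ?case
    proof (intro exI conjI allI)
      show "((\<lambda>x. x \<bullet> w) has_derivative (\<lambda>v. v \<bullet> w)) (at x)" for x by (auto intro!: derivative_eq_intros)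
      show "(\<lambda>x. v \<bullet> w) \<in> smooth_algebra" for v by (rule smooth_algebra.const)
    qed
  next
    case (add f g)
    then obtain f' g' where *: "\<And>x. (f has_derivative f' x) (at x)" "\<And>v. (\<lambda>x. f' x v) \<in> smooth_algebra"
      "\<And>x. (g has_derivative g' x) (at x)" "\<And>v. (\<lambda>x. g' x v) \<in> smooth_algebra" by metis
    show ?case
    proof (intro exI conjI allI)
      show "((\<lambda>x. f x + g x) has_derivative (\<lambda>v. f' x v + g' x v)) (at x)" for x
        by (rule has_derivative_add[OF *(1,3)])
      show "(\<lambda>x. f' x v + g' x v) \<in> smooth_algebra" for v by (rule smooth_algebra.add[OF *(2,4)])
    qed
  next
    case (mult f g)
    then obtain f' g' where *: "\<And>x. (f has_derivative f' x) (at x)" "\<And>v. (\<lambda>x. f' x v) \<in> smooth_algebra"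
      "\<And>x. (g has_derivative g' x) (at x)" "\<And>v. (\<lambda>x. g' x v) \<in> smooth_algebra" by metis
    show ?case
    proof (intro exI conjI allI)
      show "((\<lambda>x. f x * g x) has_derivative (\<lambda>v. f x * g' x v + f' x v * g x)) (at x)" for x
        by (rule has_derivative_mult[OF *(1,3)])
      show "(\<lambda>x. f x * g' x v + f' x v * g x) \<in> smooth_algebra" for v
        by (intro smooth_algebra.add smooth_algebra.mult mult.hyps *(2,4))
    qed
  next
    case (inverse f)
    then obtain f' where *: "\<And>x. (f has_derivative f' x) (at x)" "\<And>v. (\<lambda>x. f' x v) \<in> smooth_algebra" by metis
    show ?case
    proof (intro exI conjI allI)
      show "((\<lambda>x. inverse (f x)) has_derivative (\<lambda>v. (- 1) * (inverse (f x) * (f' x v * inverse (f x))))) (at x)" for x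
        using Deriv.has_derivative_inverse[OF inverse.hyps(2) *(1)] by (simp add: mult.assoc)
      show "(\<lambda>x. (- 1) * (inverse (f x) * (f' x v * inverse (f x)))) \<in> smooth_algebra" for v
        by (intro smooth_algebra.const smooth_algebra.mult smooth_algebra.inverse inverse.hyps *(2))
    qed
  next
    case (flat f p)
    then obtain f' where *: "\<And>x. (f has_derivative f' x) (at x)" "\<And>v. (\<lambda>x. f' x v) \<in> smooth_algebra" by metis
    show ?case
    proof (intro exI conjI allI)
      show "((\<lambda>x. flat p (f x)) has_derivative (\<lambda>v. flat ([:0, 0, 1:] * (p - pderiv p)) (f x) * f' x v)) (at x)" for x
        by (rule has_derivative_compose[OF *(1) flat_has_derivative[unfolded has_field_derivative_def]])
      show "(\<lambda>x. flat ([:0, 0, 1:] * (p - pderiv p)) (f x) * f' x v) \<in> smooth_algebra" for v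
        by (intro smooth_algebra.mult smooth_algebra.flat flat.hyps *(2))
    qed
  next
    case (shift f a)
    then obtain f' where *: "\<And>x. (f has_derivative f' x) (at x)" "\<And>v. (\<lambda>x. f' x v) \<in> smooth_algebra" by metis
    show ?case
    proof (intro exI conjI allI)
      show "((\<lambda>x. f (x + a)) has_derivative (\<lambda>v. f' (x + a) v)) (at x)" for x
        by (rule has_derivative_compose[of "\<lambda>x. x + a" "\<lambda>v. v", OF _ *(1)]) (auto intro!: derivative_eq_intros)
      show "(\<lambda>x. f' (x + a) v) \<in> smooth_algebra" for v by (rule smooth_algebra.shift[OF *(2)])
    qed
  qed
qed

lemma smooth_algebra_prod:
  "(\<And>i. i \<in> I \<Longrightarrow> f i \<in> smooth_algebra) \<Longrightarrow> (\<lambda>x. \<Prod>i\<in>I. f i x) \<in> smooth_algebra"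
  by (induction I rule: infinite_finite_induct) (auto intro: smooth_algebra.add smooth_algebra.mult smooth_algebra.const)

lemma smooth_algebra_sum:
  "(\<And>i. i \<in> I \<Longrightarrow> f i \<in> smooth_algebra) \<Longrightarrow> (\<lambda>x. \<Sum>i\<in>I. f i x) \<in> smooth_algebra"
  by (induction I rule: infinite_finite_induct) (auto intro: smooth_algebra.add smooth_algebra.mult smooth_algebra.const)

lemma smooth_algebra_diff:
  assumes "f \<in> smooth_algebra" "g \<in> smooth_algebra"
  shows "(\<lambda>x. f x - g x) \<in> smooth_algebra"
proof -
  have "(\<lambda>x. f x + (- 1) * g x) \<in> smooth_algebra" by (intro smooth_algebra_intros assms)
  then show ?thesis by simp
qed

text \<open>
  Smooth, 0 for \<open>t \<le> 0\<close> and 1 for \<open>t \<ge> 1\<close>; composing with it turns a nonnegative bump into a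
  function that is equal to 1 on a prescribed set.
\<close>

definition smooth_step :: "real \<Rightarrow> real" where
  "smooth_step t = flat 1 t / (flat 1 t + flat 1 (1 - t))"

lemma flat_1_nonneg: "0 \<le> flat 1 t" by (simp add: flat_def)
lemma flat_1_pos_iff: "0 < flat 1 t \<longleftrightarrow> 0 < t" by (simp add: flat_def)

lemma smooth_step_denominator_pos: "0 < flat 1 t + flat 1 (1 - t)"
  using flat_1_pos_iff[of t] flat_1_pos_iff[of "1 - t"] flat_1_nonneg[of t] flat_1_nonneg[of "1 - t"]
  by linarith

lemma smooth_step_eq_0: "t \<le> 0 \<Longrightarrow> smooth_step t = 0"
  by (simp add: smooth_step_def flat_def)

lemma smooth_step_eq_1: "1 \<le> t \<Longrightarrow> smooth_step t = 1"
  by (simp add: smooth_step_def flat_def)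

lemma smooth_step_bounds: "0 \<le> smooth_step t" "smooth_step t \<le> 1"
  using smooth_step_denominator_pos[of t] flat_1_nonneg[of t] flat_1_nonneg[of "1 - t"]
  by (auto simp: smooth_step_def)

lemma smooth_algebra_smooth_step: "f \<in> smooth_algebra \<Longrightarrow> (\<lambda>x. smooth_step (f x)) \<in> smooth_algebra"
  unfolding smooth_step_def divide_inverse
  by (intro smooth_algebra_intros smooth_algebra_diff less_imp_neq[THEN not_sym] smooth_step_denominator_pos)

definition box_bump :: "'a::euclidean_space \<Rightarrow> 'a \<Rightarrow> 'a \<Rightarrow> real" where
  "box_bump a b x = (\<Prod>e\<in>Basis. flat 1 (x \<bullet> e - a \<bullet> e) * flat 1 (b \<bullet> e - x \<bullet> e))"

lemma smooth_algebra_box_bump: "box_bump a b \<in> smooth_algebra"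
  unfolding box_bump_def[abs_def]
  by (intro smooth_algebra_prod smooth_algebra_intros smooth_algebra_diff)

lemma box_bump_nonneg: "0 \<le> box_bump a b x"
  unfolding box_bump_def by (intro prod_nonneg mult_nonneg_nonneg flat_1_nonneg ballI)

lemma box_bump_pos_iff: "0 < box_bump a b x \<longleftrightarrow> x \<in> box a b"
proof
  assume "x \<in> box a b"
  then show "0 < box_bump a b x"
    unfolding box_bump_def by (intro prod_pos ballI mult_pos_pos) (auto simp: flat_1_pos_iff mem_box)
next
  assume pos: "0 < box_bump a b x"
  show "x \<in> box a b"
  proof (rule ccontr)
    assume "x \<notin> box a b"
    then obtain e where "e \<in> Basis" "\<not> (a \<bullet> e < x \<bullet> e \<and> x \<bullet> e < b \<bullet> e)"
      unfolding mem_box by blast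
    then have "box_bump a b x = 0"
      unfolding box_bump_def by (intro prod_zero bexI[of _ e]) (auto simp: flat_def not_less)
    then show False using pos by simp
  qed
qed

lemma box_bump_eq_0: "x \<notin> box a b \<Longrightarrow> box_bump a b x = 0"
  using box_bump_pos_iff[of a b x] box_bump_nonneg[of a b x] by linarith

text \<open>
  An open set is a countable union of boxes. With \<open>s\<close> a smooth function that is 1 on more and more of
  the respective box, \<open>1 - \<Prod>(1 - s)\<close> approximates the indicator function of the union.
\<close>

lemma smooth_approx_indicator_open:
  fixes V :: "'a::euclidean_space set"
  assumes "open V"
  obtains \<phi> :: "nat \<Rightarrow> 'a \<Rightarrow> real" where "\<And>n. smooth_on UNIV (\<phi> n)"
    "\<And>n x. 0 \<le> \<phi> n x" "\<And>n x. \<phi> n x \<le> 1" "\<And>n x. x \<notin> V \<Longrightarrow> \<phi> n x = 0"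
    "\<And>x. x \<in> V \<Longrightarrow> (\<lambda>n. \<phi> n x) \<longlonglongrightarrow> 1"
proof -
  obtain D where D: "countable D" "D \<subseteq> Pow V" "\<And>X. X \<in> D \<Longrightarrow> \<exists>a b. X = box a b" "\<Union>D = V"
    using open_countable_Union_open_box[OF assms] by metis
  have "\<exists>c d. (\<forall>n::nat. box (c n) (d n) \<subseteq> V) \<and> (\<forall>X\<in>D. \<exists>n. X = box (c n) (d n))"
  proof (cases "D = {}")
    case True
    then show ?thesis by (intro exI[of _ "\<lambda>_. 0"]) auto
  next
    case False
    have "\<exists>p. from_nat_into D n = box (fst p) (snd p)" for n
      using D(3)[OF from_nat_into[OF False, of n]] by auto
    then obtain p where p: "\<And>n. from_nat_into D n = box (fst (p n)) (snd (p n))" by metis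
    have "box (fst (p n)) (snd (p n)) \<subseteq> V" for n
      using D(2) from_nat_into[OF False, of n] p[of n] by auto
    moreover have "\<exists>n. X = box (fst (p n)) (snd (p n))" if "X \<in> D" for X
      using from_nat_into_surj[OF D(1) that] p by metis
    ultimately show ?thesis
      by (intro exI[of _ "\<lambda>n. fst (p n)"] exI[of _ "\<lambda>n. snd (p n)"]) blast
  qed
  then obtain c d where cd: "\<And>n::nat. box (c n) (d n) \<subseteq> V" "\<And>X. X \<in> D \<Longrightarrow> \<exists>n. X = box (c n) (d n)"
    by metis
  define s where "s = (\<lambda>n i x. smooth_step (real n * box_bump (c i) (d i) x))"
  define \<phi> where "\<phi> = (\<lambda>n x. 1 - (\<Prod>i<n. 1 - s n i x))"
  have s01: "0 \<le> s n i x" "s n i x \<le> 1" for n i x by (auto simp: s_def smooth_step_bounds)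
  show ?thesis
  proof
    fix n x
    show "smooth_on UNIV (\<phi> n)"
      unfolding \<phi>_def s_def
      by (intro smooth_algebra_smooth smooth_algebra_diff smooth_algebra_prod smooth_algebra_smooth_step
          smooth_algebra_intros smooth_algebra_box_bump)
    show "0 \<le> \<phi> n x" unfolding \<phi>_def using s01 by (simp add: prod_le_1)
    show "\<phi> n x \<le> 1" unfolding \<phi>_def using s01 by (simp add: prod_nonneg)
    assume "x \<notin> V"
    then have "box_bump (c i) (d i) x = 0" for i
      using cd(1)[of i] by (intro box_bump_eq_0) auto
    then show "\<phi> n x = 0" by (simp add: \<phi>_def s_def smooth_step_eq_0)
  next
    fix x assume "x \<in> V"
    then obtain k where k: "x \<in> box (c k) (d k)" using D(4) cd(2) by blast
    then have pos: "0 < box_bump (c k) (d k) x" by (simp add: box_bump_pos_iff)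
    obtain N where N: "1 / box_bump (c k) (d k) x < real N" using reals_Archimedean2 by blast
    have "\<phi> n x = 1" if "n \<ge> max N (Suc k)" for n
    proof -
      have "1 \<le> real N * box_bump (c k) (d k) x" using N pos by (simp add: field_simps)
      also have "\<dots> \<le> real n * box_bump (c k) (d k) x" using that pos by (intro mult_right_mono) auto
      finally have "s n k x = 1" by (simp add: s_def smooth_step_eq_1)
      moreover have "k < n" using that by auto
      ultimately have "(\<Prod>i<n. 1 - s n i x) = 0" by (intro prod_zero) auto
      then show ?thesis by (simp add: \<phi>_def)
    qed
    then show "(\<lambda>n. \<phi> n x) \<longlonglongrightarrow> 1"
      by (intro tendsto_eventually eventually_sequentiallyI[of "max N (Suc k)"])
  qed
qed

text \<open>
  A sum of finitely many box bumps is positive on \<open>K\<close>, hence at least some \<open>\<delta> > 0\<close> there; the smooth step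
  applied to its multiple by \<open>1/\<delta>\<close> is the cut-off.
\<close>

lemma test_function_cutoff:
  fixes K :: "(real ^ 'n::finite) set"
  assumes "compact K" "open \<Omega>" "K \<subseteq> \<Omega>"
  obtains \<eta> where "test_function \<Omega> \<eta>" "\<And>x. x \<in> K \<Longrightarrow> \<eta> x = 1"
proof -
  have "\<exists>a b. x \<in> box a b \<and> cbox a b \<subseteq> \<Omega>" if "x \<in> K" for x
    using open_contains_cbox[of \<Omega>] assms that by (metis subsetD)
  then obtain a b where ab: "\<And>x. x \<in> K \<Longrightarrow> x \<in> box (a x) (b x) \<and> cbox (a x) (b x) \<subseteq> \<Omega>" by metis
  obtain C where C: "C \<subseteq> K" "finite C" "K \<subseteq> (\<Union>x\<in>C. box (a x) (b x))"
  proof (rule compactE_image[OF assms(1), of K "\<lambda>x. box (a x) (b x)"])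
    show "K \<subseteq> (\<Union>c\<in>K. box (a c) (b c))" using ab by blast
  qed (simp_all add: open_box)
  define \<Psi> where "\<Psi> = (\<lambda>x. \<Sum>c\<in>C. box_bump (a c) (b c) x)"
  have alg: "\<Psi> \<in> smooth_algebra" unfolding \<Psi>_def by (intro smooth_algebra_sum smooth_algebra_box_bump)
  have pos: "0 < \<Psi> x" if x: "x \<in> K" for x
  proof -
    obtain c where "c \<in> C" "x \<in> box (a c) (b c)" using C x by auto
    then show ?thesis unfolding \<Psi>_def
      by (intro sum_pos2[of _ c] C box_bump_nonneg) (auto simp: box_bump_pos_iff)
  qed
  have "Ck_on 0 UNIV \<Psi>" using smooth_algebra_smooth[OF alg] unfolding smooth_on_def by blast
  then have cont: "continuous_on K \<Psi>" by (auto intro: continuous_on_subset)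
  obtain \<delta> where \<delta>: "0 < \<delta>" "\<And>x. x \<in> K \<Longrightarrow> \<delta> \<le> \<Psi> x"
  proof (cases "K = {}")
    case False
    then obtain y where "y \<in> K" "\<forall>x\<in>K. \<Psi> y \<le> \<Psi> x"
      using continuous_attains_inf[OF assms(1) _ cont] by blast
    then show ?thesis using that pos by blast
  qed (use that[of 1] in auto)
  define \<eta> where "\<eta> = (\<lambda>x. smooth_step (\<Psi> x * inverse \<delta>))"
  have "{x. \<eta> x \<noteq> 0} \<subseteq> (\<Union>c\<in>C. cbox (a c) (b c))"
  proof clarify
    fix x assume "\<eta> x \<noteq> 0"
    then have "\<Psi> x \<noteq> 0" by (auto simp: \<eta>_def smooth_step_eq_0)
    then obtain c where "c \<in> C" "box_bump (a c) (b c) x \<noteq> 0"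
      unfolding \<Psi>_def by (auto elim: sum.not_neutral_contains_not_neutral)
    then show "x \<in> (\<Union>c\<in>C. cbox (a c) (b c))" using box_bump_eq_0[of x "a c" "b c"] box_subset_cbox[of "a c" "b c"] by blast
  qed
  moreover have comp: "compact (\<Union>c\<in>C. cbox (a c) (b c))" using C by (intro compact_UN) auto
  ultimately have sub: "closure {x. \<eta> x \<noteq> 0} \<subseteq> (\<Union>c\<in>C. cbox (a c) (b c))"
    by (simp add: closure_minimal compact_imp_closed)
  show ?thesis
  proof
    show "test_function \<Omega> \<eta>"
      unfolding test_function_def
    proof (intro conjI)
      show "smooth_on UNIV \<eta>" unfolding \<eta>_def
        by (intro smooth_algebra_smooth smooth_algebra_smooth_step smooth_algebra_intros alg)
      show "compact (closure {x. \<eta> x \<noteq> 0})"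
        using compact_Int_closed[OF comp closed_closure, of "{x. \<eta> x \<noteq> 0}"] sub by (simp add: Int_absorb1)
      have "(\<Union>c\<in>C. cbox (a c) (b c)) \<subseteq> \<Omega>" using C(1) ab by blast
      then show "closure {x. \<eta> x \<noteq> 0} \<subseteq> \<Omega>" using sub by (rule subset_trans[rotated])
    qed
    fix x assume "x \<in> K"
    then show "\<eta> x = 1"
      using \<delta> by (auto simp: \<eta>_def field_simps intro!: smooth_step_eq_1)
  qed
qed

section \<open>Square integrable functions\<close>

text \<open>
  Membership in \<open>L\<^sup>2\<close> for an arbitrary measure.
\<close>

definition sq_integrable :: "'a measure \<Rightarrow> ('a \<Rightarrow> 'b::euclidean_space) \<Rightarrow> bool" where
  "sq_integrable M f \<longleftrightarrow> f \<in> borel_measurable M \<and> integrable M (\<lambda>x. (norm (f x))\<^sup>2)"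

lemma sq_integrable_measurable: "sq_integrable M f \<Longrightarrow> f \<in> borel_measurable M"
  by (simp add: sq_integrable_def)

lemma sq_integrable_norm_sq: "sq_integrable M f \<Longrightarrow> integrable M (\<lambda>x. (norm (f x))\<^sup>2)"
  by (simp add: sq_integrable_def)

lemma norm_add_sq_le: "(norm (a + b))\<^sup>2 \<le> 2 * (norm a)\<^sup>2 + 2 * (norm (b::'b::real_inner))\<^sup>2"
proof -
  have "(norm (a + b))\<^sup>2 + (norm (a - b))\<^sup>2 = 2 * (norm a)\<^sup>2 + 2 * (norm b)\<^sup>2"
    by (simp add: power2_norm_eq_inner algebra_simps inner_commute)
  then show ?thesis using zero_le_power2[of "norm (a - b)"] by linarith
qed

lemma sq_integrable_bound:
  assumes "sq_integrable M f" "g \<in> borel_measurable M" "AE x in M. norm (g x) \<le> c * norm (f x)"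
  shows "sq_integrable M g"
  unfolding sq_integrable_def
proof
  show "integrable M (\<lambda>x. (norm (g x))\<^sup>2)"
  proof (rule Bochner_Integration.integrable_bound)
    show "integrable M (\<lambda>x. c\<^sup>2 * (norm (f x))\<^sup>2)" using assms(1) by (simp add: sq_integrable_def)
    show "AE x in M. norm ((norm (g x))\<^sup>2) \<le> norm (c\<^sup>2 * (norm (f x))\<^sup>2)"
      using assms(3) by eventually_elim (simp add: power_mono flip: power_mult_distrib)
  qed (use assms(2) in measurable)
qed (use assms in simp)

lemma sq_integrable_add:
  assumes "sq_integrable M f" "sq_integrable M g"
  shows "sq_integrable M (\<lambda>x. f x + g x)"
  unfolding sq_integrable_def
proof
  note [measurable] = assms[THEN sq_integrable_measurable]
  show m: "(\<lambda>x. f x + g x) \<in> borel_measurable M" by measurable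
  show "integrable M (\<lambda>x. (norm (f x + g x))\<^sup>2)"
  proof (rule Bochner_Integration.integrable_bound)
    show "integrable M (\<lambda>x. 2 * (norm (f x))\<^sup>2 + 2 * (norm (g x))\<^sup>2)"
      using assms by (simp add: sq_integrable_def)
  qed (use m norm_add_sq_le in auto)
qed

lemma sq_integrable_scaleR:
  assumes "sq_integrable M f"
  shows "sq_integrable M (\<lambda>x. c *\<^sub>R f x)"
  using assms by (rule sq_integrable_bound[where c = "\<bar>c\<bar>"]) (use assms in \<open>auto simp: sq_integrable_def\<close>)

lemma sq_integrable_diff:
  assumes "sq_integrable M f" "sq_integrable M g"
  shows "sq_integrable M (\<lambda>x. f x - g x)"
  using sq_integrable_add[OF assms(1) sq_integrable_scaleR[OF assms(2), of "-1"]] by simp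

lemma sq_integrable_0: "sq_integrable M (\<lambda>x. 0)" by (simp add: sq_integrable_def)

lemma sq_integrable_sum:
  "(\<And>i. i \<in> I \<Longrightarrow> sq_integrable M (f i)) \<Longrightarrow> sq_integrable M (\<lambda>x. \<Sum>i\<in>I. f i x)"
  by (induction I rule: infinite_finite_induct) (auto intro: sq_integrable_add sq_integrable_0)

lemma sq_integrable_linear:
  assumes "linear h" "sq_integrable M f"
  shows "sq_integrable M (\<lambda>x. h (f x))"
proof -
  obtain B where B: "\<And>x. norm (h x) \<le> B * norm x" using linear_bounded[OF assms(1)] by blast
  have "continuous_on UNIV h" using assms(1) by (simp add: linear_continuous_on linear_conv_bounded_linear)
  then have "h \<in> borel_measurable borel" by (rule borel_measurable_continuous_onI)
  then have "(\<lambda>x. h (f x)) \<in> borel_measurable M" using assms(2) by (auto simp: sq_integrable_def)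
  then show ?thesis using sq_integrable_bound[OF assms(2)] B by auto
qed

lemma sq_integrable_component:
  "sq_integrable M f \<Longrightarrow> sq_integrable M (\<lambda>x. f x $ i)" for f :: "'a \<Rightarrow> 'b::euclidean_space ^ 'n"
  using sq_integrable_linear[of "\<lambda>v. v $ i"]
  by (simp add: linear_conv_bounded_linear bounded_linear_vec_nth)

lemma sq_integrable_inner:
  assumes "sq_integrable M f" "sq_integrable M g"
  shows "integrable M (\<lambda>x. f x \<bullet> g x)"
proof (rule Bochner_Integration.integrable_bound)
  note [measurable] = assms[THEN sq_integrable_measurable]
  show "integrable M (\<lambda>x. (norm (f x))\<^sup>2 + (norm (g x))\<^sup>2)"
    using assms by (simp add: sq_integrable_def)
  show "(\<lambda>x. f x \<bullet> g x) \<in> borel_measurable M" by measurable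
  have "\<bar>a \<bullet> b\<bar> \<le> (norm a)\<^sup>2 + (norm b)\<^sup>2" for a b :: 'b
    using Cauchy_Schwarz_ineq2[of a b] sum_squares_bound[of "norm a" "norm b"]
      mult_nonneg_nonneg[OF norm_ge_zero[of a] norm_ge_zero[of b]] by linarith
  then show "AE x in M. norm (f x \<bullet> g x) \<le> norm ((norm (f x))\<^sup>2 + (norm (g x))\<^sup>2)" by simp
qed

lemma sq_integrable_mult:
  fixes f g :: "'a \<Rightarrow> real"
  shows "sq_integrable M f \<Longrightarrow> sq_integrable M g \<Longrightarrow> integrable M (\<lambda>x. f x * g x)"
  using sq_integrable_inner[of M f g] by simp

lemma integral_norm_sq_nonneg: "0 \<le> (\<integral>x. (norm (f x))\<^sup>2 \<partial>M)" by simp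

lemma Cauchy_Schwarz_integral:
  assumes f: "sq_integrable M f" and g: "sq_integrable M g"
  shows "\<bar>\<integral>x. f x \<bullet> g x \<partial>M\<bar> \<le> sqrt (\<integral>x. (norm (f x))\<^sup>2 \<partial>M) * sqrt (\<integral>x. (norm (g x))\<^sup>2 \<partial>M)"
proof -
  define a b c where "a = (\<integral>x. (norm (f x))\<^sup>2 \<partial>M)" and "b = (\<integral>x. f x \<bullet> g x \<partial>M)"
    and "c = (\<integral>x. (norm (g x))\<^sup>2 \<partial>M)"
  have quad: "0 \<le> a - 2 * t * b + t\<^sup>2 * c" for t
  proof -
    have "(norm (f x - t *\<^sub>R g x))\<^sup>2 = (norm (f x))\<^sup>2 - 2 * t * (f x \<bullet> g x) + t\<^sup>2 * (norm (g x))\<^sup>2" for x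
      unfolding power2_norm_eq_inner
      by (simp add: inner_diff_left inner_diff_right inner_commute power2_eq_square algebra_simps)
    then have "(\<integral>x. (norm (f x - t *\<^sub>R g x))\<^sup>2 \<partial>M) = a - 2 * t * b + t\<^sup>2 * c"
      using f g sq_integrable_inner[OF f g] by (simp add: a_def b_def c_def sq_integrable_def)
    then show ?thesis by (metis integral_norm_sq_nonneg)
  qed
  have "0 \<le> a" "0 \<le> c" by (auto simp: a_def c_def)
  have "b\<^sup>2 \<le> a * c"
  proof (cases "c = 0")
    case True
    have "b = 0"
    proof (rule ccontr)
      assume "b \<noteq> 0"
      then show False using quad[of "(a + 1) / (2 * b)"] True by simp
    qed
    then show ?thesis using True by simp
  next
    case False
    then have "0 < c" using \<open>0 \<le> c\<close> by simp
    then show ?thesis using quad[of "b / c"] by (simp add: field_simps power2_eq_square)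
  qed
  then show ?thesis unfolding a_def[symmetric] b_def[symmetric] c_def[symmetric]
    by (metis real_sqrt_abs real_sqrt_le_iff real_sqrt_mult)
qed

lemma integral_norm_sq_add_le:
  assumes "sq_integrable M f" "sq_integrable M g"
  shows "(\<integral>x. (norm (f x + g x))\<^sup>2 \<partial>M) \<le> 2 * (\<integral>x. (norm (f x))\<^sup>2 \<partial>M) + 2 * (\<integral>x. (norm (g x))\<^sup>2 \<partial>M)"
proof -
  have "(\<integral>x. (norm (f x + g x))\<^sup>2 \<partial>M) \<le> (\<integral>x. 2 * (norm (f x))\<^sup>2 + 2 * (norm (g x))\<^sup>2 \<partial>M)"
    using assms sq_integrable_add[OF assms]
    by (intro integral_mono norm_add_sq_le) (auto simp: sq_integrable_def)
  then show ?thesis using assms by (simp add: sq_integrable_def)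
qed

text \<open>
  If \<open>h\<^sub>n\<close> is the \<open>n\<close>-th difference, then \<open>|h\<^sub>n| \<le> 2\<^sup>-\<^sup>n + 2\<^sup>n |h\<^sub>n|\<^sup>2\<close>, and the integrals of the
  second summands form a convergent series; so \<open>\<Sum> |h\<^sub>n|\<close> is finite almost everywhere. This also works
  for infinite measures, where square integrable functions need not be integrable.
\<close>

lemma Cauchy_L2_AE_convergent_subseq:
  fixes f :: "nat \<Rightarrow> 'a \<Rightarrow> 'b::euclidean_space"
  assumes f: "\<And>n. sq_integrable M (f n)"
    and r: "\<And>n. (\<integral>x. (norm (f (r (Suc n)) x - f (r n) x))\<^sup>2 \<partial>M) \<le> (1 / 4) ^ n"
  shows "AE x in M. convergent (\<lambda>n. f (r n) x)"
proof -
  define h where "h n x = f (r (Suc n)) x - f (r n) x" for n x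
  have sq: "sq_integrable M (h n)" for n unfolding h_def by (intro sq_integrable_diff f)
  note [measurable] = sq[THEN sq_integrable_measurable]
  have "(\<integral>\<^sup>+x. ennreal (2 ^ n * (norm (h n x))\<^sup>2) \<partial>M) \<le> ennreal ((1 / 2) ^ n)" for n
  proof -
    have "(\<integral>\<^sup>+x. ennreal (2 ^ n * (norm (h n x))\<^sup>2) \<partial>M) = ennreal (\<integral>x. 2 ^ n * (norm (h n x))\<^sup>2 \<partial>M)"
      using sq[of n] by (intro nn_integral_eq_integral) (auto simp: sq_integrable_def)
    also have "(\<integral>x. 2 ^ n * (norm (h n x))\<^sup>2 \<partial>M) = 2 ^ n * (\<integral>x. (norm (h n x))\<^sup>2 \<partial>M)" by simp
    also have "\<dots> \<le> 2 ^ n * (1 / 4) ^ n" using r[of n] unfolding h_def by (intro mult_left_mono) auto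
    also have "\<dots> = (1 / 2) ^ n" by (simp flip: power_mult_distrib)
    finally show ?thesis by (simp add: ennreal_leI)
  qed
  then have "(\<Sum>n. \<integral>\<^sup>+x. ennreal (2 ^ n * (norm (h n x))\<^sup>2) \<partial>M) \<le> (\<Sum>n. ennreal ((1 / 2) ^ n))"
    by (intro suminf_le) auto
  also have "\<dots> < \<infinity>" by (subst suminf_ennreal2) (auto intro: summable_geometric)
  finally have "(\<integral>\<^sup>+x. (\<Sum>n. ennreal (2 ^ n * (norm (h n x))\<^sup>2)) \<partial>M) < \<infinity>"
    by (subst nn_integral_suminf) auto
  then have "AE x in M. (\<Sum>n. ennreal (2 ^ n * (norm (h n x))\<^sup>2)) \<noteq> \<infinity>"
    by (intro nn_integral_PInf_AE) auto
  then show ?thesis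
  proof eventually_elim
    case (elim x)
    then have "summable (\<lambda>n. 2 ^ n * (norm (h n x))\<^sup>2)"
      by (intro summable_suminf_not_top) auto
    then have s: "summable (\<lambda>n. (1 / 2) ^ n + 2 ^ n * (norm (h n x))\<^sup>2)"
      by (intro summable_add summable_geometric) auto
    have "norm (h n x) \<le> (1 / 2) ^ n + 2 ^ n * (norm (h n x))\<^sup>2" for n
    proof -
      define t where "t = norm (h n x)"
      have p: "(2::real) ^ n > 0" "(1 / 2 :: real) ^ n = 1 / 2 ^ n" by (auto simp: power_divide)
      have "y \<le> 1 + y\<^sup>2" if "0 \<le> y" for y :: real
        using sum_squares_bound[of y 1] that by simp
      from this[of "2 ^ n * t"] have "2 ^ n * t \<le> 1 + (2 ^ n * t)\<^sup>2" by (simp add: t_def)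
      then have "2 ^ n * t \<le> 2 ^ n * ((1 / 2) ^ n + 2 ^ n * t\<^sup>2)"
        using p by (simp add: power2_eq_square algebra_simps)
      then show ?thesis unfolding t_def[symmetric] using p by simp
    qed
    then have "summable (\<lambda>n. h n x)" by (intro summable_comparison_test'[OF s]) auto
    then have "convergent (\<lambda>n. \<Sum>k<n. h k x)" by (simp add: summable_iff_convergent)
    then have "convergent (\<lambda>n. f (r n) x - f (r 0) x)"
      unfolding h_def by (subst (asm) sum_lessThan_telescope)
    then have "convergent (\<lambda>n. (f (r n) x - f (r 0) x) + f (r 0) x)" by (intro convergent_add convergent_const)
    then show ?case by simp
  qed
qed

text \<open>
  A rapidly convergent subsequence converges almost everywhere, and Fatou's lemma shows that its
  pointwise limit is the limit in \<open>L\<^sup>2\<close>. Pointwise convergence is recorded because the equation is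
  verified pointwise.
\<close>

lemma L2_complete:
  fixes f :: "nat \<Rightarrow> 'a \<Rightarrow> 'b::euclidean_space"
  assumes f: "\<And>n. sq_integrable M (f n)"
    and Cauchy: "\<And>e. e > 0 \<Longrightarrow> \<exists>N. \<forall>j\<ge>N. \<forall>k\<ge>N. (\<integral>x. (norm (f j x - f k x))\<^sup>2 \<partial>M) < e"
  obtains g r where "sq_integrable M g" "strict_mono (r :: nat \<Rightarrow> nat)"
    "AE x in M. (\<lambda>n. f (r n) x) \<longlonglongrightarrow> g x" "(\<lambda>n. \<integral>x. (norm (f n x - g x))\<^sup>2 \<partial>M) \<longlonglongrightarrow> 0"
proof -
  note [measurable] = f[THEN sq_integrable_measurable]
  have "\<exists>r. \<forall>n. (\<forall>j\<ge>r n. \<forall>k\<ge>r n. (\<integral>x. (norm (f j x - f k x))\<^sup>2 \<partial>M) < (1 / 4) ^ n) \<and> (r (n::nat)::nat) < r (Suc n)"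
  proof (rule dependent_nat_choice)
    show "\<exists>N. \<forall>j\<ge>N. \<forall>k\<ge>N. (\<integral>x. (norm (f j x - f k x))\<^sup>2 \<partial>M) < (1 / 4) ^ 0"
      using Cauchy[of 1] by simp
    fix N n
    obtain N' where "\<forall>j\<ge>N'. \<forall>k\<ge>N'. (\<integral>x. (norm (f j x - f k x))\<^sup>2 \<partial>M) < (1 / 4) ^ Suc n"
      using Cauchy[of "(1 / 4) ^ Suc n"] by auto
    then show "\<exists>y. (\<forall>j\<ge>y. \<forall>k\<ge>y. (\<integral>x. (norm (f j x - f k x))\<^sup>2 \<partial>M) < (1 / 4) ^ Suc n) \<and> N < y"
      by (intro exI[of _ "max N' (Suc N)"]) auto
  qed
  then obtain r where r: "\<And>n j k. j \<ge> r n \<Longrightarrow> k \<ge> r n \<Longrightarrow> (\<integral>x. (norm (f j x - f k x))\<^sup>2 \<partial>M) < (1 / 4) ^ n"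
    and less: "\<And>n. r n < r (Suc n)" by blast
  have mono: "strict_mono r" using less by (simp add: strict_mono_Suc_iff)
  have AE_conv: "AE x in M. convergent (\<lambda>n. f (r n) x)"
    by (rule Cauchy_L2_AE_convergent_subseq[OF f]) (use r less in \<open>auto intro!: less_imp_le\<close>)
  define g where "g x = lim (\<lambda>n. f (r n) x)" for x
  have g[measurable]: "g \<in> borel_measurable M" unfolding g_def by measurable
  have AE_lim: "AE x in M. (\<lambda>n. f (r n) x) \<longlonglongrightarrow> g x"
    using AE_conv by eventually_elim (simp add: g_def convergent_LIMSEQ_iff)
  have bound: "(\<integral>\<^sup>+x. ennreal ((norm (f j x - g x))\<^sup>2) \<partial>M) \<le> ennreal ((1 / 4) ^ n)" if j: "j \<ge> r n" for n j
  proof -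
    have "(\<integral>\<^sup>+x. ennreal ((norm (f j x - g x))\<^sup>2) \<partial>M) =
        (\<integral>\<^sup>+x. liminf (\<lambda>k. ennreal ((norm (f j x - f (r k) x))\<^sup>2)) \<partial>M)"
    proof (rule nn_integral_cong_AE, use AE_lim in eventually_elim)
      case (elim x)
      then have "(\<lambda>k. ennreal ((norm (f j x - f (r k) x))\<^sup>2)) \<longlonglongrightarrow> ennreal ((norm (f j x - g x))\<^sup>2)"
        by (intro tendsto_intros)
      then show ?case by (intro lim_imp_Liminf[symmetric]) auto
    qed
    also have "\<dots> \<le> liminf (\<lambda>k. \<integral>\<^sup>+x. ennreal ((norm (f j x - f (r k) x))\<^sup>2) \<partial>M)"
      by (rule nn_integral_liminf) measurable
    also have "\<dots> \<le> liminf (\<lambda>k. ennreal ((1 / 4) ^ n))"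
    proof (rule Liminf_mono, rule eventually_sequentiallyI)
      fix k assume "n \<le> k"
      then have "r n \<le> r k" using mono by (simp add: strict_mono_less_eq)
      have "(\<integral>\<^sup>+x. ennreal ((norm (f j x - f (r k) x))\<^sup>2) \<partial>M) = ennreal (\<integral>x. (norm (f j x - f (r k) x))\<^sup>2 \<partial>M)"
        by (intro nn_integral_eq_integral sq_integrable_norm_sq sq_integrable_diff f) auto
      then show "(\<integral>\<^sup>+x. ennreal ((norm (f j x - f (r k) x))\<^sup>2) \<partial>M) \<le> ennreal ((1 / 4) ^ n)"
        using r[OF j \<open>r n \<le> r k\<close>] by (simp add: ennreal_leI)
    qed
    also have "\<dots> = ennreal ((1 / 4) ^ n)" by (simp add: Liminf_const)
    finally show ?thesis .
  qed
  have sq_diff: "sq_integrable M (\<lambda>x. f (r 0) x - g x)"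
    unfolding sq_integrable_def integrable_iff_bounded
    using bound[of 0 "r 0"] by (auto intro: le_less_trans)
  have sq: "sq_integrable M g"
    using sq_integrable_diff[OF f sq_diff, of "r 0"] by simp
  have int_le: "(\<integral>x. (norm (f j x - g x))\<^sup>2 \<partial>M) \<le> (1 / 4) ^ n" if "j \<ge> r n" for n j
  proof -
    have "ennreal (\<integral>x. (norm (f j x - g x))\<^sup>2 \<partial>M) = (\<integral>\<^sup>+x. ennreal ((norm (f j x - g x))\<^sup>2) \<partial>M)"
      by (intro nn_integral_eq_integral[symmetric] sq_integrable_norm_sq sq_integrable_diff f sq) auto
    also note bound[OF that]
    finally show ?thesis by (subst (asm) ennreal_le_iff) auto
  qed
  have "(\<lambda>n. \<integral>x. (norm (f n x - g x))\<^sup>2 \<partial>M) \<longlonglongrightarrow> 0"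
  proof (rule LIMSEQ_I)
    fix e :: real assume "0 < e"
    then obtain n where "(1 / 4 :: real) ^ n < e" using real_arch_pow_inv[of e "1 / 4"] by auto
    then show "\<exists>N. \<forall>j\<ge>N. norm ((\<integral>x. (norm (f j x - g x))\<^sup>2 \<partial>M) - 0) < e"
      using int_le[of n] by (intro exI[of _ "r n"]) (auto intro: le_less_trans)
  qed
  then show ?thesis using that sq mono AE_lim by blast
qed

section \<open>Test functions are dense\<close>

abbreviation pderiv_at :: "'n::finite \<Rightarrow> (real ^ 'n \<Rightarrow> real) \<Rightarrow> real ^ 'n \<Rightarrow> real" where
  "pderiv_at i \<phi> x \<equiv> frechet_derivative \<phi> (at x) (axis i 1)"

lemma smooth_on_continuous: "smooth_on UNIV \<phi> \<Longrightarrow> continuous_on UNIV \<phi>"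
  unfolding smooth_on_def by (metis Ck_on.simps(1))

lemma smooth_on_mult: "smooth_on UNIV f \<Longrightarrow> smooth_on UNIV g \<Longrightarrow> smooth_on UNIV (\<lambda>x. f x * g x :: real)"
  by (rule smooth_algebra_smooth[OF smooth_algebra.mult[OF smooth_algebra.smooth smooth_algebra.smooth]])

lemma smooth_on_add: "smooth_on UNIV f \<Longrightarrow> smooth_on UNIV g \<Longrightarrow> smooth_on UNIV (\<lambda>x. f x + g x :: real)"
  by (rule smooth_algebra_smooth[OF smooth_algebra.add[OF smooth_algebra.smooth smooth_algebra.smooth]])

lemma smooth_on_shift: "smooth_on UNIV f \<Longrightarrow> smooth_on UNIV (\<lambda>x. f (x + a) :: real)"
  by (rule smooth_algebra_smooth[OF smooth_algebra.shift[OF smooth_algebra.smooth]])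

lemma smooth_on_const: "smooth_on UNIV (\<lambda>x. c :: real)"
  by (rule smooth_algebra_smooth[OF smooth_algebra.const])

lemma test_function_smooth: "test_function \<Omega> \<phi> \<Longrightarrow> smooth_on UNIV \<phi>"
  by (simp add: test_function_def)

lemma test_functionI:
  assumes "smooth_on UNIV \<phi>" "compact K" "K \<subseteq> \<Omega>" "\<And>x. x \<notin> K \<Longrightarrow> \<phi> x = 0"
  shows "test_function \<Omega> \<phi>"
proof -
  have sub: "closure {x. \<phi> x \<noteq> 0} \<subseteq> K"
    using assms by (intro closure_minimal compact_imp_closed) auto
  then have "compact (closure {x. \<phi> x \<noteq> 0})"
    using compact_Int_closed[OF assms(2) closed_closure, of "{x. \<phi> x \<noteq> 0}"] by (simp add: Int_absorb1)
  then show ?thesis using assms sub by (auto simp: test_function_def)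
qed

lemma test_function_support:
  assumes "test_function \<Omega> \<phi>"
  obtains K where "compact K" "K \<subseteq> \<Omega>" "\<And>x. x \<notin> K \<Longrightarrow> \<phi> x = 0"
proof
  show "compact (closure {x. \<phi> x \<noteq> 0})" "closure {x. \<phi> x \<noteq> 0} \<subseteq> \<Omega>"
    using assms by (auto simp: test_function_def)
  show "\<phi> x = 0" if "x \<notin> closure {x. \<phi> x \<noteq> 0}" for x
    using that closure_subset[of "{x. \<phi> x \<noteq> 0}"] by auto
qed

lemma test_function_mono: "test_function U \<phi> \<Longrightarrow> U \<subseteq> \<Omega> \<Longrightarrow> test_function \<Omega> \<phi>"
  by (auto simp: test_function_def)

lemma pderiv_at_eq_0:
  assumes "closed K" "\<And>x. x \<notin> K \<Longrightarrow> \<phi> x = 0" "x \<notin> K"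
  shows "pderiv_at i \<phi> x = 0"
proof -
  have "(\<phi> has_derivative (\<lambda>v. 0)) (at x)"
    by (rule has_derivative_transform_within_open[of "\<lambda>x. 0" _ _ _ "- K"]) (use assms in auto)
  then show ?thesis using frechet_derivative_at by metis
qed

lemma test_function_pderiv:
  assumes "test_function \<Omega> \<phi>"
  shows "test_function \<Omega> (pderiv_at i \<phi>)"
proof -
  obtain K where K: "compact K" "K \<subseteq> \<Omega>" "\<And>x. x \<notin> K \<Longrightarrow> \<phi> x = 0"
    by (rule test_function_support[OF assms]) (rule that)
  show ?thesis
  proof (rule test_functionI[OF _ K(1,2)])
    show "smooth_on UNIV (pderiv_at i \<phi>)"
      by (rule smooth_on_frechet_derivative(2)[OF test_function_smooth[OF assms]])
    show "pderiv_at i \<phi> x = 0" if "x \<notin> K" for x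
      by (rule pderiv_at_eq_0[OF compact_imp_closed[OF K(1)] K(3) that])
  qed
qed

lemma test_function_mult_smooth:
  assumes "test_function \<Omega> \<eta>" "smooth_on UNIV \<phi>"
  shows "test_function \<Omega> (\<lambda>x. \<eta> x * \<phi> x)"
proof -
  obtain K where K: "compact K" "K \<subseteq> \<Omega>" "\<And>x. x \<notin> K \<Longrightarrow> \<eta> x = 0"
    by (rule test_function_support[OF assms(1)]) (rule that)
  show ?thesis
  proof (rule test_functionI[OF _ K(1,2)])
    show "smooth_on UNIV (\<lambda>x. \<eta> x * \<phi> x)"
      by (rule smooth_on_mult[OF test_function_smooth[OF assms(1)] assms(2)])
  qed (use K in auto)
qed

lemma pderiv_at_mult:
  assumes "smooth_on UNIV \<eta>" "smooth_on UNIV \<phi>"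
  shows "pderiv_at i (\<lambda>x. \<eta> x * \<phi> x) x = \<eta> x * pderiv_at i \<phi> x + pderiv_at i \<eta> x * \<phi> x"
proof -
  note D = has_derivative_mult[OF smooth_on_frechet_derivative(1)[OF assms(1)] smooth_on_frechet_derivative(1)[OF assms(2)]]
  show ?thesis by (simp flip: frechet_derivative_at[OF D])
qed

lemma test_function_shift:
  assumes "test_function UNIV \<phi>"
  shows "test_function UNIV (\<lambda>x. \<phi> (x + a))"
proof -
  obtain K where K: "compact K" "K \<subseteq> UNIV" "\<And>x. x \<notin> K \<Longrightarrow> \<phi> x = 0"
    by (rule test_function_support[OF assms(1)]) (rule that)
  show ?thesis
  proof (rule test_functionI)
    show "smooth_on UNIV (\<lambda>x. \<phi> (x + a))"
      by (rule smooth_on_shift[OF test_function_smooth[OF assms]])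
    show "compact ((\<lambda>x. x + (- a)) ` K)"
      by (intro compact_continuous_image K(1) continuous_intros)
    show "\<phi> (x + a) = 0" if "x \<notin> (\<lambda>x. x + (- a)) ` K" for x
      using that by (intro K(3)) (auto simp: image_iff)
  qed simp
qed

lemma test_function_measurable:
  assumes "test_function \<Omega> \<phi>"
  shows "\<phi> \<in> borel_measurable borel"
  by (intro borel_measurable_continuous_onI smooth_on_continuous test_function_smooth[OF assms])

lemma test_function_bounded:
  assumes "test_function \<Omega> \<phi>"
  obtains B where "0 < B" "\<And>x. \<bar>\<phi> x\<bar> \<le> B"
proof -
  obtain K where K: "compact K" "K \<subseteq> \<Omega>" "\<And>x. x \<notin> K \<Longrightarrow> \<phi> x = 0"
    by (rule test_function_support[OF assms]) (rule that)
  have "continuous_on K \<phi>"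
    using smooth_on_continuous[OF test_function_smooth[OF assms]] by (rule continuous_on_subset) simp
  then have "bounded (\<phi> ` K)" using K(1) compact_continuous_image compact_imp_bounded by blast
  then obtain B where "0 < B" "\<forall>y\<in>\<phi> ` K. norm y \<le> B" using bounded_pos by metis
  then have "\<bar>\<phi> x\<bar> \<le> B" for x using K(3)[of x] by (cases "x \<in> K") auto
  then show ?thesis using that \<open>0 < B\<close> by blast
qed

lemma sq_integrable_lborel_bounded_support:
  fixes f :: "'a::euclidean_space \<Rightarrow> 'b::euclidean_space"
  assumes "f \<in> borel_measurable borel" "\<And>x. norm (f x) \<le> B" "bounded K" "\<And>x. x \<notin> K \<Longrightarrow> f x = 0"
  shows "sq_integrable lborel f"
proof -
  obtain a where a: "K \<subseteq> cbox (- a) a" using bounded_subset_cbox_symmetric[OF assms(3)] by blast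
  have "sq_integrable lborel (indicator (cbox (- a) a) :: 'a \<Rightarrow> real)"
  proof -
    have "(\<lambda>x. (norm (indicator (cbox (- a) a) x :: real))\<^sup>2) = indicator (cbox (- a) a)"
      by (auto simp: indicator_def)
    moreover have "integrable lborel (indicator (cbox (- a) a) :: 'a \<Rightarrow> real)"
      by (rule integrable_real_indicator[OF _ emeasure_lborel_cbox_finite]) simp
    ultimately show ?thesis by (simp add: sq_integrable_def)
  qed
  then show ?thesis
  proof (rule sq_integrable_bound)
    have "norm (f x) \<le> B * norm (indicator (cbox (- a) a) x :: real)" for x
      using assms(2)[of x] assms(4)[of x] a by (auto simp: indicator_def)
    then show "AE x in lborel. norm (f x) \<le> B * norm (indicator (cbox (- a) a) x :: real)" by simp
  qed (use assms(1) in simp)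
qed

lemma test_function_sq_integrable:
  assumes "test_function \<Omega> \<phi>"
  shows "sq_integrable lborel \<phi>"
proof -
  obtain K where "compact K" "K \<subseteq> \<Omega>" "\<And>x. x \<notin> K \<Longrightarrow> \<phi> x = 0"
    by (rule test_function_support[OF assms]) (rule that)
  moreover obtain B where "0 < B" "\<And>x. \<bar>\<phi> x\<bar> \<le> B" by (rule test_function_bounded[OF assms]) (rule that)
  ultimately show ?thesis
    by (intro sq_integrable_lborel_bounded_support[OF test_function_measurable[OF assms], of B K])
       (auto intro: compact_imp_bounded)
qed

lemma test_functions_to_open:
  fixes V :: "(real ^ 'n::finite) set"
  assumes "open V" "bounded V" "closure V \<subseteq> \<Omega>"
  obtains \<phi> where "\<And>n. test_function \<Omega> (\<phi> n)"
    "\<And>n x. 0 \<le> \<phi> n x" "\<And>n x. \<phi> n x \<le> indicator V x"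
    "\<And>x. (\<lambda>n. \<phi> n x) \<longlonglongrightarrow> indicator V x"
proof -
  obtain \<phi> :: "nat \<Rightarrow> real ^ 'n \<Rightarrow> real" where \<phi>: "\<And>n. smooth_on UNIV (\<phi> n)"
    "\<And>n x. 0 \<le> \<phi> n x" "\<And>n x. \<phi> n x \<le> 1" "\<And>n x. x \<notin> V \<Longrightarrow> \<phi> n x = 0"
    "\<And>x. x \<in> V \<Longrightarrow> (\<lambda>n. \<phi> n x) \<longlonglongrightarrow> 1"
    using smooth_approx_indicator_open[OF assms(1)] by metis
  show ?thesis
  proof
    show "test_function \<Omega> (\<phi> n)" for n
      by (rule test_functionI[OF \<phi>(1), of "closure V"])
         (use assms \<phi>(4) closure_subset[of V] in \<open>auto simp: compact_closure\<close>)
  qed (use \<phi> in \<open>auto simp: indicator_def\<close>)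
qed

text \<open>
  Membership in the \<open>L\<^sup>2\<close> closure of the test functions.
\<close>

definition test_approximable :: "(real ^ 'n::finite \<Rightarrow> real) \<Rightarrow> bool" where
  "test_approximable w \<longleftrightarrow> sq_integrable lborel w \<and>
     (\<forall>e>0. \<exists>\<phi>. test_function UNIV \<phi> \<and> (\<integral>x. (norm (w x - \<phi> x))\<^sup>2 \<partial>lborel) < e)"

lemma test_approximable_limit:
  assumes w: "sq_integrable lborel w"
    and *: "\<And>e. e > 0 \<Longrightarrow> \<exists>v. test_approximable v \<and> (\<integral>x. (norm (w x - v x))\<^sup>2 \<partial>lborel) < e"
  shows "test_approximable w"
  unfolding test_approximable_def
proof (intro conjI allI impI w)
  fix e :: real assume "0 < e"
  then obtain v where v: "test_approximable v" "(\<integral>x. (norm (w x - v x))\<^sup>2 \<partial>lborel) < e / 4"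
    using *[of "e / 4"] by auto
  then obtain \<phi> where \<phi>: "test_function UNIV \<phi>" "(\<integral>x. (norm (v x - \<phi> x))\<^sup>2 \<partial>lborel) < e / 4"
    unfolding test_approximable_def using \<open>0 < e\<close> by (meson divide_pos_pos zero_less_numeral)
  have sv: "sq_integrable lborel v" using v by (simp add: test_approximable_def)
  have "(\<integral>x. (norm (w x - \<phi> x))\<^sup>2 \<partial>lborel) = (\<integral>x. (norm ((w x - v x) + (v x - \<phi> x)))\<^sup>2 \<partial>lborel)"
    by simp
  also have "\<dots> \<le> 2 * (\<integral>x. (norm (w x - v x))\<^sup>2 \<partial>lborel) + 2 * (\<integral>x. (norm (v x - \<phi> x))\<^sup>2 \<partial>lborel)"
    by (intro integral_norm_sq_add_le sq_integrable_diff w sv test_function_sq_integrable[OF \<phi>(1)])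
  finally show "\<exists>\<phi>. test_function UNIV \<phi> \<and> (\<integral>x. (norm (w x - \<phi> x))\<^sup>2 \<partial>lborel) < e"
    using v(2) \<phi> by (intro exI[of _ \<phi>]) auto
qed

lemma test_function_0: "test_function \<Omega> (\<lambda>x. 0)"
  by (rule test_functionI[of _ "{}"]) (auto intro: smooth_on_const)

lemma test_function_add:
  assumes "test_function UNIV f" "test_function UNIV g"
  shows "test_function UNIV (\<lambda>x. f x + g x)"
proof -
  obtain K where K: "compact K" "K \<subseteq> UNIV" "\<And>x. x \<notin> K \<Longrightarrow> f x = 0"
    by (rule test_function_support[OF assms(1)]) (rule that)
  obtain L where L: "compact L" "L \<subseteq> UNIV" "\<And>x. x \<notin> L \<Longrightarrow> g x = 0"
    by (rule test_function_support[OF assms(2)]) (rule that)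
  show ?thesis
  proof (rule test_functionI)
    show "smooth_on UNIV (\<lambda>x. f x + g x)"
      by (rule smooth_on_add[OF test_function_smooth[OF assms(1)] test_function_smooth[OF assms(2)]])
    show "compact (K \<union> L)" by (rule compact_Un[OF K(1) L(1)])
    show "f x + g x = 0" if "x \<notin> K \<union> L" for x using K(3)[of x] L(3)[of x] that by simp
  qed simp
qed

lemma test_function_scale:
  assumes "test_function \<Omega> f"
  shows "test_function \<Omega> (\<lambda>x. c * f x)"
proof -
  have "test_function \<Omega> (\<lambda>x. f x * c)"
    by (rule test_function_mult_smooth[OF assms smooth_on_const])
  then show ?thesis by (simp add: mult.commute)
qed

lemma test_approximable_test: "test_function UNIV \<phi> \<Longrightarrow> test_approximable \<phi>"
  using test_function_sq_integrable unfolding test_approximable_def by fastforce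

lemma test_approximable_add:
  assumes v: "test_approximable v" and w: "test_approximable w"
  shows "test_approximable (\<lambda>x. v x + w x)"
  unfolding test_approximable_def
proof (intro conjI allI impI)
  have s: "sq_integrable lborel v" "sq_integrable lborel w" using v w by (auto simp: test_approximable_def)
  show "sq_integrable lborel (\<lambda>x. v x + w x)" by (intro sq_integrable_add s)
  fix e :: real assume "0 < e"
  then have "0 < e / 4" by simp
  then obtain f g where f: "test_function UNIV f" "(\<integral>x. (norm (v x - f x))\<^sup>2 \<partial>lborel) < e / 4"
    and g: "test_function UNIV g" "(\<integral>x. (norm (w x - g x))\<^sup>2 \<partial>lborel) < e / 4"
    using v w unfolding test_approximable_def by blast
  have "(\<integral>x. (norm (v x + w x - (f x + g x)))\<^sup>2 \<partial>lborel) = (\<integral>x. (norm ((v x - f x) + (w x - g x)))\<^sup>2 \<partial>lborel)"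
    by (simp add: algebra_simps)
  also have "\<dots> \<le> 2 * (\<integral>x. (norm (v x - f x))\<^sup>2 \<partial>lborel) + 2 * (\<integral>x. (norm (w x - g x))\<^sup>2 \<partial>lborel)"
    by (intro integral_norm_sq_add_le sq_integrable_diff s test_function_sq_integrable[OF f(1)] test_function_sq_integrable[OF g(1)])
  finally show "\<exists>\<phi>. test_function UNIV \<phi> \<and> (\<integral>x. (norm (v x + w x - \<phi> x))\<^sup>2 \<partial>lborel) < e"
    using f(2) g(2) test_function_add[OF f(1) g(1)] by (intro exI[of _ "\<lambda>x. f x + g x"]) auto
qed

lemma test_approximable_scale:
  assumes v: "test_approximable v"
  shows "test_approximable (\<lambda>x. c * v x)"
  unfolding test_approximable_def
proof (intro conjI allI impI)
  show "sq_integrable lborel (\<lambda>x. c * v x)"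
    using v sq_integrable_scaleR[of lborel v c] by (simp add: test_approximable_def)
  fix e :: real assume "0 < e"
  have pos: "0 < c\<^sup>2 + 1" using zero_le_power2[of c] by linarith
  with \<open>0 < e\<close> obtain f where f: "test_function UNIV f" "(\<integral>x. (norm (v x - f x))\<^sup>2 \<partial>lborel) < e / (c\<^sup>2 + 1)"
    using v unfolding test_approximable_def by (meson divide_pos_pos)
  have "(\<integral>x. (norm (c * v x - c * f x))\<^sup>2 \<partial>lborel) = (\<integral>x. c\<^sup>2 * (norm (v x - f x))\<^sup>2 \<partial>lborel)"
    by (intro Bochner_Integration.integral_cong refl) (simp add: power_mult_distrib flip: right_diff_distrib)
  also have "\<dots> = c\<^sup>2 * (\<integral>x. (norm (v x - f x))\<^sup>2 \<partial>lborel)" by simp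
  also have "\<dots> \<le> (c\<^sup>2 + 1) * (\<integral>x. (norm (v x - f x))\<^sup>2 \<partial>lborel)" by (intro mult_right_mono) auto
  also have "\<dots> < e" using f(2) pos by (simp add: field_simps)
  finally show "\<exists>\<phi>. test_function UNIV \<phi> \<and> (\<integral>x. (norm (c * v x - \<phi> x))\<^sup>2 \<partial>lborel) < e"
    using test_function_scale[OF f(1)] by (intro exI[of _ "\<lambda>x. c * f x"]) auto
qed

lemma test_approximable_sum:
  "(\<And>i. i \<in> I \<Longrightarrow> test_approximable (f i)) \<Longrightarrow> test_approximable (\<lambda>x. \<Sum>i\<in>I. f i x)"
  by (induction I rule: infinite_finite_induct)
     (auto intro: test_approximable_add test_approximable_test test_function_0)

lemma integral_norm_sq_dominated_tendsto_0:
  fixes f :: "nat \<Rightarrow> 'a \<Rightarrow> 'b::euclidean_space"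
  assumes "sq_integrable M g" "\<And>n. f n \<in> borel_measurable M" "h \<in> borel_measurable M"
    and "\<And>n x. x \<in> space M \<Longrightarrow> norm (f n x - h x) \<le> c * norm (g x)"
    and "\<And>x. x \<in> space M \<Longrightarrow> (\<lambda>n. f n x) \<longlonglongrightarrow> h x"
  shows "(\<lambda>n. \<integral>x. (norm (h x - f n x))\<^sup>2 \<partial>M) \<longlonglongrightarrow> 0"
proof -
  have "(\<lambda>n. \<integral>x. (norm (h x - f n x))\<^sup>2 \<partial>M) \<longlonglongrightarrow> (\<integral>x. 0 \<partial>M)"
  proof (rule integral_dominated_convergence)
    show "integrable M (\<lambda>x. c\<^sup>2 * (norm (g x))\<^sup>2)" using assms(1) by (simp add: sq_integrable_def)
    show "AE x in M. (\<lambda>n. (norm (h x - f n x))\<^sup>2) \<longlonglongrightarrow> 0"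
    proof (rule AE_I2)
      fix x assume "x \<in> space M"
      then have "(\<lambda>n. (norm (h x - f n x))\<^sup>2) \<longlonglongrightarrow> (norm (h x - h x))\<^sup>2"
        by (intro tendsto_intros assms)
      then show "(\<lambda>n. (norm (h x - f n x))\<^sup>2) \<longlonglongrightarrow> 0" by simp
    qed
    show "AE x in M. norm ((norm (h x - f n x))\<^sup>2) \<le> c\<^sup>2 * (norm (g x))\<^sup>2" for n
      using assms(4)[of _ n] by (auto simp: norm_minus_commute power_mono simp flip: power_mult_distrib)
  qed (use assms(2,3) in measurable)
  then show ?thesis by simp
qed

lemma test_approximable_dominated_limit:
  assumes v: "\<And>n. test_approximable (v n)" and "sq_integrable lborel w" "sq_integrable lborel g"
    and "\<And>n x. norm (v n x - w x) \<le> c * norm (g x)" "\<And>x. (\<lambda>n. v n x) \<longlonglongrightarrow> w x"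
  shows "test_approximable w"
proof (rule test_approximable_limit)
  have [measurable]: "v n \<in> borel_measurable lborel" for n
    using v by (auto simp: test_approximable_def sq_integrable_def)
  have "(\<lambda>n. \<integral>x. (norm (w x - v n x))\<^sup>2 \<partial>lborel) \<longlonglongrightarrow> 0"
    by (rule integral_norm_sq_dominated_tendsto_0[OF assms(3), where c = c])
       (use assms in \<open>auto simp: sq_integrable_def\<close>)
  then show "\<exists>v. test_approximable v \<and> (\<integral>x. (norm (w x - v x))\<^sup>2 \<partial>lborel) < e" if "e > 0" for e
    using order_tendstoD(2)[OF _ that] v by (force simp: eventually_sequentially)
qed fact

lemma indicator_sq_integrable:
  fixes A :: "'a::euclidean_space set"
  assumes "A \<in> sets borel" "bounded A"
  shows "sq_integrable lborel (indicator A :: _ \<Rightarrow> real)"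
  by (rule sq_integrable_lborel_bounded_support[of _ 1 A]) (use assms in \<open>auto simp: indicator_def\<close>)

lemma test_approximable_open:
  assumes "open V" "bounded V"
  shows "test_approximable (indicator V)"
proof -
  obtain \<phi> where \<phi>: "\<And>n. test_function UNIV (\<phi> n)"
    "\<And>n x. 0 \<le> \<phi> n x" "\<And>n x. \<phi> n x \<le> indicator V x"
    "\<And>x. (\<lambda>n. \<phi> n x) \<longlonglongrightarrow> indicator V x"
    using test_functions_to_open[OF assms, of UNIV] by auto
  show ?thesis
  proof (rule test_approximable_dominated_limit[where v = \<phi> and g = "indicator V" and c = 1])
    show "norm (\<phi> n x - indicator V x) \<le> 1 * norm (indicator V x :: real)" for n x
      using \<phi>(2)[of n x] \<phi>(3)[of n x] by (auto simp: indicator_def split: if_splits)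
  qed (use \<phi> assms in \<open>auto intro: test_approximable_test indicator_sq_integrable\<close>)
qed

text \<open>
  Outer regularity of Lebesgue measure reduces bounded Borel sets to bounded open sets.
\<close>

lemma test_approximable_indicator:
  fixes A :: "(real ^ 'n::finite) set"
  assumes A: "A \<in> sets borel" "bounded A"
  shows "test_approximable (indicator A)"
proof (rule test_approximable_limit)
  fix e :: real assume "0 < e"
  obtain R where R: "A \<subseteq> ball 0 R" using A(2) bounded_subset_ballD by blast
  obtain T where T: "open T" "A \<subseteq> T" "emeasure lborel (T - A) < ennreal e"
    using outer_regular_lborel[OF A(1) \<open>0 < e\<close>] by blast
  define V where "V = T \<inter> ball 0 R"
  have V: "open V" "bounded V" "A \<subseteq> V" using T R by (auto simp: V_def bounded_Int)
  have "(\<lambda>x. (norm (indicator A x - indicator V x :: real))\<^sup>2) = indicator (V - A)"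
    using V(3) by (auto simp: fun_eq_iff indicator_def)
  then have "(\<integral>x. (norm (indicator A x - indicator V x :: real))\<^sup>2 \<partial>lborel) = measure lborel (V - A)"
    using A V by simp
  also have "\<dots> < e"
  proof -
    have "emeasure lborel (V - A) \<le> emeasure lborel (T - A)"
      using T(1) A(1) by (intro emeasure_mono) (auto simp: V_def)
    then have "emeasure lborel (V - A) < ennreal e" using T(3) by (rule le_less_trans)
    then show ?thesis using \<open>0 < e\<close>
      by (metis emeasure_eq_ennreal_measure ennreal_less_iff measure_nonneg top.not_eq_extremum ennreal_less_top order_less_trans)
  qed
  finally show "\<exists>v. test_approximable v \<and> (\<integral>x. (norm (indicator A x - v x :: real))\<^sup>2 \<partial>lborel) < e"
    using test_approximable_open[OF V(1,2)] by blast
qed (rule indicator_sq_integrable[OF A])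

text \<open>
  Truncating an approximating sequence of simple functions to balls reduces the claim to indicator
  functions of bounded Borel sets.
\<close>

lemma test_functions_dense_L2:
  fixes w :: "real ^ 'n::finite \<Rightarrow> real"
  assumes w: "sq_integrable lborel w"
  shows "test_approximable w"
proof -
  have [measurable]: "w \<in> borel_measurable borel" using w by (simp add: sq_integrable_def)
  obtain s where s: "\<And>n. simple_function lborel (s n)" "\<And>x. (\<lambda>n. s n x) \<longlonglongrightarrow> w x"
    "\<And>n x. dist (s n x) 0 \<le> 2 * dist (w x) 0"
    using borel_measurable_implies_sequence_metric[of w lborel 0] by auto
  define v where "v n x = indicator (cball 0 (real n)) x * s n x" for n x
  show ?thesis
  proof (rule test_approximable_dominated_limit[of v w w 3])
    fix n
    have fin: "finite (range (s n))" using s(1)[of n] by (simp add: simple_function_def)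
    have meas: "s n -` {y} \<in> sets borel" for y
      using simple_functionD(2)[OF s(1)[of n], of "{y}"] by simp
    have "v n = (\<lambda>x. \<Sum>y\<in>range (s n). y * indicator (s n -` {y} \<inter> cball 0 (real n)) x)"
    proof
      fix x
      have "(\<Sum>y\<in>range (s n). y * indicator (s n -` {y} \<inter> cball 0 (real n)) x)
          = (\<Sum>y\<in>range (s n). if s n x = y then indicator (cball 0 (real n)) x * y else 0)"
        by (intro sum.cong) (auto simp: indicator_def)
      also have "\<dots> = v n x" using fin by (simp add: v_def)
      finally show "v n x = (\<Sum>y\<in>range (s n). y * indicator (s n -` {y} \<inter> cball 0 (real n)) x)" by simp
    qed
    moreover have "test_approximable (\<lambda>x. \<Sum>y\<in>range (s n). y * indicator (s n -` {y} \<inter> cball 0 (real n)) x)"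
      by (intro test_approximable_sum test_approximable_scale test_approximable_indicator sets.Int meas) auto
    ultimately show "test_approximable (v n)" by simp
  next
    fix n x
    show "norm (v n x - w x) \<le> 3 * norm (w x)"
      using s(3)[of n x] by (auto simp: v_def indicator_def)
  next
    fix x :: "real ^ 'n"
    obtain N where N: "norm x \<le> real N" using real_arch_simple by blast
    have "\<forall>\<^sub>F n in sequentially. s n x = v n x"
      by (rule eventually_sequentiallyI[of N]) (use N in \<open>auto simp: v_def indicator_def\<close>)
    with s(2)[of x] show "(\<lambda>n. v n x) \<longlonglongrightarrow> w x" by (rule Lim_transform_eventually)
  qed (fact w)+
qed

text \<open>
  The sets over which the integral of \<open>f\<close> vanishes form a Dynkin system; the open sets are stable under
  intersection and generate the Borel sets. It remains to take the sets where \<open>f\<close> is positive and where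
  it is negative.
\<close>

lemma AE_eq_0_if_open_integrals_0:
  fixes f :: "'a::euclidean_space \<Rightarrow> real"
  assumes f: "integrable lborel f"
    and zero: "\<And>V. open V \<Longrightarrow> (\<integral>x. indicator V x * f x \<partial>lborel) = 0"
  shows "AE x in lborel. f x = 0"
proof -
  have int: "set_integrable lborel A f" if "A \<in> sets borel" for A
    unfolding set_integrable_def using integrable_mult_indicator[OF _ f] that by simp
  have sets_zero: "(LINT x:A|lborel. f x) = 0" if "A \<in> sets borel" for A
  proof -
    have A: "A \<in> sigma_sets UNIV {V. open V}" using that by (simp add: borel_def)
    have stable: "Int_stable {V::'a set. open V}" by (auto simp: Int_stable_def)
    show ?thesis
    proof (rule sigma_sets_induct_disjoint[OF stable _ A])
      fix V :: "'a set" assume "V \<in> {V. open V}"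
      then show "(LINT x:V|lborel. f x) = 0" using zero[of V] by (simp add: set_lebesgue_integral_def)
    next
      show "(LINT x:{}|lborel. f x) = 0" by (simp add: set_lebesgue_integral_def)
    next
      fix A :: "'a set" assume *: "A \<in> sigma_sets UNIV {V. open V}" "(LINT x:A|lborel. f x) = 0"
      then have A: "A \<in> sets borel" by (simp add: borel_def)
      have "(LINT x:UNIV|lborel. f x) = (LINT x:(UNIV - A) \<union> A|lborel. f x)" by (simp add: Un_commute)
      also have "\<dots> = (LINT x:UNIV - A|lborel. f x) + (LINT x:A|lborel. f x)"
        by (rule set_integral_Un) (use A in \<open>auto intro!: int\<close>)
      finally show "(LINT x:UNIV - A|lborel. f x) = 0"
        using zero[of UNIV] * by (simp add: set_lebesgue_integral_def)
    next
      fix A :: "nat \<Rightarrow> 'a set"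
      assume *: "disjoint_family A" "range A \<subseteq> sigma_sets UNIV {V. open V}" "\<And>i. (LINT x:A i|lborel. f x) = 0"
      then have m: "A i \<in> sets borel" for i by (auto simp: borel_def)
      have "(LINT x:(\<Union>i. A i)|lborel. f x) = (\<Sum>i. (LINT x:A i|lborel. f x))"
        by (intro lebesgue_integral_countable_add int sets.countable_UN)
           (use m *(1) in \<open>auto simp: disjoint_family_on_def\<close>)
      then show "(LINT x:(\<Union>i. A i)|lborel. f x) = 0" using *(3) by simp
    qed simp
  qed
  have [measurable]: "f \<in> borel_measurable borel" using f by auto
  have *: "AE x in lborel. indicator A x * \<bar>f x\<bar> = 0" if A: "A \<in> sets borel" and "\<And>x. x \<in> A \<Longrightarrow> \<bar>f x\<bar> = c * f x" for A c
  proof -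
    have eq: "(\<lambda>x. indicator A x * \<bar>f x\<bar>) = (\<lambda>x. c * (indicator A x *\<^sub>R f x))" using that by (auto simp: indicator_def)
    have "integrable lborel (\<lambda>x. indicator A x * \<bar>f x\<bar>)"
      unfolding eq using int[OF A] by (simp add: set_integrable_def)
    moreover have "(\<integral>x. indicator A x * \<bar>f x\<bar> \<partial>lborel) = 0"
      unfolding eq using sets_zero[OF A] by (simp add: set_lebesgue_integral_def)
    ultimately show ?thesis by (subst (asm) integral_nonneg_eq_0_iff_AE) auto
  qed
  have "AE x in lborel. indicator {x. 0 < f x} x * \<bar>f x\<bar> = 0" by (rule *[of _ 1]) auto
  moreover have "AE x in lborel. indicator {x. f x < 0} x * \<bar>f x\<bar> = 0" by (rule *[of _ "-1"]) auto
  ultimately show ?thesis by eventually_elim (auto simp: indicator_def split: if_splits)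
qed

section \<open>Weak derivatives and difference quotients\<close>

definition l2 :: "'a measure \<Rightarrow> ('a \<Rightarrow> 'b::euclidean_space) \<Rightarrow> real" where
  "l2 M f = sqrt (\<integral>x. (norm (f x))\<^sup>2 \<partial>M)"

lemma l2_nonneg: "0 \<le> l2 M f" by (simp add: l2_def)

lemma l2_power2: "(l2 M f)\<^sup>2 = (\<integral>x. (norm (f x))\<^sup>2 \<partial>M)" by (simp add: l2_def)

lemma l2_Cauchy_Schwarz:
  fixes f g :: "'a \<Rightarrow> real"
  assumes "sq_integrable M f" "sq_integrable M g"
  shows "\<bar>\<integral>x. f x * g x \<partial>M\<bar> \<le> l2 M f * l2 M g"
  using Cauchy_Schwarz_integral[OF assms] by (simp add: l2_def)

lemma l2_triangle:
  assumes f: "sq_integrable M f" and g: "sq_integrable M g"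
  shows "l2 M (\<lambda>x. f x + g x) \<le> l2 M f + l2 M g"
proof -
  have "(norm (f x + g x))\<^sup>2 = (norm (f x))\<^sup>2 + 2 * (f x \<bullet> g x) + (norm (g x))\<^sup>2" for x
    unfolding power2_norm_eq_inner by (simp add: inner_add_left inner_add_right inner_commute)
  then have "(l2 M (\<lambda>x. f x + g x))\<^sup>2 = (l2 M f)\<^sup>2 + 2 * (\<integral>x. f x \<bullet> g x \<partial>M) + (l2 M g)\<^sup>2"
    unfolding l2_power2 using f g sq_integrable_inner[OF f g] by (simp add: sq_integrable_def)
  also have "\<dots> \<le> (l2 M f)\<^sup>2 + 2 * (l2 M f * l2 M g) + (l2 M g)\<^sup>2"
    using Cauchy_Schwarz_integral[OF f g] by (simp add: l2_def)
  also have "\<dots> = (l2 M f + l2 M g)\<^sup>2" by (simp add: power2_sum)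
  finally show ?thesis by (rule power2_le_imp_le) (simp add: l2_nonneg)
qed

lemma l2_0: "l2 M (\<lambda>x. 0) = 0" by (simp add: l2_def)

lemma l2_leI: "(\<integral>x. (norm (f x))\<^sup>2 \<partial>M) < e\<^sup>2 \<Longrightarrow> 0 < e \<Longrightarrow> l2 M f \<le> e"
  unfolding l2_def by (intro real_le_lsqrt) auto

lemma l2_diff_commute: "l2 M (\<lambda>x. f x - g x) = l2 M (\<lambda>x. g x - f x)"
proof -
  have "norm (f x - g x) = norm (g x - f x)" for x by (rule norm_minus_commute)
  then show ?thesis by (simp only: l2_def)
qed

text \<open>
  Testing with approximations \<open>\<phi>\<close> of \<open>w\<close> itself gives \<open>|w|\<^sup>2 \<le> C |w|\<close> in the limit.
\<close>

lemma l2_duality: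
  fixes w :: "real ^ 'n::finite \<Rightarrow> real"
  assumes w: "sq_integrable lborel w" and "0 \<le> C"
    and bound: "\<And>\<phi>. test_function UNIV \<phi> \<Longrightarrow> \<bar>\<integral>x. \<phi> x * w x \<partial>lborel\<bar> \<le> C * l2 lborel \<phi>"
  shows "l2 lborel w \<le> C"
proof -
  define N where "N = l2 lborel w"
  have N0: "0 \<le> N" by (simp add: N_def l2_nonneg)
  have eps: "N\<^sup>2 \<le> C * N + e * (N + C)" if "0 < e" for e
  proof -
    have "0 < e\<^sup>2" using that by simp
    then obtain \<phi> where \<phi>: "test_function UNIV \<phi>" "(\<integral>x. (norm (w x - \<phi> x))\<^sup>2 \<partial>lborel) < e\<^sup>2"
      using test_functions_dense_L2[OF w] unfolding test_approximable_def by blast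
    note s = test_function_sq_integrable[OF \<phi>(1)] sq_integrable_diff[OF w test_function_sq_integrable[OF \<phi>(1)]]
      sq_integrable_diff[OF test_function_sq_integrable[OF \<phi>(1)] w]
    have small: "l2 lborel (\<lambda>x. w x - \<phi> x) \<le> e"
      by (rule l2_leI[OF \<phi>(2) that])
    have "l2 lborel \<phi> = l2 lborel (\<lambda>x. w x + (\<phi> x - w x))" by simp
    also have "\<dots> \<le> N + l2 lborel (\<lambda>x. \<phi> x - w x)" unfolding N_def by (intro l2_triangle w s)
    also have "l2 lborel (\<lambda>x. \<phi> x - w x) = l2 lborel (\<lambda>x. w x - \<phi> x)" by (rule l2_diff_commute)
    finally have \<phi>_le: "l2 lborel \<phi> \<le> N + e" using small by simp
    have "N\<^sup>2 = (\<integral>x. (w x - \<phi> x) * w x + \<phi> x * w x \<partial>lborel)"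
      unfolding N_def l2_power2 by (simp add: power2_eq_square algebra_simps)
    also have "\<dots> = (\<integral>x. (w x - \<phi> x) * w x \<partial>lborel) + (\<integral>x. \<phi> x * w x \<partial>lborel)"
      by (intro Bochner_Integration.integral_add sq_integrable_mult s w)
    also have "\<dots> \<le> l2 lborel (\<lambda>x. w x - \<phi> x) * N + C * l2 lborel \<phi>"
      using l2_Cauchy_Schwarz[OF s(2) w] bound[OF \<phi>(1)] unfolding N_def by linarith
    also have "\<dots> \<le> e * N + C * (N + e)"
      using small \<phi>_le N0 \<open>0 \<le> C\<close> by (intro add_mono mult_right_mono mult_left_mono)
    finally show ?thesis by (simp add: algebra_simps)
  qed
  have "N\<^sup>2 \<le> C * N + e" if "0 < e" for e
  proof -
    have p: "0 < N + C + 1" using N0 \<open>0 \<le> C\<close> by simp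
    have "N\<^sup>2 \<le> C * N + e / (N + C + 1) * (N + C)" using p that by (intro eps) simp
    also have "e / (N + C + 1) * (N + C) \<le> e" using p that by (simp add: field_simps)
    finally show ?thesis by simp
  qed
  then have "N\<^sup>2 \<le> C * N" by (rule field_le_epsilon)
  then have "N * N \<le> C * N" by (simp only: power2_eq_square)
  then have "N \<le> C" using N0 \<open>0 \<le> C\<close> 
    by (cases "N = 0") (auto intro: mult_right_le_imp_le)
  then show ?thesis by (simp add: N_def)
qed

lemma lborel_integrable_shift:
  fixes f :: "'a::euclidean_space \<Rightarrow> 'b::euclidean_space"
  assumes [measurable]: "f \<in> borel_measurable borel"
  shows "integrable lborel (\<lambda>x. f (x + a)) \<longleftrightarrow> integrable lborel f"
    and "(\<integral>x. f (x + a) \<partial>lborel) = (\<integral>x. f x \<partial>lborel)"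
proof -
  have "integrable (distr lborel borel ((+) a)) f \<longleftrightarrow> integrable lborel (\<lambda>x. f (a + x))"
    by (rule integrable_distr_eq) auto
  then show "integrable lborel (\<lambda>x. f (x + a)) \<longleftrightarrow> integrable lborel f"
    by (simp add: lborel_distr_plus add.commute)
  have "integral\<^sup>L (distr lborel borel ((+) a)) f = (\<integral>x. f (a + x) \<partial>lborel)"
    by (rule integral_distr) auto
  then show "(\<integral>x. f (x + a) \<partial>lborel) = (\<integral>x. f x \<partial>lborel)"
    by (simp add: lborel_distr_plus add.commute)
qed

lemma sq_integrable_shift:
  fixes f :: "'a::euclidean_space \<Rightarrow> 'b::euclidean_space"
  assumes "sq_integrable lborel f"
  shows "sq_integrable lborel (\<lambda>x. f (x + a))" "l2 lborel (\<lambda>x. f (x + a)) = l2 lborel f"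
proof -
  have [measurable]: "f \<in> borel_measurable borel" using assms by (simp add: sq_integrable_def)
  then have n: "(\<lambda>x. (norm (f x))\<^sup>2) \<in> borel_measurable borel" by measurable
  have "(\<lambda>x. f (x + a)) \<in> borel_measurable borel" by measurable
  then show "sq_integrable lborel (\<lambda>x. f (x + a))"
    using assms lborel_integrable_shift(1)[OF n, of a] by (simp add: sq_integrable_def)
  show "l2 lborel (\<lambda>x. f (x + a)) = l2 lborel f"
    using lborel_integrable_shift(2)[OF n, of a] by (simp add: l2_def)
qed

text \<open>
  Weak partial derivatives on the whole space for scalar functions in \<open>L\<^sup>2\<close>, with respect to the Borel
  measure \<open>lborel\<close>.
\<close>

definition weak_deriv_L2 :: "'n::finite \<Rightarrow> (real ^ 'n \<Rightarrow> real) \<Rightarrow> (real ^ 'n \<Rightarrow> real) \<Rightarrow> bool" where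
  "weak_deriv_L2 i u g \<longleftrightarrow> sq_integrable lborel u \<and> sq_integrable lborel g \<and>
     (\<forall>\<phi>. test_function UNIV \<phi> \<longrightarrow>
        (\<integral>x. pderiv_at i \<phi> x * u x \<partial>lborel) = - (\<integral>x. \<phi> x * g x \<partial>lborel))"

lemma test_function_line_DERIV:
  fixes \<phi> :: "real ^ 'n::finite \<Rightarrow> real"
  assumes "smooth_on UNIV \<phi>"
  shows "((\<lambda>t. \<phi> (x + t *\<^sub>R axis i 1)) has_real_derivative pderiv_at i \<phi> (x + t *\<^sub>R axis i 1)) (at t)"
proof -
  note D = smooth_on_frechet_derivative(1)[OF assms]
  have "((\<lambda>t. \<phi> (x + t *\<^sub>R axis i 1)) has_derivative
      (\<lambda>h. frechet_derivative \<phi> (at (x + t *\<^sub>R axis i 1)) (h *\<^sub>R axis i 1))) (at t)"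
    by (rule has_derivative_compose[of "\<lambda>t. x + t *\<^sub>R axis i 1" "\<lambda>h. h *\<^sub>R axis i 1", OF _ D])
       (auto intro!: derivative_eq_intros)
  moreover have "frechet_derivative \<phi> (at y) (h *\<^sub>R v) = pderiv_at i \<phi> y * h" if "v = axis i 1" for h :: real and y v :: "real ^ 'n"
    by (simp add: that linear_cmul[OF has_derivative_linear[OF D]])
  ultimately show ?thesis by (simp add: has_field_derivative_def)
qed

text \<open>
  Differentiation under the integral sign falls on the test function, so dominated convergence applies;
  the weak derivative then moves it to \<open>u\<close>.
\<close>

lemma pairing_DERIV_0:
  assumes wd: "weak_deriv_L2 i u g" and \<phi>: "test_function UNIV \<phi>"
  shows "((\<lambda>t. \<integral>x. \<phi> (x - t *\<^sub>R axis i 1) * u x \<partial>lborel) has_real_derivative (\<integral>x. \<phi> x * g x \<partial>lborel)) (at 0)"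
  unfolding DERIV_def tendsto_at_iff_sequentially comp_def
proof (intro allI impI)
  fix X :: "nat \<Rightarrow> real" assume X: "\<forall>n. X n \<in> UNIV - {0}" "X \<longlonglongrightarrow> 0"
  have u: "sq_integrable lborel u" using wd by (simp add: weak_deriv_L2_def)
  have [measurable]: "u \<in> borel_measurable borel" using u by (simp add: sq_integrable_def)
  have [measurable]: "\<phi> \<in> borel_measurable borel" by (rule test_function_measurable[OF \<phi>])
  have [measurable]: "pderiv_at i \<phi> \<in> borel_measurable borel"
    by (rule test_function_measurable[OF test_function_pderiv[OF \<phi>]])
  define e :: "real ^ 'a" where "e = axis i 1"
  obtain K where K: "compact K" "K \<subseteq> UNIV" "\<And>x. x \<notin> K \<Longrightarrow> \<phi> x = 0"
    by (rule test_function_support[OF \<phi>]) (rule that)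
  obtain R where R: "\<And>x. x \<in> K \<Longrightarrow> norm x \<le> R"
    using compact_imp_bounded[OF K(1)] by (auto simp: bounded_iff)
  obtain c where c: "\<And>n. \<bar>X n\<bar> \<le> c"
    using convergent_imp_bounded[OF X(2)] by (auto simp: bounded_iff)
  obtain B where B: "0 < B" "\<And>x. \<bar>pderiv_at i \<phi> x\<bar> \<le> B"
    by (rule test_function_bounded[OF test_function_pderiv[OF \<phi>]]) (rule that)
  have ne: "norm e = 1" by (simp add: e_def)
  have lip: "\<bar>\<phi> (x - h *\<^sub>R e) - \<phi> x\<bar> \<le> B * \<bar>h\<bar>" for x h
    using field_differentiable_bound[of UNIV "\<lambda>t. \<phi> (x + t *\<^sub>R axis i 1)" "\<lambda>t. pderiv_at i \<phi> (x + t *\<^sub>R axis i 1)" B "- h" 0]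
      test_function_line_DERIV[OF test_function_smooth[OF \<phi>]] B(2) by (simp add: e_def)
  (* The quotients vanish outside of one ball because the increments are bounded. *)
  define q where "q n x = (\<phi> (x - X n *\<^sub>R e) - \<phi> x) / X n" for n x
  have q_le: "\<bar>q n x\<bar> \<le> B * indicator (cball 0 (R + c)) x" for n x
  proof (cases "norm x \<le> R + c")
    case True
    then show ?thesis using lip[of x "X n"] X(1) by (simp add: q_def field_simps)
  next
    case False
    have "norm x \<le> norm (x - X n *\<^sub>R e) + \<bar>X n\<bar>"
      using norm_triangle_ineq[of "x - X n *\<^sub>R e" "X n *\<^sub>R e"] ne by simp
    then have "\<not> norm (x - X n *\<^sub>R e) \<le> R" "\<not> norm x \<le> R" using False c[of n] by linarith+
    then have "x - X n *\<^sub>R e \<notin> K" "x \<notin> K" using R by blast+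
    then show ?thesis using K(3) B(1) by (simp add: q_def)
  qed
  have "(\<lambda>n. \<integral>x. q n x * u x \<partial>lborel) \<longlonglongrightarrow> (\<integral>x. - pderiv_at i \<phi> x * u x \<partial>lborel)"
  proof (rule integral_dominated_convergence)
    show "integrable lborel (\<lambda>x. B * (indicator (cball 0 (R + c)) x * \<bar>u x\<bar>))"
    proof (intro integrable_mult_right sq_integrable_mult)
      show "sq_integrable lborel (\<lambda>x. \<bar>u x\<bar>)"
        by (rule sq_integrable_bound[OF u, where c = 1]) auto
    qed (auto intro: indicator_sq_integrable)
    show "AE x in lborel. (\<lambda>n. q n x * u x) \<longlonglongrightarrow> - pderiv_at i \<phi> x * u x"
    proof (intro AE_I2 tendsto_mult tendsto_const)
      fix x
      have "((\<lambda>t. \<phi> (x + t *\<^sub>R axis i 1)) has_real_derivative pderiv_at i \<phi> x) (at 0)"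
        using test_function_line_DERIV[OF test_function_smooth[OF \<phi>], of x i 0] by simp
      then have lim: "((\<lambda>h. (\<phi> (x + h *\<^sub>R e) - \<phi> x) / h) \<longlongrightarrow> pderiv_at i \<phi> x) (at 0)"
        by (simp add: DERIV_def e_def)
      have "(\<lambda>n. - X n) \<longlonglongrightarrow> 0" using tendsto_minus[OF X(2)] by simp
      then have "filterlim (\<lambda>n. - X n) (at 0) sequentially"
        using X(1) by (intro filterlim_atI) auto
      from filterlim_compose[OF lim this]
      have "(\<lambda>n. - ((\<phi> (x + (- X n) *\<^sub>R e) - \<phi> x) / (- X n))) \<longlonglongrightarrow> - pderiv_at i \<phi> x"
        by (rule tendsto_minus)
      then show "(\<lambda>n. q n x) \<longlonglongrightarrow> - pderiv_at i \<phi> x" by (simp add: q_def[abs_def])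
    qed
    show "AE x in lborel. norm (q n x * u x) \<le> B * (indicator (cball 0 (R + c)) x * \<bar>u x\<bar>)" for n
      using q_le[of n] by (auto simp: abs_mult intro!: mult_right_mono simp flip: mult.assoc)
    show "(\<lambda>x. q n x * u x) \<in> borel_measurable lborel" for n unfolding q_def by measurable
  qed measurable
  moreover have "(\<integral>x. - pderiv_at i \<phi> x * u x \<partial>lborel) = (\<integral>x. \<phi> x * g x \<partial>lborel)"
    using wd \<phi> by (simp add: weak_deriv_L2_def)
  moreover have "(\<integral>x. q n x * u x \<partial>lborel) =
      ((\<integral>x. \<phi> (x - (0 + X n) *\<^sub>R axis i 1) * u x \<partial>lborel) - (\<integral>x. \<phi> (x - 0 *\<^sub>R axis i 1) * u x \<partial>lborel)) / X n" for n
  proof -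
    have t: "test_function UNIV (\<lambda>x. \<phi> (x - X n *\<^sub>R axis i 1))"
      using test_function_shift[OF \<phi>, of "- (X n *\<^sub>R axis i 1)"] by simp
    have "(\<integral>x. q n x * u x \<partial>lborel) = (\<integral>x. (\<phi> (x - X n *\<^sub>R axis i 1) * u x - \<phi> x * u x) / X n \<partial>lborel)"
      by (intro Bochner_Integration.integral_cong refl) (simp add: q_def e_def algebra_simps diff_divide_distrib)
    also have "\<dots> = (\<integral>x. \<phi> (x - X n *\<^sub>R axis i 1) * u x - \<phi> x * u x \<partial>lborel) / X n" by simp
    also have "(\<integral>x. \<phi> (x - X n *\<^sub>R axis i 1) * u x - \<phi> x * u x \<partial>lborel) =
        (\<integral>x. \<phi> (x - X n *\<^sub>R axis i 1) * u x \<partial>lborel) - (\<integral>x. \<phi> x * u x \<partial>lborel)"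
      by (intro Bochner_Integration.integral_diff sq_integrable_mult u test_function_sq_integrable[OF t]
          test_function_sq_integrable[OF \<phi>])
    finally show ?thesis by simp
  qed
  ultimately show "(\<lambda>n. ((\<integral>x. \<phi> (x - (0 + X n) *\<^sub>R axis i 1) * u x \<partial>lborel) -
      (\<integral>x. \<phi> (x - 0 *\<^sub>R axis i 1) * u x \<partial>lborel)) / X n) \<longlonglongrightarrow> (\<integral>x. \<phi> x * g x \<partial>lborel)"
    by simp
qed

lemma pairing_DERIV:
  assumes wd: "weak_deriv_L2 i u g" and \<phi>: "test_function UNIV \<phi>"
  shows "((\<lambda>t. \<integral>x. \<phi> (x - t *\<^sub>R axis i 1) * u x \<partial>lborel) has_real_derivative
    (\<integral>x. \<phi> (x - t *\<^sub>R axis i 1) * g x \<partial>lborel)) (at t)"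
proof -
  have t: "test_function UNIV (\<lambda>x. \<phi> (x - t *\<^sub>R axis i 1))"
    using test_function_shift[OF \<phi>, of "- (t *\<^sub>R axis i 1)"] by simp
  have "((\<lambda>s. \<integral>x. \<phi> (x - s *\<^sub>R axis i 1 - t *\<^sub>R axis i 1) * u x \<partial>lborel) has_real_derivative
      (\<integral>x. \<phi> (x - t *\<^sub>R axis i 1) * g x \<partial>lborel)) (at 0)"
    by (rule pairing_DERIV_0[OF wd t])
  then show ?thesis by (simp add: DERIV_def algebra_simps)
qed

lemma shift_pairing:
  fixes u v :: "'a::euclidean_space \<Rightarrow> real"
  assumes [measurable]: "u \<in> borel_measurable borel" "v \<in> borel_measurable borel"
  shows "(\<integral>x. u (x - a) * v x \<partial>lborel) = (\<integral>x. u x * v (x + a) \<partial>lborel)"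
  using lborel_integrable_shift(2)[of "\<lambda>x. u (x - a) * v x" a] by simp

text \<open>
  For a test function \<open>\<phi>\<close> the function \<open>t \<mapsto> \<integral> \<phi>(x - t e\<^sub>i) u(x) dx\<close> has derivative
  \<open>\<integral> \<phi>(x - t e\<^sub>i) g(x) dx\<close>, which is at most \<open>|\<phi>| |g|\<close> by the Cauchy--Schwarz inequality. The mean value
  theorem bounds the pairing of \<open>\<phi>\<close> with the translation difference, and duality removes \<open>\<phi>\<close>.
\<close>

lemma l2_translation_axis:
  assumes wd: "weak_deriv_L2 i u g"
  shows "l2 lborel (\<lambda>x. u (x + h *\<^sub>R axis i 1) - u x) \<le> \<bar>h\<bar> * l2 lborel g"
proof (rule l2_duality)
  have u: "sq_integrable lborel u" "sq_integrable lborel g" using wd by (auto simp: weak_deriv_L2_def)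
  have [measurable]: "u \<in> borel_measurable borel" using u by (simp add: sq_integrable_def)
  show "sq_integrable lborel (\<lambda>x. u (x + h *\<^sub>R axis i 1) - u x)"
    by (intro sq_integrable_diff sq_integrable_shift u)
  show "0 \<le> \<bar>h\<bar> * l2 lborel g" by (simp add: l2_nonneg)
  fix \<phi> :: "real ^ 'a \<Rightarrow> real" assume \<phi>: "test_function UNIV \<phi>"
  have [measurable]: "\<phi> \<in> borel_measurable borel" by (rule test_function_measurable[OF \<phi>])
  note s\<phi> = test_function_sq_integrable[OF \<phi>]
  define I where "I t = (\<integral>x. \<phi> (x - t *\<^sub>R axis i 1) * u x \<partial>lborel)" for t
  have "(\<integral>x. \<phi> x * (u (x + h *\<^sub>R axis i 1) - u x) \<partial>lborel) =
      (\<integral>x. \<phi> x * u (x + h *\<^sub>R axis i 1) - \<phi> x * u x \<partial>lborel)"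
    by (simp add: right_diff_distrib)
  also have "\<dots> = (\<integral>x. \<phi> x * u (x + h *\<^sub>R axis i 1) \<partial>lborel) - (\<integral>x. \<phi> x * u x \<partial>lborel)"
    by (intro Bochner_Integration.integral_diff sq_integrable_mult sq_integrable_shift u s\<phi>)
  also have "\<dots> = I h - I 0" by (simp add: I_def shift_pairing)
  also have "\<bar>I h - I 0\<bar> \<le> (l2 lborel \<phi> * l2 lborel g) * \<bar>h - 0\<bar>"
    unfolding real_norm_def[symmetric]
  proof (rule field_differentiable_bound[of UNIV])
    show "(I has_real_derivative (\<integral>x. \<phi> (x - t *\<^sub>R axis i 1) * g x \<partial>lborel)) (at t within UNIV)" for t
      unfolding I_def using pairing_DERIV[OF wd \<phi>] by simp
    show "norm (\<integral>x. \<phi> (x - t *\<^sub>R axis i 1) * g x \<partial>lborel) \<le> l2 lborel \<phi> * l2 lborel g" for t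
      using l2_Cauchy_Schwarz[OF sq_integrable_shift(1)[OF s\<phi>, of "- (t *\<^sub>R axis i 1)"] u(2)]
        sq_integrable_shift(2)[OF s\<phi>, of "- (t *\<^sub>R axis i 1)"] by simp
  qed auto
  finally show "\<bar>\<integral>x. \<phi> x * (u (x + h *\<^sub>R axis i 1) - u x) \<partial>lborel\<bar> \<le> \<bar>h\<bar> * l2 lborel g * l2 lborel \<phi>"
    by (simp add: mult_ac)
qed

text \<open>
  A translation by \<open>a\<close> is a composition of translations along the coordinate axes, and translations
  preserve the norm.
\<close>

lemma l2_translation:
  fixes u :: "real ^ 'n::finite \<Rightarrow> real"
  assumes wd: "\<And>i. weak_deriv_L2 i u (g i)"
  shows "l2 lborel (\<lambda>x. u (x + a) - u x) \<le> (\<Sum>i\<in>UNIV. \<bar>a $ i\<bar> * l2 lborel (g i))"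
proof -
  have u: "sq_integrable lborel u" using wd by (auto simp: weak_deriv_L2_def)
  have "l2 lborel (\<lambda>x. u (x + (\<Sum>i\<in>S. (a $ i) *\<^sub>R axis i 1)) - u x) \<le> (\<Sum>i\<in>S. \<bar>a $ i\<bar> * l2 lborel (g i))"
    if "finite S" for S
    using that
  proof induction
    case empty
    show ?case by (simp add: l2_0)
  next
    case (insert j S)
    define b where "b = (\<Sum>i\<in>S. (a $ i) *\<^sub>R axis i 1 :: real ^ 'n)"
    define w where "w x = u (x + (a $ j) *\<^sub>R axis j 1) - u x" for x
    have w: "sq_integrable lborel w" unfolding w_def by (intro sq_integrable_diff sq_integrable_shift u)
    have "l2 lborel (\<lambda>x. u (x + (\<Sum>i\<in>insert j S. (a $ i) *\<^sub>R axis i 1)) - u x)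
        = l2 lborel (\<lambda>x. w (x + b) + (u (x + b) - u x))"
      using insert by (simp add: w_def b_def add_ac)
    also have "\<dots> \<le> l2 lborel (\<lambda>x. w (x + b)) + l2 lborel (\<lambda>x. u (x + b) - u x)"
      by (intro l2_triangle sq_integrable_diff sq_integrable_shift u w)
    also have "l2 lborel (\<lambda>x. w (x + b)) = l2 lborel w" by (rule sq_integrable_shift(2)[OF w])
    also have "\<dots> \<le> \<bar>a $ j\<bar> * l2 lborel (g j)" unfolding w_def by (rule l2_translation_axis[OF wd])
    finally show ?case using insert unfolding b_def by simp
  qed
  from this[of UNIV] show ?thesis using basis_expansion[of a] by (simp add: scalar_mult_eq_scaleR)
qed

definition diff_quotient :: "'n::finite \<Rightarrow> real \<Rightarrow> (real ^ 'n \<Rightarrow> real) \<Rightarrow> real ^ 'n \<Rightarrow> real" where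
  "diff_quotient i h u x = (u (x + h *\<^sub>R axis i 1) - u x) / h"

lemma diff_quotient_sq_integrable: "sq_integrable lborel u \<Longrightarrow> sq_integrable lborel (diff_quotient i h u)"
  using sq_integrable_scaleR[of lborel "\<lambda>x. u (x + h *\<^sub>R axis i 1) - u x" "1 / h"]
  by (simp add: diff_quotient_def[abs_def] sq_integrable_diff sq_integrable_shift)

lemma l2_scale: "l2 M (\<lambda>x. c * f x) = \<bar>c\<bar> * l2 M f" for f :: "'a \<Rightarrow> real"
  by (simp add: l2_def power_mult_distrib real_sqrt_mult)

lemma l2_dquot_le:
  assumes wd: "weak_deriv_L2 i u g"
  shows "l2 lborel (diff_quotient i h u) \<le> l2 lborel g"
proof (cases "h = 0")
  case True
  then show ?thesis by (simp add: diff_quotient_def[abs_def] l2_0 l2_nonneg)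
next
  case False
  have "l2 lborel (diff_quotient i h u) = \<bar>1 / h\<bar> * l2 lborel (\<lambda>x. u (x + h *\<^sub>R axis i 1) - u x)"
    by (subst l2_scale[symmetric]) (simp add: diff_quotient_def[abs_def])
  also have "\<dots> \<le> \<bar>1 / h\<bar> * (\<bar>h\<bar> * l2 lborel g)" by (intro mult_left_mono l2_translation_axis[OF wd]) simp
  finally show ?thesis using False by simp
qed

lemma diff_quotient_test_pairing_tendsto:
  assumes wd: "weak_deriv_L2 i u g" and \<phi>: "test_function UNIV \<phi>"
  shows "((\<lambda>h. \<integral>x. \<phi> x * diff_quotient i h u x \<partial>lborel) \<longlongrightarrow> (\<integral>x. \<phi> x * g x \<partial>lborel)) (at 0)"
proof -
  have u: "sq_integrable lborel u" using wd by (auto simp: weak_deriv_L2_def)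
  have [measurable]: "u \<in> borel_measurable borel" using u by (simp add: sq_integrable_def)
  have [measurable]: "\<phi> \<in> borel_measurable borel" by (rule test_function_measurable[OF \<phi>])
  have "(\<integral>x. \<phi> x * diff_quotient i h u x \<partial>lborel) =
      ((\<integral>x. \<phi> (x - (0 + h) *\<^sub>R axis i 1) * u x \<partial>lborel) - (\<integral>x. \<phi> (x - 0 *\<^sub>R axis i 1) * u x \<partial>lborel)) / h" for h
  proof -
    have "(\<integral>x. \<phi> x * diff_quotient i h u x \<partial>lborel) = (\<integral>x. (\<phi> x * u (x + h *\<^sub>R axis i 1) - \<phi> x * u x) / h \<partial>lborel)"
      by (intro Bochner_Integration.integral_cong refl) (simp add: diff_quotient_def algebra_simps diff_divide_distrib)
    also have "\<dots> = (\<integral>x. \<phi> x * u (x + h *\<^sub>R axis i 1) - \<phi> x * u x \<partial>lborel) / h" by simp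
    also have "(\<integral>x. \<phi> x * u (x + h *\<^sub>R axis i 1) - \<phi> x * u x \<partial>lborel) =
        (\<integral>x. \<phi> x * u (x + h *\<^sub>R axis i 1) \<partial>lborel) - (\<integral>x. \<phi> x * u x \<partial>lborel)"
      by (intro Bochner_Integration.integral_diff sq_integrable_mult sq_integrable_shift u
          test_function_sq_integrable[OF \<phi>])
    finally show ?thesis by (simp add: shift_pairing)
  qed
  then show ?thesis using pairing_DERIV_0[OF wd \<phi>] by (simp add: DERIV_def)
qed

text \<open>
  The quotients are bounded in \<open>L\<^sup>2\<close>, so convergence against the dense set of test functions suffices.
\<close>

lemma diff_quotient_weakly_tendsto:
  assumes wd: "weak_deriv_L2 i u g" and w: "sq_integrable lborel w"
  shows "((\<lambda>h. \<integral>x. w x * diff_quotient i h u x \<partial>lborel) \<longlongrightarrow> (\<integral>x. w x * g x \<partial>lborel)) (at 0)"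
proof (rule tendstoI)
  fix e :: real assume "0 < e"
  have u: "sq_integrable lborel u" and g: "sq_integrable lborel g" using wd by (auto simp: weak_deriv_L2_def)
  define G where "G = l2 lborel g + 1"
  have G: "0 < G" "l2 lborel g \<le> G" using l2_nonneg[of lborel g] by (auto simp: G_def)
  have "0 < (e / (4 * G))\<^sup>2" using \<open>0 < e\<close> G by simp
  then obtain \<phi> where \<phi>: "test_function UNIV \<phi>" "(\<integral>x. (norm (w x - \<phi> x))\<^sup>2 \<partial>lborel) < (e / (4 * G))\<^sup>2"
    using test_functions_dense_L2[OF w] unfolding test_approximable_def by blast
  note s\<phi> = test_function_sq_integrable[OF \<phi>(1)]
  note wf = sq_integrable_diff[OF w s\<phi>]
  have small: "l2 lborel (\<lambda>x. w x - \<phi> x) \<le> e / (4 * G)"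
    using \<open>0 < e\<close> G by (intro l2_leI \<phi>(2)) simp
  have close: "\<bar>(\<integral>x. w x * v x \<partial>lborel) - (\<integral>x. \<phi> x * v x \<partial>lborel)\<bar> \<le> e / 4"
    if v: "sq_integrable lborel v" "l2 lborel v \<le> l2 lborel g" for v
  proof -
    have "(\<integral>x. w x * v x \<partial>lborel) - (\<integral>x. \<phi> x * v x \<partial>lborel) = (\<integral>x. w x * v x - \<phi> x * v x \<partial>lborel)"
      by (intro Bochner_Integration.integral_diff[symmetric] sq_integrable_mult w v s\<phi>)
    also have "\<dots> = (\<integral>x. (w x - \<phi> x) * v x \<partial>lborel)" by (simp add: left_diff_distrib)
    also have "\<bar>\<dots>\<bar> \<le> l2 lborel (\<lambda>x. w x - \<phi> x) * l2 lborel v" by (rule l2_Cauchy_Schwarz[OF wf v(1)])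
    also have "\<dots> \<le> e / (4 * G) * G" using small v(2) G \<open>0 < e\<close> by (intro mult_mono) (auto simp: l2_nonneg)
    finally show ?thesis using G by simp
  qed
  have "\<forall>\<^sub>F h in at 0. dist (\<integral>x. \<phi> x * diff_quotient i h u x \<partial>lborel) (\<integral>x. \<phi> x * g x \<partial>lborel) < e / 4"
    using diff_quotient_test_pairing_tendsto[OF wd \<phi>(1)] \<open>0 < e\<close> by (intro tendstoD) auto
  then show "\<forall>\<^sub>F h in at 0. dist (\<integral>x. w x * diff_quotient i h u x \<partial>lborel) (\<integral>x. w x * g x \<partial>lborel) < e"
  proof eventually_elim
    case (elim h)
    show ?case
      using elim close[OF g order_refl] close[OF diff_quotient_sq_integrable[OF u] l2_dquot_le[OF wd], of h] \<open>0 < e\<close>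
      unfolding dist_real_def by linarith
  qed
qed

text \<open>
  Both sides expand into values of the correlation function \<open>c(z) = \<integral> u(x + z) v(x) dx\<close>. The forward
  quotient of \<open>u\<close> is paired with the backward quotient of \<open>v\<close> because only then is the resulting expression
  symmetric in the two increments.
\<close>

lemma diff_quotient_commute:
  assumes u: "sq_integrable lborel u" and v: "sq_integrable lborel v"
  shows "(\<integral>x. diff_quotient i h u x * diff_quotient j (- k) v x \<partial>lborel) = (\<integral>x. diff_quotient j k u x * diff_quotient i (- h) v x \<partial>lborel)"
proof -
  have [measurable]: "u \<in> borel_measurable borel" "v \<in> borel_measurable borel" using u v by (auto simp: sq_integrable_def)
  define c where "c z = (\<integral>x. u (x + z) * v x \<partial>lborel)" for z
  have corr: "(\<integral>x. u (x + a) * v (x - b) \<partial>lborel) = c (a + b)" for a b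
    using lborel_integrable_shift(2)[of "\<lambda>x. u (x + a) * v (x - b)" b] by (simp add: c_def add_ac)
  have *: "(\<integral>x. (u (x + a) - u x) * (v x - v (x - b)) \<partial>lborel) = c a - c (a + b) - c 0 + c b" for a b
  proof -
    have int: "integrable lborel (\<lambda>x. u (x + a) * v (x - b))" for a b
      using sq_integrable_shift(1)[OF v, of "- b"] by (intro sq_integrable_mult sq_integrable_shift u) simp
    have "(\<integral>x. (u (x + a) - u x) * (v x - v (x - b)) \<partial>lborel) =
        (\<integral>x. u (x + a) * v (x - 0) - u (x + a) * v (x - b) - u (x + 0) * v (x - 0) + u (x + 0) * v (x - b) \<partial>lborel)"
      by (simp add: algebra_simps)
    also have "\<dots> = c (a + 0) - c (a + b) - c (0 + 0) + c (0 + b)"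
      by (subst Bochner_Integration.integral_add Bochner_Integration.integral_diff; (intro Bochner_Integration.integrable_diff int)?)+
         (simp only: corr)
    finally show ?thesis by simp
  qed
  have "(\<integral>x. diff_quotient i h u x * diff_quotient j (- k) v x \<partial>lborel) =
      (c (h *\<^sub>R axis i 1) - c (h *\<^sub>R axis i 1 + k *\<^sub>R axis j 1) - c 0 + c (k *\<^sub>R axis j 1)) / (h * k)" for h k and i j :: 'a
  proof -
    have "diff_quotient j (- k) v x = (v x - v (x - k *\<^sub>R axis j 1)) / k" for x
      using minus_divide_divide[of "v x - v (x - k *\<^sub>R axis j 1)" k] by (simp add: diff_quotient_def)
    then have "diff_quotient i h u x * diff_quotient j (- k) v x =
        (u (x + h *\<^sub>R axis i 1) - u x) * (v x - v (x - k *\<^sub>R axis j 1)) / (h * k)" for x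
      by (simp only: diff_quotient_def times_divide_times_eq)
    then show ?thesis by (simp add: *)
  qed
  then show ?thesis by (simp add: add_ac mult.commute)
qed

text \<open>
  For smooth functions this is integration by parts, done twice. Here the identity for difference
  quotients passes to the limit in one increment after the other; each limit needs only weak convergence.
\<close>

lemma weak_deriv_mixed_commute:
  assumes ui: "weak_deriv_L2 i u ui" and uj: "weak_deriv_L2 j u uj"
    and vi: "weak_deriv_L2 i v vi" and vj: "weak_deriv_L2 j v vj"
  shows "(\<integral>x. ui x * vj x \<partial>lborel) = (\<integral>x. uj x * vi x \<partial>lborel)"
proof -
  have s: "sq_integrable lborel u" "sq_integrable lborel v" "sq_integrable lborel ui" "sq_integrable lborel uj"
    "sq_integrable lborel vi" "sq_integrable lborel vj"
    using assms by (auto simp: weak_deriv_L2_def)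
  have neg: "filterlim (\<lambda>k::real. - k) (at 0) (at 0)"
    by (rule filterlim_atI) (auto intro!: tendsto_eq_intros simp: eventually_at_filter)
  have step: "(\<integral>x. diff_quotient i h u x * vj x \<partial>lborel) = (\<integral>x. uj x * diff_quotient i (- h) v x \<partial>lborel)" for h
  proof (rule tendsto_unique)
    show "((\<lambda>k. \<integral>x. diff_quotient i h u x * diff_quotient j (- k) v x \<partial>lborel) \<longlongrightarrow> (\<integral>x. diff_quotient i h u x * vj x \<partial>lborel)) (at 0)"
      using filterlim_compose[OF diff_quotient_weakly_tendsto[OF vj diff_quotient_sq_integrable[OF s(1)]] neg] by simp
    show "((\<lambda>k. \<integral>x. diff_quotient i h u x * diff_quotient j (- k) v x \<partial>lborel) \<longlongrightarrow> (\<integral>x. uj x * diff_quotient i (- h) v x \<partial>lborel)) (at 0)"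
      using diff_quotient_weakly_tendsto[OF uj diff_quotient_sq_integrable[OF s(2), of i "- h"]]
      by (simp add: diff_quotient_commute[OF s(1,2)] mult.commute)
  qed simp
  show ?thesis
  proof (rule tendsto_unique)
    show "((\<lambda>h. \<integral>x. diff_quotient i h u x * vj x \<partial>lborel) \<longlongrightarrow> (\<integral>x. ui x * vj x \<partial>lborel)) (at 0)"
      using diff_quotient_weakly_tendsto[OF ui s(6)] by (simp add: mult.commute)
    show "((\<lambda>h. \<integral>x. diff_quotient i h u x * vj x \<partial>lborel) \<longlongrightarrow> (\<integral>x. uj x * vi x \<partial>lborel)) (at 0)"
      unfolding step using filterlim_compose[OF diff_quotient_weakly_tendsto[OF vi s(4)] neg] by simp
  qed simp
qed

section \<open>The symbols of the Hodge--Dirac operators\<close>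

lemma ext_e_wedge_nth:
  "(ext_e i \<and>\<^sub>e w) $ S = (if i \<in> S then shuffle_sign {i} (S - {i}) * w $ (S - {i}) else 0)"
proof -
  have "(ext_e i \<and>\<^sub>e w) $ S =
      (\<Sum>T\<in>Pow S. if T = {i} then shuffle_sign {i} (S - {i}) * w $ (S - {i}) else 0)"
    unfolding ext_e_eq wedge_def ext_basis_def vec_lambda_beta
    by (intro sum.cong refl) (auto simp: axis_def)
  then show ?thesis by (simp add: sum.delta)
qed

lemma inner_ext_basis: "u \<bullet> ext_basis S = u $ S"
  by (simp add: ext_basis_def inner_axis)

lemma interior_mult_nth:
  "interior_mult i u $ S = (if i \<in> S then 0 else shuffle_sign {i} S * u $ insert i S)"
proof -
  have "interior_mult i u $ S = interior_mult i u \<bullet> ext_basis S" by (simp add: inner_ext_basis)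
  also have "\<dots> = u \<bullet> (ext_e i \<and>\<^sub>e ext_basis S)" by (rule interior_mult_adjoint)
  also have "\<dots> = (if i \<in> S then 0 else shuffle_sign {i} S * u $ insert i S)"
    by (simp add: ext_e_eq wedge_ext_basis inner_ext_basis)
  finally show ?thesis .
qed

lemma linear_interior_mult: "linear (interior_mult i)"
  unfolding interior_mult_def by (rule adjoint_linear[OF linear_wedge_right])

lemma shuffle_sign_square: "shuffle_sign S T * shuffle_sign S T = 1"
  by (simp add: shuffle_sign_def flip: power_mult_distrib)

lemma shuffle_sign_singletons: "i \<noteq> j \<Longrightarrow> shuffle_sign {i} {j} * shuffle_sign {j} {i} = - 1"
proof -
  assume "i \<noteq> j"
  have "{(s, t) \<in> {a} \<times> {b}. t < s} = (if b < a then {(a, b)} else {})" for a b :: 'a by auto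
  then have "shuffle_sign {a} {b} = (if b < a then - 1 else 1)" for a b :: 'a by (simp add: shuffle_sign_def)
  then show ?thesis using \<open>i \<noteq> j\<close> by auto
qed

text \<open>
  For \<open>i \<noteq> j\<close> the two terms have the same coefficient up to a sign: inserting \<open>j\<close> before removing \<open>i\<close>
  instead of after it changes the shuffle signs by one transposition.
\<close>

lemma wedge_interior_anticommute:
  "ext_e i \<and>\<^sub>e interior_mult j w + interior_mult j (ext_e i \<and>\<^sub>e w) = (if i = j then w else 0)"
proof -
  have "(ext_e i \<and>\<^sub>e interior_mult j w + interior_mult j (ext_e i \<and>\<^sub>e w)) $ S = (if i = j then w else 0) $ S" for S
  proof (cases "i = j")
    case True
    then show ?thesis
      by (cases "i \<in> S") (auto simp: ext_e_wedge_nth interior_mult_nth insert_absorb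
          shuffle_sign_square simp flip: mult.assoc)
  next
    case False
    show ?thesis
    proof (cases "i \<in> S \<and> j \<notin> S")
      case True
      define R where "R = S - {i}"
      have R: "S = insert i R" "i \<notin> R" "j \<notin> R" "insert j S - {i} = insert j R" using True False by (auto simp: R_def)
      have 1: "shuffle_sign {j} (insert i R) = shuffle_sign {j} {i} * shuffle_sign {j} R"
        using shuffle_sign_Un_right[of "{i}" R "{j}"] R by simp
      have 2: "shuffle_sign {i} (insert j R) = shuffle_sign {i} {j} * shuffle_sign {i} R"
        using shuffle_sign_Un_right[of "{j}" R "{i}"] R by simp
      have "interior_mult j (ext_e i \<and>\<^sub>e w) $ S =
          (shuffle_sign {i} {j} * shuffle_sign {j} {i}) * (shuffle_sign {i} R * shuffle_sign {j} R * w $ insert j R)"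
        using True R False by (simp add: interior_mult_nth ext_e_wedge_nth 1 2)
      moreover have "(ext_e i \<and>\<^sub>e interior_mult j w) $ S = shuffle_sign {i} R * shuffle_sign {j} R * w $ insert j R"
        using True R False by (simp add: interior_mult_nth ext_e_wedge_nth)
      ultimately show ?thesis using False by (simp add: shuffle_sign_singletons)
    next
      assume "\<not> (i \<in> S \<and> j \<notin> S)"
      then show ?thesis using False by (auto simp: interior_mult_nth ext_e_wedge_nth)
    qed
  qed
  then show ?thesis by (simp add: vec_eq_iff)
qed

lemma ext_e_wedge_anticommute: "ext_e i \<and>\<^sub>e (ext_e j \<and>\<^sub>e w) = - (ext_e j \<and>\<^sub>e (ext_e i \<and>\<^sub>e w))"
proof -
  have "(ext_e i + ext_e j) \<and>\<^sub>e (ext_e i + ext_e j) = 0"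
    using wedge_ext_vec_self[of "axis i 1 + axis j 1"] by (simp add: linear_add[OF linear_ext_vec])
  then have "ext_e i \<and>\<^sub>e ext_e j + ext_e j \<and>\<^sub>e ext_e i = 0"
    by (simp add: linear_add[OF linear_wedge_left] linear_add[OF linear_wedge_right] wedge_ext_vec_self add.commute)
  then have "(ext_e i \<and>\<^sub>e ext_e j + ext_e j \<and>\<^sub>e ext_e i) \<and>\<^sub>e w = 0"
    by (simp add: linear_0[OF linear_wedge_left])
  then show ?thesis
    by (simp add: linear_add[OF linear_wedge_left] wedge_assoc eq_neg_iff_add_eq_0)
qed

lemma linear_matrix_inner:
  fixes A :: "real ^ 's \<Rightarrow> real ^ 's"
  assumes "linear A"
  shows "A u \<bullet> v = (\<Sum>S\<in>UNIV. \<Sum>T\<in>UNIV. A (axis S 1) $ T * (u $ S * v $ T))"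
proof -
  have "A u = A (\<Sum>S\<in>UNIV. (u $ S) *\<^sub>R axis S 1)"
    using basis_expansion[of u] by (simp add: scalar_mult_eq_scaleR)
  also have "\<dots> = (\<Sum>S\<in>UNIV. (u $ S) *\<^sub>R A (axis S 1))"
    by (simp add: linear_sum[OF assms] linear_cmul[OF assms])
  finally have "A u \<bullet> v = (\<Sum>S\<in>UNIV. (u $ S) * (A (axis S 1) \<bullet> v))"
    by (simp add: inner_sum_left)
  then show ?thesis by (simp add: inner_vec_def sum_distrib_left mult_ac)
qed

text \<open>
  The principal symbol of \<open>d\<close>: applied to the partial derivatives of a field it gives the exterior
  derivative. Likewise \<open>int_div\<close> below for the interior derivative.
\<close>

definition ext_div :: "('n::{finite,linorder} \<Rightarrow> 'n ext) \<Rightarrow> 'n ext" where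
  "ext_div p = (\<Sum>i\<in>UNIV. ext_e i \<and>\<^sub>e p i)"

definition int_div :: "('n::{finite,linorder} \<Rightarrow> 'n ext) \<Rightarrow> 'n ext" where
  "int_div p = (\<Sum>i\<in>UNIV. interior_mult i (p i))"

text \<open>
  Write \<open>d\<close> and \<open>\<delta>\<close> for the two symbols applied to \<open>P\<close>. By \<open>sym\<close>, the integral of \<open>A(P\<^sub>i) \<bullet> P\<^sub>j\<close>
  is symmetric in \<open>i\<close> and \<open>j\<close> for each linear map \<open>A\<close>. For \<open>d \<bullet> \<delta>\<close> the maps are
  \<open>e\<^sub>j \<and> (e\<^sub>i \<and> w)\<close>, which are antisymmetric, so the sum vanishes. For \<open>d \<bullet> d + \<delta> \<bullet> \<delta>\<close> the symmetry
  exchanges \<open>i\<close> and \<open>j\<close> in the second part only, and the anticommutation rule leaves the diagonal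
  terms.
\<close>

lemma integral_dirac_symbol:
  fixes P :: "'n::{finite,linorder} \<Rightarrow> 'a \<Rightarrow> 'n ext"
  assumes P: "\<And>i. sq_integrable M (P i)"
    and sym: "\<And>i j S T. (\<integral>x. P i x $ S * P j x $ T \<partial>M) = (\<integral>x. P j x $ S * P i x $ T \<partial>M)"
  shows "(\<integral>x. (norm (ext_div (\<lambda>i. P i x) + int_div (\<lambda>i. P i x)))\<^sup>2 \<partial>M) = (\<Sum>i\<in>UNIV. \<integral>x. (norm (P i x))\<^sup>2 \<partial>M)" (is ?plus)
    and "(\<integral>x. (norm (ext_div (\<lambda>i. P i x) - int_div (\<lambda>i. P i x)))\<^sup>2 \<partial>M) = (\<Sum>i\<in>UNIV. \<integral>x. (norm (P i x))\<^sup>2 \<partial>M)" (is ?minus)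
proof -
  define J where "J i j A = (\<integral>x. A (P i x) \<bullet> P j x \<partial>M)" for i j and A :: "'n ext \<Rightarrow> 'n ext"
  have Jint: "integrable M (\<lambda>x. A (P i x) \<bullet> P j x)" if "linear A" for A i j
    by (intro sq_integrable_inner sq_integrable_linear[OF that] P)
  have Jswap: "J i j A = J j i A" if "linear A" for i j A
  proof -
    have int: "integrable M (\<lambda>x. P i x $ S * P j x $ T)" for i j S T
      by (intro sq_integrable_mult sq_integrable_component P)
    have "J i j A = (\<Sum>S\<in>UNIV. \<Sum>T\<in>UNIV. A (axis S 1) $ T * (\<integral>x. P i x $ S * P j x $ T \<partial>M))" for i j
      unfolding J_def linear_matrix_inner[OF that]
      using int by (simp add: Bochner_Integration.integral_sum Bochner_Integration.integrable_sum)
    then show ?thesis using sym by simp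
  qed
  have l1: "linear (\<lambda>w. ext_e j \<and>\<^sub>e (ext_e i \<and>\<^sub>e w))" for i j :: 'n
    using linear_compose[OF linear_wedge_right linear_wedge_right] by (simp add: o_def)
  have l2: "linear (\<lambda>w. ext_e j \<and>\<^sub>e interior_mult i w)" for i j :: 'n
    using linear_compose[OF linear_interior_mult linear_wedge_right] by (simp add: o_def)
  have l3: "linear (\<lambda>w. interior_mult j (ext_e i \<and>\<^sub>e w))" for i j :: 'n
    using linear_compose[OF linear_wedge_right linear_interior_mult] by (simp add: o_def)
  have adj: "u \<bullet> interior_mult i v = (ext_e i \<and>\<^sub>e u) \<bullet> v" for u v and i :: 'n
    by (metis interior_mult_adjoint inner_commute)
  have adj': "u \<bullet> (ext_e i \<and>\<^sub>e v) = interior_mult i u \<bullet> v" for u v and i :: 'n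
    by (simp add: interior_mult_adjoint)
  define d where "d x = ext_div (\<lambda>i. P i x)" for x
  define \<delta> where "\<delta> x = int_div (\<lambda>i. P i x)" for x
  have d: "sq_integrable M d" unfolding d_def[abs_def] ext_div_def
    by (intro sq_integrable_sum sq_integrable_linear[OF linear_wedge_right] P)
  have \<delta>: "sq_integrable M \<delta>" unfolding \<delta>_def[abs_def] int_div_def
    by (intro sq_integrable_sum sq_integrable_linear[OF linear_interior_mult] P)
  have d\<delta>: "d x \<bullet> \<delta> x = (\<Sum>i\<in>UNIV. \<Sum>j\<in>UNIV. (ext_e j \<and>\<^sub>e (ext_e i \<and>\<^sub>e P i x)) \<bullet> P j x)" for x
    unfolding d_def \<delta>_def ext_div_def int_div_def inner_sum_left by (simp only: inner_sum_right adj)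
  have dd: "d x \<bullet> d x = (\<Sum>i\<in>UNIV. \<Sum>j\<in>UNIV. interior_mult j (ext_e i \<and>\<^sub>e P i x) \<bullet> P j x)" for x
    unfolding d_def ext_div_def inner_sum_left by (simp only: inner_sum_right adj')
  have \<delta>\<delta>: "\<delta> x \<bullet> \<delta> x = (\<Sum>i\<in>UNIV. \<Sum>j\<in>UNIV. (ext_e j \<and>\<^sub>e interior_mult i (P i x)) \<bullet> P j x)" for x
    unfolding \<delta>_def int_div_def inner_sum_left by (simp only: inner_sum_right adj)
  have cross: "(\<integral>x. d x \<bullet> \<delta> x \<partial>M) = 0"
  proof -
    define X where "X = (\<Sum>i\<in>UNIV. \<Sum>j\<in>UNIV. J i j (\<lambda>w. ext_e j \<and>\<^sub>e (ext_e i \<and>\<^sub>e w)))"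
    have anti: "J i j (\<lambda>w. ext_e j \<and>\<^sub>e (ext_e i \<and>\<^sub>e w)) = - J j i (\<lambda>w. ext_e i \<and>\<^sub>e (ext_e j \<and>\<^sub>e w))" for i j
    proof -
      have "J i j (\<lambda>w. ext_e j \<and>\<^sub>e (ext_e i \<and>\<^sub>e w)) = J j i (\<lambda>w. ext_e j \<and>\<^sub>e (ext_e i \<and>\<^sub>e w))" by (rule Jswap[OF l1])
      also have "\<dots> = - J j i (\<lambda>w. ext_e i \<and>\<^sub>e (ext_e j \<and>\<^sub>e w))"
        unfolding J_def ext_e_wedge_anticommute[of j i] by simp
      finally show ?thesis .
    qed
    have "X = - (\<Sum>i\<in>UNIV. \<Sum>j\<in>UNIV. J j i (\<lambda>w. ext_e i \<and>\<^sub>e (ext_e j \<and>\<^sub>e w)))"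
      unfolding X_def sum_negf[symmetric] by (intro sum.cong refl anti)
    also have "(\<Sum>i\<in>UNIV. \<Sum>j\<in>UNIV. J j i (\<lambda>w. ext_e i \<and>\<^sub>e (ext_e j \<and>\<^sub>e w))) = X"
      unfolding X_def by (rule sum.swap)
    finally have "X = 0" by simp
    then show ?thesis unfolding d\<delta> X_def J_def
      by (simp add: Bochner_Integration.integral_sum Bochner_Integration.integrable_sum Jint[OF l1])
  qed
  have diag: "(\<integral>x. d x \<bullet> d x \<partial>M) + (\<integral>x. \<delta> x \<bullet> \<delta> x \<partial>M) = (\<Sum>i\<in>UNIV. \<integral>x. (norm (P i x))\<^sup>2 \<partial>M)"
  proof -
    have "(\<integral>x. \<delta> x \<bullet> \<delta> x \<partial>M) = (\<Sum>i\<in>UNIV. \<Sum>j\<in>UNIV. J i j (\<lambda>w. ext_e j \<and>\<^sub>e interior_mult i w))"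
      unfolding \<delta>\<delta> J_def
      by (simp add: Bochner_Integration.integral_sum Bochner_Integration.integrable_sum Jint[OF l2])
    also have "\<dots> = (\<Sum>i\<in>UNIV. \<Sum>j\<in>UNIV. J j i (\<lambda>w. ext_e j \<and>\<^sub>e interior_mult i w))"
      by (intro sum.cong refl Jswap l2)
    also have "\<dots> = (\<Sum>i\<in>UNIV. \<Sum>j\<in>UNIV. J i j (\<lambda>w. ext_e i \<and>\<^sub>e interior_mult j w))" by (rule sum.swap)
    finally have "(\<integral>x. d x \<bullet> d x \<partial>M) + (\<integral>x. \<delta> x \<bullet> \<delta> x \<partial>M) =
        (\<Sum>i\<in>UNIV. \<Sum>j\<in>UNIV. J i j (\<lambda>w. interior_mult j (ext_e i \<and>\<^sub>e w)) + J i j (\<lambda>w. ext_e i \<and>\<^sub>e interior_mult j w))"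
      unfolding dd
      by (simp add: Bochner_Integration.integral_sum Bochner_Integration.integrable_sum Jint[OF l3] sum.distrib J_def)
    also have "\<dots> = (\<Sum>i\<in>UNIV. \<Sum>j\<in>UNIV. if i = j then \<integral>x. (norm (P i x))\<^sup>2 \<partial>M else 0)"
    proof (intro sum.cong refl)
      fix i j
      have "J i j (\<lambda>w. interior_mult j (ext_e i \<and>\<^sub>e w)) + J i j (\<lambda>w. ext_e i \<and>\<^sub>e interior_mult j w) =
          (\<integral>x. interior_mult j (ext_e i \<and>\<^sub>e P i x) \<bullet> P j x + (ext_e i \<and>\<^sub>e interior_mult j (P i x)) \<bullet> P j x \<partial>M)"
        unfolding J_def by (intro Bochner_Integration.integral_add[symmetric] Jint l2 l3)
      also have "\<dots> = (\<integral>x. (if i = j then P i x else 0) \<bullet> P j x \<partial>M)"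
        by (simp only: inner_add_left[symmetric] add.commute[of "interior_mult _ _"] wedge_interior_anticommute)
      also have "\<dots> = (if i = j then \<integral>x. (norm (P i x))\<^sup>2 \<partial>M else 0)" by (simp add: power2_norm_eq_inner)
      finally show "J i j (\<lambda>w. interior_mult j (ext_e i \<and>\<^sub>e w)) + J i j (\<lambda>w. ext_e i \<and>\<^sub>e interior_mult j w) =
          (if i = j then \<integral>x. (norm (P i x))\<^sup>2 \<partial>M else 0)" .
    qed
    finally show ?thesis by simp
  qed
  have exp_plus: "(norm (d x + \<delta> x))\<^sup>2 = d x \<bullet> d x + \<delta> x \<bullet> \<delta> x + 2 * (d x \<bullet> \<delta> x)"
    and exp_minus: "(norm (d x - \<delta> x))\<^sup>2 = d x \<bullet> d x + \<delta> x \<bullet> \<delta> x - 2 * (d x \<bullet> \<delta> x)" for x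
    unfolding power2_norm_eq_inner
    by (simp_all add: inner_add_left inner_add_right inner_diff_left inner_diff_right inner_commute)
  note ints = sq_integrable_inner[OF d d] sq_integrable_inner[OF \<delta> \<delta>] sq_integrable_inner[OF d \<delta>]
  show ?plus unfolding d_def[symmetric] \<delta>_def[symmetric] exp_plus using ints cross diag by simp
  show ?minus unfolding d_def[symmetric] \<delta>_def[symmetric] exp_minus using ints cross diag by simp
qed

section \<open>Compactness in the space of square integrable functions\<close>

text \<open>
  The cubes of the grid of mesh \<open>1/m\<close>; the labels \<open>z\<close> are the integer vectors.
\<close>

definition cell :: "nat \<Rightarrow> ('n::finite \<Rightarrow> int) \<Rightarrow> (real ^ 'n) set" where
  "cell m z = {x. \<forall>i. \<lfloor>real m * x $ i\<rfloor> = z i}"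

lemma cell_bounds:
  assumes "0 < m"
  shows "x \<in> cell m z \<longleftrightarrow> (\<forall>i. of_int (z i) / real m \<le> x $ i \<and> x $ i < (of_int (z i) + 1) / real m)"
  using assms by (auto simp: cell_def floor_eq_iff field_simps)

lemma cell_measurable [measurable]: "0 < m \<Longrightarrow> cell m z \<in> sets borel"
proof -
  assume m: "0 < m"
  have "cell m z = (\<Inter>i. {x. of_int (z i) / real m \<le> x $ i} \<inter> {x. x $ i < (of_int (z i) + 1) / real m})"
    using cell_bounds[OF m, of _ z] by auto
  also have "\<dots> \<in> sets borel"
    by (intro sets.countable_INT' sets.Int borel_closed borel_open closed_halfspace_component_ge_cart
        open_halfspace_component_lt_cart image_subsetI) auto
  finally show ?thesis .
qed

lemma emeasure_cell:
  fixes z :: "'n::finite \<Rightarrow> int"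
  assumes m: "0 < m"
  shows "emeasure lborel (cell m z) = ennreal ((1 / real m) ^ CARD('n))"
proof -
  define a b where "a = (\<chi> i. of_int (z i) / real m)" and "b = (\<chi> i. (of_int (z i) + 1) / real m)"
  have le: "a $ i \<le> b $ i" for i using m by (simp add: a_def b_def divide_right_mono)
  have ne: "cbox a b \<noteq> {}" using le by (simp add: interval_ne_empty_cart)
  have "measure lborel (cbox a b) = (\<Prod>i\<in>UNIV. b $ i - a $ i)" by (rule content_cbox_cart[OF ne])
  also have "\<dots> = (1 / real m) ^ CARD('n)" by (simp add: a_def b_def flip: diff_divide_distrib)
  finally have "measure lborel (cbox a b) = (1 / real m) ^ CARD('n)" .
  then have c: "emeasure lborel (cbox a b) = ennreal ((1 / real m) ^ CARD('n))"
    using emeasure_lborel_cbox_finite[of a b] by (subst emeasure_eq_ennreal_measure) auto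
  have "box a b \<subseteq> cell m z" "cell m z \<subseteq> cbox a b"
    unfolding subset_iff cell_bounds[OF m] mem_box_cart a_def b_def by (auto simp: less_imp_le)
  then have "emeasure lborel (box a b) \<le> emeasure lborel (cell m z)" "emeasure lborel (cell m z) \<le> emeasure lborel (cbox a b)"
    using m by (auto intro!: emeasure_mono)
  moreover have "emeasure lborel (box a b) = emeasure lborel (cbox a b)"
    by (simp add: emeasure_lborel_box_eq emeasure_lborel_cbox_eq)
  ultimately show ?thesis using c by simp
qed

lemma measure_cell: "0 < m \<Longrightarrow> measure lborel (cell m z) = (1 / real m) ^ CARD('n)" for z :: "'n::finite \<Rightarrow> int"
  by (simp add: measure_def emeasure_cell)

lemma sq_integrable_imp_integrable_on:
  fixes w :: "'a \<Rightarrow> 'b::euclidean_space"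
  assumes w: "sq_integrable M w" and Q: "Q \<in> sets M" "emeasure M Q < \<infinity>"
  shows "integrable M (\<lambda>x. indicator Q x *\<^sub>R w x)"
    and "norm (\<integral>x. indicator Q x *\<^sub>R w x \<partial>M) \<le> measure M Q + (\<integral>x. (norm (w x))\<^sup>2 \<partial>M)"
proof -
  have [measurable]: "w \<in> borel_measurable M" "Q \<in> sets M" using w Q by (auto simp: sq_integrable_def)
  have ind: "integrable M (indicator Q :: _ \<Rightarrow> real)" using Q by (rule integrable_real_indicator)
  have t: "t \<le> 1 + t\<^sup>2" if "0 \<le> t" for t :: real using sum_squares_bound[of t 1] that by simp
  have le: "norm (indicator Q x *\<^sub>R w x) \<le> indicator Q x + (norm (w x))\<^sup>2" for x
    using t[of "norm (w x)"] by (auto simp: indicator_def)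
  have int: "integrable M (\<lambda>x. indicator Q x + (norm (w x))\<^sup>2)"
    using ind w by (intro Bochner_Integration.integrable_add) (auto simp: sq_integrable_def)
  show i: "integrable M (\<lambda>x. indicator Q x *\<^sub>R w x)"
    by (rule Bochner_Integration.integrable_bound[OF int]) (use le in \<open>auto intro: order_trans[OF _ abs_ge_self]\<close>)
  have "norm (\<integral>x. indicator Q x *\<^sub>R w x \<partial>M) \<le> (\<integral>x. norm (indicator Q x *\<^sub>R w x) \<partial>M)"
    by (rule integral_norm_bound)
  also have "\<dots> \<le> (\<integral>x. indicator Q x + (norm (w x))\<^sup>2 \<partial>M)"
    by (intro integral_mono integrable_norm i int le)
  also have "\<dots> = measure M Q + (\<integral>x. (norm (w x))\<^sup>2 \<partial>M)"
    using ind w Q by (simp add: sq_integrable_def)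
  finally show "norm (\<integral>x. indicator Q x *\<^sub>R w x \<partial>M) \<le> measure M Q + (\<integral>x. (norm (w x))\<^sup>2 \<partial>M)" .
qed

text \<open>
  Expand the square. The nonnegative integral is used because it is estimated by Fubini's theorem later.
\<close>

lemma variance_double_integral:
  fixes w :: "'a \<Rightarrow> 'b::euclidean_space"
  assumes w: "sq_integrable M w" and Q: "Q \<in> sets M" "emeasure M Q < \<infinity>"
  shows "(norm (\<integral>x. indicator Q x *\<^sub>R w x \<partial>M))\<^sup>2 \<le> measure M Q * (\<integral>x. indicator Q x * (norm (w x))\<^sup>2 \<partial>M)"
    and "(\<integral>\<^sup>+x. \<integral>\<^sup>+y. ennreal (indicator Q x * (indicator Q y * (norm (w x - w y))\<^sup>2)) \<partial>M \<partial>M) =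
    ennreal (2 * (measure M Q * (\<integral>x. indicator Q x * (norm (w x))\<^sup>2 \<partial>M) - (norm (\<integral>x. indicator Q x *\<^sub>R w x \<partial>M))\<^sup>2))"
proof -
  note iw = sq_integrable_imp_integrable_on(1)[OF w Q]
  have [measurable]: "w \<in> borel_measurable M" "Q \<in> sets M" using w Q by (auto simp: sq_integrable_def)
  have ind: "integrable M (indicator Q :: _ \<Rightarrow> real)" using Q by (rule integrable_real_indicator)
  have isq: "integrable M (\<lambda>x. indicator Q x * (norm (w x))\<^sup>2)"
    using integrable_mult_indicator[OF Q(1) sq_integrable_norm_sq[OF w]] by simp
  define W S q where "W = (\<integral>x. indicator Q x *\<^sub>R w x \<partial>M)" and "S = (\<integral>x. indicator Q x * (norm (w x))\<^sup>2 \<partial>M)"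
    and "q = measure M Q"
  have qi: "(\<integral>x. indicator Q x \<partial>M) = q" using Q by (simp add: q_def)
  have e1: "indicator Q y * (norm (w x - w y))\<^sup>2 =
      (norm (w x))\<^sup>2 * indicator Q y - 2 * (w x \<bullet> (indicator Q y *\<^sub>R w y)) + indicator Q y * (norm (w y))\<^sup>2" for x y
    unfolding power2_norm_eq_inner by (simp add: inner_diff_left inner_diff_right inner_commute algebra_simps)
  have i1: "integrable M (\<lambda>y. indicator Q y * (norm (w x - w y))\<^sup>2)" for x
    unfolding e1 using ind iw isq
    by (intro Bochner_Integration.integrable_add Bochner_Integration.integrable_diff integrable_mult_right integrable_inner_right) auto
  have v1: "(\<integral>y. indicator Q y * (norm (w x - w y))\<^sup>2 \<partial>M) = (norm (w x))\<^sup>2 * q - 2 * (w x \<bullet> W) + S" for x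
    unfolding e1 using ind iw isq
    by (simp add: qi q_def[symmetric] W_def[symmetric] S_def[symmetric] del: inner_scaleR_left inner_scaleR_right)
  have inner: "(\<integral>\<^sup>+y. ennreal (indicator Q x * (indicator Q y * (norm (w x - w y))\<^sup>2)) \<partial>M) =
      ennreal (indicator Q x * ((norm (w x))\<^sup>2 * q - 2 * (w x \<bullet> W) + S))" for x
    unfolding v1[symmetric] integral_mult_right_zero[symmetric]
    by (intro nn_integral_eq_integral integrable_mult_right i1) auto
  have nonneg: "0 \<le> indicator Q x * ((norm (w x))\<^sup>2 * q - 2 * (w x \<bullet> W) + S)" for x
    unfolding v1[symmetric] by (intro mult_nonneg_nonneg Bochner_Integration.integral_nonneg) auto
  have e2: "indicator Q x * ((norm (w x))\<^sup>2 * q - 2 * (w x \<bullet> W) + S) =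
      indicator Q x * (norm (w x))\<^sup>2 * q - 2 * ((indicator Q x *\<^sub>R w x) \<bullet> W) + indicator Q x * S" for x
    by (simp add: algebra_simps)
  have outer: "(\<integral>\<^sup>+x. ennreal (indicator Q x * ((norm (w x))\<^sup>2 * q - 2 * (w x \<bullet> W) + S)) \<partial>M) =
      ennreal (\<integral>x. indicator Q x * ((norm (w x))\<^sup>2 * q - 2 * (w x \<bullet> W) + S) \<partial>M)"
  proof (rule nn_integral_eq_integral)
    show "integrable M (\<lambda>x. indicator Q x * ((norm (w x))\<^sup>2 * q - 2 * (w x \<bullet> W) + S))"
      unfolding e2 using ind iw isq
      by (intro Bochner_Integration.integrable_add Bochner_Integration.integrable_diff integrable_mult_right integrable_mult_left integrable_inner_left) auto
    show "AE x in M. 0 \<le> indicator Q x * ((norm (w x))\<^sup>2 * q - 2 * (w x \<bullet> W) + S)"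
      using nonneg by simp
  qed
  have val: "(\<integral>x. indicator Q x * ((norm (w x))\<^sup>2 * q - 2 * (w x \<bullet> W) + S) \<partial>M) = S * q - 2 * (W \<bullet> W) + q * S"
    unfolding e2 using ind iw isq
    by (simp add: qi q_def[symmetric] W_def[symmetric] S_def[symmetric] del: inner_scaleR_left inner_scaleR_right)
  have "0 \<le> S * q - 2 * (W \<bullet> W) + q * S"
    unfolding val[symmetric] using nonneg by (rule Bochner_Integration.integral_nonneg)
  then show "(norm (\<integral>x. indicator Q x *\<^sub>R w x \<partial>M))\<^sup>2 \<le> measure M Q * (\<integral>x. indicator Q x * (norm (w x))\<^sup>2 \<partial>M)"
    unfolding W_def[symmetric] S_def[symmetric] q_def[symmetric] by (simp add: dot_square_norm mult.commute)
  have "S * q - 2 * (W \<bullet> W) + q * S = 2 * (q * S - (norm W)\<^sup>2)"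
    by (simp add: dot_square_norm right_diff_distrib mult.commute)
  then show "(\<integral>\<^sup>+x. \<integral>\<^sup>+y. ennreal (indicator Q x * (indicator Q y * (norm (w x - w y))\<^sup>2)) \<partial>M \<partial>M) =
    ennreal (2 * (measure M Q * (\<integral>x. indicator Q x * (norm (w x))\<^sup>2 \<partial>M) - (norm (\<integral>x. indicator Q x *\<^sub>R w x \<partial>M))\<^sup>2))"
    unfolding W_def[symmetric] S_def[symmetric] q_def[symmetric] inner outer val by (simp only:)
qed

lemma nn_integral_lborel_shift:
  fixes f :: "'a::euclidean_space \<Rightarrow> ennreal"
  assumes [measurable]: "f \<in> borel_measurable borel"
  shows "(\<integral>\<^sup>+y. f (a + y) \<partial>lborel) = (\<integral>\<^sup>+y. f y \<partial>lborel)"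
proof -
  have "(\<integral>\<^sup>+y. f y \<partial>distr lborel borel ((+) a)) = (\<integral>\<^sup>+y. f (a + y) \<partial>lborel)"
    by (rule nn_integral_distr) auto
  then show ?thesis by (simp add: lborel_distr_plus)
qed

text \<open>
  Two points of the same cell differ by a vector in the cube \<open>H\<close> of side \<open>2/m\<close>. Substituting \<open>y = x + h\<close>
  and integrating over \<open>x\<close> first leaves the squared norms of the translation differences, integrated
  over \<open>H\<close>; the cells are disjoint, so summing over them costs nothing.
\<close>

lemma cell_sum_double_integral_le:
  fixes w :: "real ^ 'n::finite \<Rightarrow> 'b::euclidean_space"
  assumes m: "0 < m" and w: "sq_integrable lborel w" and "finite Z" and "0 \<le> C"
    and trans: "\<And>a. l2 lborel (\<lambda>x. w (x + a) - w x) \<le> C * norm a"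
  shows "(\<Sum>z\<in>Z. \<integral>\<^sup>+x. \<integral>\<^sup>+y. ennreal (indicator (cell m z) x * (indicator (cell m z) y * (norm (w x - w y))\<^sup>2)) \<partial>lborel \<partial>lborel)
    \<le> ennreal ((2 / real m) ^ CARD('n) * (C * (real CARD('n) / real m))\<^sup>2)"
proof -
  define H :: "(real ^ 'n) set" where "H = cbox (\<chi> i. - 1 / real m) (\<chi> i. 1 / real m)"
  have [measurable]: "w \<in> borel_measurable borel" using w by (simp add: sq_integrable_def)
  have [measurable]: "cell m z \<in> sets borel" for z :: "'n \<Rightarrow> int" using m by (rule cell_measurable)
  have [measurable]: "H \<in> sets borel" by (simp add: H_def)
  define k where "k x h = ennreal (indicator H h * (norm (w (x + h) - w x))\<^sup>2)" for x h
  have k_meas[measurable]: "(\<lambda>(x, h). k x h) \<in> borel_measurable (lborel \<Otimes>\<^sub>M lborel)"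
    unfolding k_def by measurable
  have diff_H: "h \<in> H" if "x \<in> cell m z" "x + h \<in> cell m z" for x h and z :: "'n \<Rightarrow> int"
  proof -
    have "- 1 / real m \<le> h $ i \<and> h $ i \<le> 1 / real m" for i
    proof -
      have "of_int (z i) / real m \<le> x $ i" "x $ i < (of_int (z i) + 1) / real m"
        "of_int (z i) / real m \<le> x $ i + h $ i" "x $ i + h $ i < (of_int (z i) + 1) / real m"
        using that unfolding cell_bounds[OF m] by auto
      then show ?thesis unfolding add_divide_distrib by auto
    qed
    then show ?thesis by (simp add: H_def mem_box_cart)
  qed
  have norm_H: "norm h \<le> real CARD('n) / real m" if "h \<in> H" for h
  proof -
    have "norm h \<le> (\<Sum>i\<in>UNIV. \<bar>h $ i\<bar>)" by (rule norm_le_l1_cart)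
    also have "\<dots> \<le> (\<Sum>i\<in>(UNIV::'n set). 1 / real m)"
      using that by (intro sum_mono) (auto simp: H_def mem_box_cart abs_le_iff minus_le_iff)
    finally show ?thesis by simp
  qed
  have emH: "emeasure lborel H = ennreal ((2 / real m) ^ CARD('n))"
  proof -
    have ne: "H \<noteq> {}" unfolding H_def by (simp add: interval_ne_empty_cart)
    have "measure lborel H = (\<Prod>i\<in>(UNIV::'n set). 1 / real m - - 1 / real m)"
      using content_cbox_cart[OF ne[unfolded H_def]] by (simp add: H_def)
    also have "1 / real m - - 1 / real m = 2 / real m" by simp
    finally have "measure lborel H = (2 / real m) ^ CARD('n)" by simp
    then show ?thesis
      using emeasure_lborel_cbox_finite[of "\<chi> i. - 1 / real m" "\<chi> i::'n. 1 / real m"]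
      by (subst emeasure_eq_ennreal_measure) (auto simp: H_def)
  qed
  have "(\<Sum>z\<in>Z. \<integral>\<^sup>+x. \<integral>\<^sup>+y. ennreal (indicator (cell m z) x * (indicator (cell m z) y * (norm (w x - w y))\<^sup>2)) \<partial>lborel \<partial>lborel)
      \<le> (\<Sum>z\<in>Z. \<integral>\<^sup>+x. indicator (cell m z) x * (\<integral>\<^sup>+h. k x h \<partial>lborel) \<partial>lborel)"
  proof (intro sum_mono nn_integral_mono)
    fix z :: "'n \<Rightarrow> int" and x :: "real ^ 'n"
    have "(\<integral>\<^sup>+y. ennreal (indicator (cell m z) x * (indicator (cell m z) y * (norm (w x - w y))\<^sup>2)) \<partial>lborel)
      = (\<integral>\<^sup>+h. ennreal (indicator (cell m z) x * (indicator (cell m z) (x + h) * (norm (w x - w (x + h)))\<^sup>2)) \<partial>lborel)"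
      by (rule nn_integral_lborel_shift[symmetric]) measurable
    also have "\<dots> \<le> (\<integral>\<^sup>+h. indicator (cell m z) x * k x h \<partial>lborel)"
    proof (rule nn_integral_mono)
      fix h show "ennreal (indicator (cell m z) x * (indicator (cell m z) (x + h) * (norm (w x - w (x + h)))\<^sup>2)) \<le> indicator (cell m z) x * k x h"
        using diff_H[of x z h] by (auto simp: k_def indicator_def norm_minus_commute)
    qed
    also have "\<dots> = indicator (cell m z) x * (\<integral>\<^sup>+h. k x h \<partial>lborel)" by (rule nn_integral_cmult) measurable
    finally show "(\<integral>\<^sup>+y. ennreal (indicator (cell m z) x * (indicator (cell m z) y * (norm (w x - w y))\<^sup>2)) \<partial>lborel)
      \<le> indicator (cell m z) x * (\<integral>\<^sup>+h. k x h \<partial>lborel)" .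
  qed
  also have "\<dots> = (\<integral>\<^sup>+x. (\<Sum>z\<in>Z. indicator (cell m z) x * (\<integral>\<^sup>+h. k x h \<partial>lborel)) \<partial>lborel)"
    by (rule nn_integral_sum[symmetric]) measurable
  also have "\<dots> \<le> (\<integral>\<^sup>+x. \<integral>\<^sup>+h. k x h \<partial>lborel \<partial>lborel)"
  proof (rule nn_integral_mono)
    fix x :: "real ^ 'n"
    have "(\<Sum>z\<in>Z. indicator (cell m z) x :: ennreal) = (\<Sum>z\<in>Z. if z = (\<lambda>i. \<lfloor>real m * x $ i\<rfloor>) then 1 else 0)"
      by (intro sum.cong) (auto simp: cell_def indicator_def)
    also have "\<dots> \<le> 1" using \<open>finite Z\<close> by simp
    finally have "(\<Sum>z\<in>Z. indicator (cell m z) x) * (\<integral>\<^sup>+h. k x h \<partial>lborel) \<le> 1 * (\<integral>\<^sup>+h. k x h \<partial>lborel)"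
      by (rule mult_right_mono) simp
    then show "(\<Sum>z\<in>Z. indicator (cell m z) x * (\<integral>\<^sup>+h. k x h \<partial>lborel)) \<le> (\<integral>\<^sup>+h. k x h \<partial>lborel)"
      by (simp add: sum_distrib_right)
  qed
  also have "\<dots> = (\<integral>\<^sup>+h. \<integral>\<^sup>+x. k x h \<partial>lborel \<partial>lborel)"
    by (rule lborel_pair.Fubini'[symmetric]) (use k_meas in \<open>simp add: split_beta'\<close>)
  also have "\<dots> \<le> (\<integral>\<^sup>+h. ennreal ((C * (real CARD('n) / real m))\<^sup>2) * indicator H h \<partial>lborel)"
  proof (rule nn_integral_mono)
    fix h :: "real ^ 'n"
    show "(\<integral>\<^sup>+x. k x h \<partial>lborel) \<le> ennreal ((C * (real CARD('n) / real m))\<^sup>2) * indicator H h"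
    proof (cases "h \<in> H")
      case True
      have "(\<integral>\<^sup>+x. k x h \<partial>lborel) = ennreal (\<integral>x. (norm (w (x + h) - w x))\<^sup>2 \<partial>lborel)"
        using True unfolding k_def
        by (simp add: nn_integral_eq_integral sq_integrable_norm_sq sq_integrable_diff sq_integrable_shift w)
      also have "(\<integral>x. (norm (w (x + h) - w x))\<^sup>2 \<partial>lborel) = (l2 lborel (\<lambda>x. w (x + h) - w x))\<^sup>2"
        by (simp add: l2_power2)
      also have "\<dots> \<le> (C * (real CARD('n) / real m))\<^sup>2"
        using trans[of h] mult_left_mono[OF norm_H[OF True] \<open>0 \<le> C\<close>]
        by (intro power_mono l2_nonneg) linarith
      finally show ?thesis using True by (simp add: ennreal_leI)
    qed (simp add: k_def)
  qed
  also have "\<dots> = ennreal ((C * (real CARD('n) / real m))\<^sup>2) * emeasure lborel H"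
    by (rule nn_integral_cmult_indicator) simp
  also have "\<dots> = ennreal ((2 / real m) ^ CARD('n) * (C * (real CARD('n) / real m))\<^sup>2)"
    by (simp add: emH ennreal_mult mult.commute)
  finally show ?thesis .
qed

lemma finite_cells_cover:
  assumes "bounded (K :: (real ^ 'n::finite) set)"
  obtains Z where "finite Z" "K \<subseteq> (\<Union>z\<in>Z. cell m z)"
proof -
  obtain R where R: "\<And>x. x \<in> K \<Longrightarrow> norm x \<le> R" using assms by (auto simp: bounded_iff)
  define L where "L = \<lceil>real m * R\<rceil>"
  define Z where "Z = (PiE (UNIV::'n set) (\<lambda>_. {- L..L}))"
  have "finite Z" unfolding Z_def by (intro finite_PiE) auto
  moreover have "K \<subseteq> (\<Union>z\<in>Z. cell m z)"
  proof
    fix x assume x: "x \<in> K"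
    have "\<lfloor>real m * x $ i\<rfloor> \<in> {- L..L}" for i
    proof -
      have "\<bar>x $ i\<bar> \<le> R" using component_le_norm_cart[of x i] R[OF x] by simp
      then have "\<bar>real m * x $ i\<bar> \<le> real m * R" by (simp add: abs_mult mult_left_mono)
      then show ?thesis unfolding L_def atLeastAtMost_iff by linarith
    qed
    then show "x \<in> (\<Union>z\<in>Z. cell m z)"
      by (intro UN_I[of "\<lambda>i. \<lfloor>real m * x $ i\<rfloor>"]) (auto simp: Z_def cell_def)
  qed
  ultimately show ?thesis using that by blast
qed

text \<open>
  A Poincare inequality on the grid: up to an error that tends to 0 with the mesh, the norm is controlled
  by finitely many cell integrals.
\<close>

lemma l2_le_cell_means:
  fixes w :: "real ^ 'n::finite \<Rightarrow> 'b::euclidean_space"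
  assumes m: "0 < m" and w: "sq_integrable lborel w" and Z: "finite Z" "\<And>x. x \<notin> (\<Union>z\<in>Z. cell m z) \<Longrightarrow> w x = 0"
    and "0 \<le> C" and trans: "\<And>a. l2 lborel (\<lambda>x. w (x + a) - w x) \<le> C * norm a"
  shows "(\<integral>x. (norm (w x))\<^sup>2 \<partial>lborel) \<le>
    real m ^ CARD('n) * (\<Sum>z\<in>Z. (norm (\<integral>x. indicator (cell m z) x *\<^sub>R w x \<partial>lborel))\<^sup>2)
    + 2 ^ CARD('n) * (C * (real CARD('n) / real m))\<^sup>2"
proof -
  define q where "q = (1 / real m) ^ CARD('n)"
  have q: "0 < q" using m by (simp add: q_def)
  define W S where "W z = (\<integral>x. indicator (cell m z) x *\<^sub>R w x \<partial>lborel)"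
    and "S z = (\<integral>x. indicator (cell m z) x * (norm (w x))\<^sup>2 \<partial>lborel)" for z
  have [measurable]: "cell m z \<in> sets borel" for z :: "'n \<Rightarrow> int" using m by (rule cell_measurable)
  have isq: "integrable lborel (\<lambda>x. indicator (cell m z) x * (norm (w x))\<^sup>2)" for z
    using integrable_mult_indicator[OF _ sq_integrable_norm_sq[OF w], of "cell m z"] by simp
  have D: "(\<integral>\<^sup>+x. \<integral>\<^sup>+y. ennreal (indicator (cell m z) x * (indicator (cell m z) y * (norm (w x - w y))\<^sup>2)) \<partial>lborel \<partial>lborel)
      = ennreal (2 * (q * S z - (norm (W z))\<^sup>2))" for z
    using variance_double_integral(2)[OF w, of "cell m z"] m
    by (simp add: emeasure_cell measure_cell q_def W_def S_def)
  have D0: "0 \<le> 2 * (q * S z - (norm (W z))\<^sup>2)" for z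
    using variance_double_integral(1)[OF w, of "cell m z"] m
    by (simp add: emeasure_cell measure_cell q_def W_def S_def)
  have "ennreal (\<Sum>z\<in>Z. 2 * (q * S z - (norm (W z))\<^sup>2)) \<le> ennreal ((2 / real m) ^ CARD('n) * (C * (real CARD('n) / real m))\<^sup>2)"
    using cell_sum_double_integral_le[OF m w Z(1) \<open>0 \<le> C\<close> trans] D0 by (simp add: D sum_ennreal)
  then have "(\<Sum>z\<in>Z. 2 * (q * S z - (norm (W z))\<^sup>2)) \<le> (2 / real m) ^ CARD('n) * (C * (real CARD('n) / real m))\<^sup>2"
    by (subst (asm) ennreal_le_iff) auto
  also have "(2 / real m) ^ CARD('n) = q * 2 ^ CARD('n)" by (simp add: q_def power_divide)
  finally have "q * (\<Sum>z\<in>Z. S z) \<le> (\<Sum>z\<in>Z. (norm (W z))\<^sup>2) + q * 2 ^ CARD('n) * (C * (real CARD('n) / real m))\<^sup>2 / 2"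
    by (simp add: sum_subtractf sum_distrib_left[symmetric])
  also have "\<dots> \<le> (\<Sum>z\<in>Z. (norm (W z))\<^sup>2) + q * 2 ^ CARD('n) * (C * (real CARD('n) / real m))\<^sup>2"
    using q by (intro add_left_mono) simp
  finally have "(\<Sum>z\<in>Z. S z) \<le> (1 / q) * (\<Sum>z\<in>Z. (norm (W z))\<^sup>2) + 2 ^ CARD('n) * (C * (real CARD('n) / real m))\<^sup>2"
    using q by (simp add: field_simps)
  moreover have "1 / q = real m ^ CARD('n)" by (simp add: q_def power_divide)
  moreover have "(\<integral>x. (norm (w x))\<^sup>2 \<partial>lborel) = (\<Sum>z\<in>Z. S z)"
  proof -
    have "(norm (w x))\<^sup>2 = (\<Sum>z\<in>Z. indicator (cell m z) x * (norm (w x))\<^sup>2)" for x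
    proof (cases "x \<in> (\<Union>z\<in>Z. cell m z)")
      case True
      then obtain z where z: "z \<in> Z" "x \<in> cell m z" by blast
      have "(\<Sum>y\<in>Z. indicator (cell m y) x * (norm (w x))\<^sup>2) = (\<Sum>y\<in>Z. if y = z then (norm (w x))\<^sup>2 else 0)"
        using z(2) by (intro sum.cong refl) (auto simp: cell_def indicator_def)
      then show ?thesis using z(1) Z(1) by simp
    next
      case False
      then show ?thesis using Z(2) by simp
    qed
    then have "(\<integral>x. (norm (w x))\<^sup>2 \<partial>lborel) = (\<integral>x. (\<Sum>z\<in>Z. indicator (cell m z) x * (norm (w x))\<^sup>2) \<partial>lborel)"
      by (intro Bochner_Integration.integral_cong refl)
    also have "\<dots> = (\<Sum>z\<in>Z. S z)" unfolding S_def by (intro Bochner_Integration.integral_sum isq)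
    finally show ?thesis .
  qed
  ultimately show ?thesis by (simp add: W_def)
qed

text \<open>
  Bolzano--Weierstrass for each index and a diagonal sequence.
\<close>

lemma common_convergent_subsequence:
  fixes X :: "'i::countable \<Rightarrow> nat \<Rightarrow> 'b::euclidean_space"
  assumes "\<And>i. bounded (range (X i))"
  obtains r where "strict_mono (r :: nat \<Rightarrow> nat)" "\<And>i. convergent (\<lambda>k. X i (r k))"
proof -
  interpret subseqs "\<lambda>n s. convergent (\<lambda>k. X (from_nat n) (s k))"
  proof
    fix n and s :: "nat \<Rightarrow> nat"
    have "bounded (range (\<lambda>k. X (from_nat n) (s k)))"
      by (rule bounded_subset[OF assms[of "from_nat n"]]) auto
    then obtain l r' where "strict_mono r'" "((\<lambda>k. X (from_nat n) (s k)) \<circ> r') \<longlonglongrightarrow> l"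
      using bounded_imp_convergent_subsequence by blast
    then show "\<exists>r'. strict_mono r' \<and> convergent (\<lambda>k. X (from_nat n) ((s \<circ> r') k))"
      by (auto simp: convergent_def o_def)
  qed
  show ?thesis
  proof
    show "strict_mono diagseq" by (rule subseq_diagseq)
  next
    fix i :: 'i
    have "convergent (\<lambda>k. X (from_nat (to_nat i)) ((diagseq \<circ> ((+) (Suc (to_nat i)))) k))"
    proof (rule diagseq_holds)
      fix r s :: "nat \<Rightarrow> nat" and n
      assume "strict_mono r" "convergent (\<lambda>k. X (from_nat n) (s k))"
      then show "convergent (\<lambda>k. X (from_nat n) ((s \<circ> r) k))"
        using convergent_subseq_convergent[of "\<lambda>k. X (from_nat n) (s k)" r] by (simp add: o_def)
    qed
    then have "convergent (\<lambda>k. X i (diagseq (k + Suc (to_nat i))))" by (simp add: o_def add.commute)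
    then show "convergent (\<lambda>k. X i (diagseq k))" by (rule convergent_ignore_initial_segment[THEN iffD1])
  qed
qed

text \<open>
  A form of the Kolmogorov--Riesz compactness criterion. Choose a subsequence along which the integrals
  over all cells of all grids converge; \<open>l2_le_cell_means\<close> applied to differences, on a grid that is fine
  enough, shows that it is Cauchy.
\<close>

theorem L2_precompact_if_equitranslatable:
  fixes u :: "nat \<Rightarrow> real ^ 'n::finite \<Rightarrow> 'b::euclidean_space"
  assumes u: "\<And>j. sq_integrable lborel (u j)"
    and K: "bounded K" "\<And>j x. x \<notin> K \<Longrightarrow> u j x = 0"
    and bound: "\<And>j. (\<integral>x. (norm (u j x))\<^sup>2 \<partial>lborel) \<le> B"
    and trans: "\<And>j a. l2 lborel (\<lambda>x. u j (x + a) - u j x) \<le> C * norm a"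
  obtains r where "strict_mono (r :: nat \<Rightarrow> nat)"
    "\<And>e. e > 0 \<Longrightarrow> \<exists>N. \<forall>j\<ge>N. \<forall>k\<ge>N. (\<integral>x. (norm (u (r j) x - u (r k) x))\<^sup>2 \<partial>lborel) < e"
proof -
  have C0: "0 \<le> C" using order_trans[OF l2_nonneg trans[of 0 "axis undefined 1"]] by simp
  define X where "X p j = (\<integral>x. indicator (cell (Suc (fst p)) (snd p)) x *\<^sub>R u j x \<partial>lborel)" for p :: "nat \<times> ('n \<Rightarrow> int)" and j
  have "bounded (range (X p))" for p
  proof -
    have "norm (X p j) \<le> measure lborel (cell (Suc (fst p)) (snd p)) + B" for j
      using sq_integrable_imp_integrable_on(2)[OF u[of j], of "cell (Suc (fst p)) (snd p)"] bound[of j]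
      by (simp add: X_def emeasure_cell)
    then show ?thesis by (auto simp: bounded_iff)
  qed
  then obtain r where r: "strict_mono r" "\<And>p. convergent (\<lambda>k. X p (r k))"
    by (rule common_convergent_subsequence[of X]) (rule that)
  have "\<exists>N. \<forall>j\<ge>N. \<forall>k\<ge>N. (\<integral>x. (norm (u (r j) x - u (r k) x))\<^sup>2 \<partial>lborel) < e" if e: "0 < e" for e
  proof -
    have "(\<lambda>m. 2 ^ CARD('n) * (2 * C * (real CARD('n) / real m))\<^sup>2) \<longlonglongrightarrow> 2 ^ CARD('n) * (2 * C * 0)\<^sup>2"
      by (intro tendsto_intros lim_const_over_n)
    then have "(\<lambda>m. 2 ^ CARD('n) * (2 * C * (real CARD('n) / real m))\<^sup>2) \<longlonglongrightarrow> 0" by simp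
    from order_tendstoD(2)[OF this, of "e / 2"] e
    obtain m0 where m0: "\<And>m. m \<ge> m0 \<Longrightarrow> 2 ^ CARD('n) * (2 * C * (real CARD('n) / real m))\<^sup>2 < e / 2"
      by (auto simp: eventually_sequentially)
    define m where "m = Suc m0"
    have m: "0 < m" "2 ^ CARD('n) * (2 * C * (real CARD('n) / real m))\<^sup>2 < e / 2"
      using m0[of m] by (auto simp: m_def)
    obtain Z :: "('n \<Rightarrow> int) set" where Z: "finite Z" "K \<subseteq> (\<Union>z\<in>Z. cell m z)"
      by (rule finite_cells_cover[OF K(1), of m]) (rule that)
    define T where "T j k = (\<Sum>z\<in>Z. (norm (X (m0, z) (r j) - X (m0, z) (r k)))\<^sup>2)" for j k
    have main: "(\<integral>x. (norm (u (r j) x - u (r k) x))\<^sup>2 \<partial>lborel) < real m ^ CARD('n) * T j k + e / 2" for j k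
    proof -
      have "(\<integral>x. (norm (u (r j) x - u (r k) x))\<^sup>2 \<partial>lborel) \<le>
        real m ^ CARD('n) * (\<Sum>z\<in>Z. (norm (\<integral>x. indicator (cell m z) x *\<^sub>R (u (r j) x - u (r k) x) \<partial>lborel))\<^sup>2)
        + 2 ^ CARD('n) * (2 * C * (real CARD('n) / real m))\<^sup>2"
      proof (rule l2_le_cell_means[OF m(1) _ Z(1)])
        show "sq_integrable lborel (\<lambda>x. u (r j) x - u (r k) x)" by (intro sq_integrable_diff u)
        show "u (r j) x - u (r k) x = 0" if "x \<notin> (\<Union>z\<in>Z. cell m z)" for x
          using K(2) Z(2) that by (metis diff_self subsetD)
        show "0 \<le> 2 * C" using C0 by simp
        fix a
        have "l2 lborel (\<lambda>x. u (r j) (x + a) - u (r k) (x + a) - (u (r j) x - u (r k) x)) =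
            l2 lborel (\<lambda>x. (u (r j) (x + a) - u (r j) x) + (u (r k) x - u (r k) (x + a)))"
          by (simp add: algebra_simps)
        also have "\<dots> \<le> l2 lborel (\<lambda>x. u (r j) (x + a) - u (r j) x) + l2 lborel (\<lambda>x. u (r k) x - u (r k) (x + a))"
          by (intro l2_triangle sq_integrable_diff sq_integrable_shift u)
        also have "l2 lborel (\<lambda>x. u (r k) x - u (r k) (x + a)) = l2 lborel (\<lambda>x. u (r k) (x + a) - u (r k) x)"
          by (rule l2_diff_commute)
        finally show "l2 lborel (\<lambda>x. u (r j) (x + a) - u (r k) (x + a) - (u (r j) x - u (r k) x)) \<le> 2 * C * norm a"
          using trans[of "r j" a] trans[of "r k" a] by simp
      qed
      also have "(\<Sum>z\<in>Z. (norm (\<integral>x. indicator (cell m z) x *\<^sub>R (u (r j) x - u (r k) x) \<partial>lborel))\<^sup>2) = T j k"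
        unfolding T_def
      proof (intro sum.cong refl)
        fix z
        have "integrable lborel (\<lambda>x. indicator (cell m z) x *\<^sub>R u j x)" for j
          using m(1) by (intro sq_integrable_imp_integrable_on(1) u) (auto simp: emeasure_cell)
        then show "(norm (\<integral>x. indicator (cell m z) x *\<^sub>R (u (r j) x - u (r k) x) \<partial>lborel))\<^sup>2 = (norm (X (m0, z) (r j) - X (m0, z) (r k)))\<^sup>2"
          by (simp add: X_def m_def scaleR_diff_right)
      qed
      finally show ?thesis using m(2) by simp
    qed
    have "\<exists>N. \<forall>j\<ge>N. \<forall>k\<ge>N. real m ^ CARD('n) * T j k < e / 2"
    proof -
      define d where "d = e / (2 * real m ^ CARD('n) * (real (card Z) + 1))"
      have d: "0 < d" using e m(1) by (simp add: d_def)
      have "\<exists>N. \<forall>j\<ge>N. \<forall>k\<ge>N. norm (X (m0, z) (r j) - X (m0, z) (r k)) < sqrt d" for z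
        using convergent_Cauchy[OF r(2)[of "(m0, z)"]] d unfolding Cauchy_def dist_norm by (meson real_sqrt_gt_zero)
      then obtain N where N: "\<And>z j k. j \<ge> N z \<Longrightarrow> k \<ge> N z \<Longrightarrow> norm (X (m0, z) (r j) - X (m0, z) (r k)) < sqrt d"
        by metis
      define N0 where "N0 = Max (insert 0 (N ` Z))"
      have "real m ^ CARD('n) * T j k < e / 2" if "j \<ge> N0" "k \<ge> N0" for j k
      proof -
        have "(norm (X (m0, z) (r j) - X (m0, z) (r k)))\<^sup>2 \<le> d" if z: "z \<in> Z" for z
        proof -
          have "N z \<le> N0" unfolding N0_def using z Z(1) by (intro Max_ge) auto
          then have "norm (X (m0, z) (r j) - X (m0, z) (r k)) \<le> sqrt d"
            using N[of z j k] \<open>j \<ge> N0\<close> \<open>k \<ge> N0\<close> by simp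
          then show ?thesis using d real_le_rsqrt power_mono[of "norm (X (m0, z) (r j) - X (m0, z) (r k))" "sqrt d" 2] by simp
        qed
        then have "T j k \<le> real (card Z) * d" unfolding T_def by (rule sum_bounded_above)
        also have "\<dots> < (real (card Z) + 1) * d" using d by simp
        finally have "real m ^ CARD('n) * T j k < real m ^ CARD('n) * ((real (card Z) + 1) * d)"
          using m(1) by (intro mult_strict_left_mono) auto
        also have "\<dots> = e / 2"
        proof -
          have "A * (c * (e / (2 * A * c))) = e / 2" if "A \<noteq> 0" "c \<noteq> 0" for A c :: real using that by simp
          then show ?thesis unfolding d_def using m(1) by (metis of_nat_0_less_iff add_pos_nonneg add.commute less_irrefl of_nat_0_le_iff zero_less_one zero_less_power)
        qed
        finally show ?thesis .
      qed
      then show ?thesis by blast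
    qed
    then obtain N where N: "\<And>j k. j \<ge> N \<Longrightarrow> k \<ge> N \<Longrightarrow> real m ^ CARD('n) * T j k < e / 2" by blast
    then have "(\<integral>x. (norm (u (r j) x - u (r k) x))\<^sup>2 \<partial>lborel) < e" if "j \<ge> N" "k \<ge> N" for j k
      using main[of j k] N[OF that] by linarith
    then show ?thesis by blast
  qed
  then show ?thesis using that r(1) by blast
qed

section \<open>Uniqueness of weak partial derivatives\<close>

lemma sq_integrable_lebesgue_on:
  fixes f :: "'a::euclidean_space \<Rightarrow> 'b::euclidean_space"
  assumes "S \<in> sets lebesgue"
  shows "sq_integrable (lebesgue_on S) f \<longleftrightarrow> sq_integrable lebesgue (\<lambda>x. if x \<in> S then f x else 0)"
    and "(\<integral>x. (norm (f x))\<^sup>2 \<partial>lebesgue_on S) = (\<integral>x. (norm (if x \<in> S then f x else 0))\<^sup>2 \<partial>lebesgue)"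
proof -
  have eq: "(\<lambda>x. (norm (if x \<in> S then f x else 0))\<^sup>2) = (\<lambda>x. if x \<in> S then (norm (f x))\<^sup>2 else 0)" by auto
  show "sq_integrable (lebesgue_on S) f \<longleftrightarrow> sq_integrable lebesgue (\<lambda>x. if x \<in> S then f x else 0)"
    unfolding sq_integrable_def eq borel_measurable_if[OF assms] Lebesgue_Measure.integrable_restrict_UNIV[OF assms] ..
  show "(\<integral>x. (norm (f x))\<^sup>2 \<partial>lebesgue_on S) = (\<integral>x. (norm (if x \<in> S then f x else 0))\<^sup>2 \<partial>lebesgue)"
    unfolding eq by (rule Lebesgue_Measure.integral_restrict_UNIV[OF assms, symmetric])
qed

lemma L2_iff: "f \<in> L2 S \<longleftrightarrow> sq_integrable (lebesgue_on S) f"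
  by (simp add: L2_def sq_integrable_def)

lemma sq_integrable_lebesgue_on_subset:
  fixes f :: "'a::euclidean_space \<Rightarrow> 'b::euclidean_space"
  assumes "sq_integrable (lebesgue_on T) f" "S \<in> sets lebesgue" "T \<in> sets lebesgue" "S \<subseteq> T"
  shows "sq_integrable (lebesgue_on S) f"
    and "(\<integral>x. (norm (f x))\<^sup>2 \<partial>lebesgue_on S) \<le> (\<integral>x. (norm (f x))\<^sup>2 \<partial>lebesgue_on T)"
proof -
  have T: "sq_integrable lebesgue (\<lambda>x. if x \<in> T then f x else 0)"
    using assms by (simp add: sq_integrable_lebesgue_on)
  have "f \<in> borel_measurable (lebesgue_on S)"
    using assms measurable_restrict_mono[OF _ assms(4)] by (auto simp: sq_integrable_def)
  then have m: "(\<lambda>x. if x \<in> S then f x else 0) \<in> borel_measurable lebesgue"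
    using assms by (simp add: borel_measurable_if)
  have S: "sq_integrable lebesgue (\<lambda>x. if x \<in> S then f x else 0)"
    by (rule sq_integrable_bound[OF T m, of 1]) (use assms(4) in auto)
  then show "sq_integrable (lebesgue_on S) f" using assms by (simp add: sq_integrable_lebesgue_on)
  show "(\<integral>x. (norm (f x))\<^sup>2 \<partial>lebesgue_on S) \<le> (\<integral>x. (norm (f x))\<^sup>2 \<partial>lebesgue_on T)"
    unfolding sq_integrable_lebesgue_on(2)[OF assms(2)] sq_integrable_lebesgue_on(2)[OF assms(3)]
    by (rule integral_mono) (use S T assms(4) in \<open>auto simp: sq_integrable_def\<close>)
qed

text \<open>
  Reduced to real valued functions by coordinates.
\<close>

lemma lebesgue_ex_borel:
  fixes h :: "'a::euclidean_space \<Rightarrow> 'b::euclidean_space"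
  assumes "h \<in> borel_measurable lebesgue"
  obtains h' where "h' \<in> borel_measurable borel" "AE x in lebesgue. h x = h' x"
proof -
  have "\<exists>k\<in>borel_measurable lborel. AE x in lborel. h x \<bullet> b = k x" for b
    by (intro completion_ex_borel_measurable_real borel_measurable_inner assms borel_measurable_const)
  then obtain k where k: "\<And>b. k b \<in> borel_measurable lborel" "\<And>b. AE x in lborel. h x \<bullet> b = k b x" by metis
  have [measurable]: "k b \<in> borel_measurable borel" for b using k(1)[of b] by simp
  show ?thesis
  proof
    show "(\<lambda>x. \<Sum>b\<in>Basis. k b x *\<^sub>R b) \<in> borel_measurable borel" by measurable
    have "AE x in lebesgue. \<forall>b\<in>Basis. h x \<bullet> b = k b x"
      by (rule AE_completion) (simp add: AE_ball_countable countable_finite k(2))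
    then show "AE x in lebesgue. h x = (\<Sum>b\<in>Basis. k b x *\<^sub>R b)"
    proof eventually_elim
      case (elim x)
      then have "(\<Sum>b\<in>Basis. k b x *\<^sub>R b) = (\<Sum>b\<in>Basis. (h x \<bullet> b) *\<^sub>R b)" by (intro sum.cong) auto
      then show ?case by (simp add: euclidean_representation)
    qed
  qed
qed

lemma borel_imp_lebesgue: "h \<in> borel_measurable borel \<Longrightarrow> h \<in> borel_measurable lebesgue"
  by (rule measurable_completion) simp

lemma sq_integrable_lborel_iff:
  fixes h :: "'a::euclidean_space \<Rightarrow> 'b::euclidean_space"
  assumes "h \<in> borel_measurable borel"
  shows "sq_integrable lborel h \<longleftrightarrow> sq_integrable lebesgue h"
    and "(\<integral>x. (norm (h x))\<^sup>2 \<partial>lborel) = (\<integral>x. (norm (h x))\<^sup>2 \<partial>lebesgue)"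
proof -
  have [measurable]: "h \<in> borel_measurable borel" by fact
  have "(\<lambda>x. (norm (h x))\<^sup>2) \<in> borel_measurable lborel" by measurable
  then show "sq_integrable lborel h \<longleftrightarrow> sq_integrable lebesgue h" "(\<integral>x. (norm (h x))\<^sup>2 \<partial>lborel) = (\<integral>x. (norm (h x))\<^sup>2 \<partial>lebesgue)"
    using borel_imp_lebesgue[OF assms] assms
    by (auto simp: sq_integrable_def integrable_completion integral_completion)
qed

lemma sq_integrable_cong_AE:
  assumes "f \<in> borel_measurable M" "sq_integrable M g" "AE x in M. f x = g x"
  shows "sq_integrable M f" "(\<integral>x. (norm (f x))\<^sup>2 \<partial>M) = (\<integral>x. (norm (g x))\<^sup>2 \<partial>M)"
proof -
  have [measurable]: "f \<in> borel_measurable M" "g \<in> borel_measurable M" using assms by (auto simp: sq_integrable_def)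
  show "sq_integrable M f" by (rule sq_integrable_bound[OF assms(2), of _ 1]) (use assms in auto)
  show "(\<integral>x. (norm (f x))\<^sup>2 \<partial>M) = (\<integral>x. (norm (g x))\<^sup>2 \<partial>M)"
    by (rule integral_cong_AE) (use assms(3) in auto)
qed

text \<open>
  Approximating indicator functions of open subsets of the open box by test functions shows that \<open>f\<close> integrates to
  0 over each of them; the boundary of the box is a null set.
\<close>

lemma weak_zero_imp_AE_0_box:
  fixes f :: "real ^ 'n::finite \<Rightarrow> real"
  assumes "open \<Omega>" and B: "cbox a b \<subseteq> \<Omega>" and int: "integrable (lebesgue_on (cbox a b)) f"
    and zero: "\<And>\<phi>. test_function \<Omega> \<phi> \<Longrightarrow> (\<integral>x. \<phi> x * f x \<partial>lebesgue_on \<Omega>) = 0"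
  shows "AE x in lebesgue. x \<in> cbox a b \<longrightarrow> f x = 0"
proof -
  define h where "h x = (if x \<in> cbox a b then f x else 0)" for x
  have h: "integrable lebesgue h" unfolding h_def using int by (subst Lebesgue_Measure.integrable_restrict_UNIV) auto
  have hm: "h \<in> borel_measurable lebesgue" using h by simp
  obtain h' where h': "h' \<in> borel_measurable borel" "AE x in lebesgue. h x = h' x"
    by (rule lebesgue_ex_borel[OF hm])
  have [measurable]: "h' \<in> borel_measurable borel" by (rule h'(1))
  have h'_leb: "h' \<in> borel_measurable lebesgue" by (rule borel_imp_lebesgue[OF h'(1)])
  have "integrable lebesgue h'" using integrable_cong_AE[OF hm h'_leb h'(2)] h by simp
  then have h'_int: "integrable lborel h'" by (simp add: integrable_completion)
  have \<Omega>: "\<Omega> \<in> sets lebesgue" using \<open>open \<Omega>\<close> by simp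
  have "AE x in lborel. h' x = 0"
  proof (rule AE_eq_0_if_open_integrals_0[OF h'_int])
    fix V :: "(real ^ 'n) set" assume V: "open V"
    define V' where "V' = V \<inter> box a b"
    have "open V'" "bounded V'" using V by (auto simp: V'_def bounded_Int)
    moreover have "closure V' \<subseteq> \<Omega>"
      using closure_mono[of V' "cbox a b"] box_subset_cbox[of a b] B by (auto simp: V'_def)
    ultimately obtain \<phi> where \<phi>: "\<And>n. test_function \<Omega> (\<phi> n)"
      "\<And>n x. 0 \<le> \<phi> n x" "\<And>n x. \<phi> n x \<le> indicator V' x" "\<And>x. (\<lambda>n. \<phi> n x) \<longlonglongrightarrow> indicator V' x"
      by (rule test_functions_to_open) (rule that)
    have \<phi>0: "\<phi> n x = 0" if "x \<notin> V'" for n x using \<phi>(2,3)[of n x] that by simp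
    have [measurable]: "\<phi> n \<in> borel_measurable borel" for n by (rule test_function_measurable[OF \<phi>(1)])
    have [measurable]: "V' \<in> sets borel" "V \<in> sets borel" using V \<open>open V'\<close> by auto
    have "(\<lambda>n. \<integral>x. \<phi> n x * h' x \<partial>lborel) \<longlonglongrightarrow> (\<integral>x. indicator V' x * h' x \<partial>lborel)"
    proof (rule integral_dominated_convergence)
      show "integrable lborel (\<lambda>x. \<bar>h' x\<bar>)" using h'_int by simp
      show "AE x in lborel. (\<lambda>n. \<phi> n x * h' x) \<longlonglongrightarrow> indicator V' x * h' x"
        by (intro AE_I2 tendsto_intros \<phi>)
      have "\<bar>\<phi> n x\<bar> \<le> 1" for n x using \<phi>(2,3)[of n x] by (cases "x \<in> V'") auto
      then show "AE x in lborel. norm (\<phi> n x * h' x) \<le> \<bar>h' x\<bar>" for n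
        by (auto simp: abs_mult intro!: mult_left_le_one_le)
    qed measurable
    moreover have "(\<integral>x. \<phi> n x * h' x \<partial>lborel) = 0" for n
    proof -
      have [measurable]: "\<phi> n \<in> borel_measurable lebesgue" by (rule borel_imp_lebesgue) measurable
      have "(\<integral>x. \<phi> n x * h' x \<partial>lborel) = (\<integral>x. \<phi> n x * h' x \<partial>lebesgue)"
        by (rule integral_completion[symmetric]) measurable
      also have "\<dots> = (\<integral>x. \<phi> n x * h x \<partial>lebesgue)"
        by (rule integral_cong_AE) (use h'(2) hm h'_leb in \<open>auto\<close>)
      also have "\<dots> = (\<integral>x. (if x \<in> \<Omega> then \<phi> n x * f x else 0) \<partial>lebesgue)"
        using \<phi>0[of _ n] B box_subset_cbox[of a b]
        by (intro Bochner_Integration.integral_cong refl) (auto simp: h_def V'_def)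
      also have "\<dots> = 0" by (simp add: Lebesgue_Measure.integral_restrict_UNIV[OF \<Omega>] zero[OF \<phi>(1)])
      finally show ?thesis .
    qed
    ultimately have "(\<integral>x. indicator V' x * h' x \<partial>lborel) = 0"
      by (simp add: LIMSEQ_const_iff)
    also have "(\<integral>x. indicator V' x * h' x \<partial>lborel) = (\<integral>x. indicator V x * h' x \<partial>lborel)"
    proof -
      have "cbox a b - box a b \<in> null_sets lebesgue"
        using negligible_frontier_interval[of a b] by (simp add: negligible_iff_null_sets)
      then have "AE x in lebesgue. x \<notin> cbox a b - box a b" by (rule AE_not_in)
      then have "AE x in lebesgue. indicator V' x * h' x = indicator V x * h' x"
        using h'(2) by eventually_elim (auto simp: V'_def h_def indicator_def split: if_splits)
      then have "(\<integral>x. indicator V' x * h' x \<partial>lebesgue) = (\<integral>x. indicator V x * h' x \<partial>lebesgue)"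
        by (intro integral_cong_AE borel_imp_lebesgue) measurable
      then show ?thesis by (simp add: integral_completion)
    qed
    finally show "(\<integral>x. indicator V x * h' x \<partial>lborel) = 0" .
  qed
  then have "AE x in lebesgue. h' x = 0" by (rule AE_completion)
  then show ?thesis using h'(2) by eventually_elim (auto simp: h_def)
qed

lemma weak_zero_imp_AE_0:
  fixes f :: "real ^ 'n::finite \<Rightarrow> 'b::euclidean_space"
  assumes "open \<Omega>" and int: "\<And>K. compact K \<Longrightarrow> K \<subseteq> \<Omega> \<Longrightarrow> integrable (lebesgue_on K) f"
    and zero: "\<And>\<phi>. test_function \<Omega> \<phi> \<Longrightarrow> (\<integral>x. \<phi> x *\<^sub>R f x \<partial>lebesgue_on \<Omega>) = 0"
    and integrable: "\<And>\<phi>. test_function \<Omega> \<phi> \<Longrightarrow> integrable (lebesgue_on \<Omega>) (\<lambda>x. \<phi> x *\<^sub>R f x)"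
  shows "AE x in lebesgue_on \<Omega>. f x = 0"
proof -
  obtain D where D: "countable D" "D \<subseteq> Pow \<Omega>" "\<And>X. X \<in> D \<Longrightarrow> \<exists>a b. X = cbox a b" "\<Union>D = \<Omega>"
    using open_countable_Union_open_cbox[OF \<open>open \<Omega>\<close>] by metis
  have "AE x in lebesgue. \<forall>X\<in>D. \<forall>e\<in>Basis. x \<in> X \<longrightarrow> f x \<bullet> e = 0"
  proof (subst AE_ball_countable[OF D(1)], intro ballI, subst AE_ball_countable[OF countable_finite[OF finite_Basis]], intro ballI)
    fix X and e :: 'b assume X: "X \<in> D" and "e \<in> Basis"
    then obtain a b where ab: "X = cbox a b" "cbox a b \<subseteq> \<Omega>" using D(2,3) by blast
    show "AE x in lebesgue. x \<in> X \<longrightarrow> f x \<bullet> e = 0"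
      unfolding ab(1)
    proof (rule weak_zero_imp_AE_0_box[OF \<open>open \<Omega>\<close> ab(2)])
      show "integrable (lebesgue_on (cbox a b)) (\<lambda>x. f x \<bullet> e)" using int[OF compact_cbox ab(2)] by simp
      fix \<phi> assume \<phi>: "test_function \<Omega> \<phi>"
      have "(\<integral>x. \<phi> x * (f x \<bullet> e) \<partial>lebesgue_on \<Omega>) = (\<integral>x. (\<phi> x *\<^sub>R f x) \<bullet> e \<partial>lebesgue_on \<Omega>)" by simp
      also have "\<dots> = (\<integral>x. \<phi> x *\<^sub>R f x \<partial>lebesgue_on \<Omega>) \<bullet> e" by (rule integral_inner_left) (simp add: integrable[OF \<phi>])
      finally show "(\<integral>x. \<phi> x * (f x \<bullet> e) \<partial>lebesgue_on \<Omega>) = 0" using zero[OF \<phi>] by simp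
    qed
  qed
  then have "AE x in lebesgue. x \<in> \<Omega> \<longrightarrow> f x = 0"
  proof eventually_elim
    case (elim x)
    show ?case
    proof
      assume "x \<in> \<Omega>"
      then obtain X where "X \<in> D" "x \<in> X" using D(4) by blast
      then have "\<forall>e\<in>Basis. f x \<bullet> e = 0" using elim by blast
      then show "f x = 0" by (simp only: euclidean_all_zero_iff)
    qed
  qed
  then show ?thesis using \<open>open \<Omega>\<close> by (simp add: AE_restrict_space_iff)
qed

lemma test_function_times_loc_integrable:
  fixes f :: "real ^ 'n::finite \<Rightarrow> 'b::euclidean_space"
  assumes "open \<Omega>" and int: "\<And>K. compact K \<Longrightarrow> K \<subseteq> \<Omega> \<Longrightarrow> integrable (lebesgue_on K) f"
    and \<phi>: "test_function \<Omega> \<phi>"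
  shows "integrable (lebesgue_on \<Omega>) (\<lambda>x. \<phi> x *\<^sub>R f x)"
proof -
  obtain K where K: "compact K" "K \<subseteq> \<Omega>" "\<And>x. x \<notin> K \<Longrightarrow> \<phi> x = 0"
    by (rule test_function_support[OF \<phi>]) (rule that)
  obtain B where B: "0 < B" "\<And>x. \<bar>\<phi> x\<bar> \<le> B" by (rule test_function_bounded[OF \<phi>]) (rule that)
  have Ks: "K \<in> sets lebesgue" using K(1) by (simp add: borel_compact)
  have i: "integrable lebesgue (\<lambda>x. if x \<in> K then f x else 0)"
    using int[OF K(1,2)] by (simp add: Lebesgue_Measure.integrable_restrict_UNIV[OF Ks])
  have [measurable]: "\<phi> \<in> borel_measurable lebesgue" by (rule borel_imp_lebesgue[OF test_function_measurable[OF \<phi>]])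
  have [measurable]: "(\<lambda>x. if x \<in> K then f x else 0) \<in> borel_measurable lebesgue" using i by simp
  have "integrable lebesgue (\<lambda>x. \<phi> x *\<^sub>R (if x \<in> K then f x else 0))"
  proof (rule Bochner_Integration.integrable_bound)
    show "integrable lebesgue (\<lambda>x. B * norm (if x \<in> K then f x else 0))" using i by (intro integrable_mult_right integrable_norm)
    show "AE x in lebesgue. norm (\<phi> x *\<^sub>R (if x \<in> K then f x else 0)) \<le> norm (B * norm (if x \<in> K then f x else 0))"
      using B by (auto intro!: mult_right_mono)
  qed measurable
  moreover have "(\<lambda>x. \<phi> x *\<^sub>R (if x \<in> K then f x else 0)) = (\<lambda>x. if x \<in> \<Omega> then \<phi> x *\<^sub>R f x else 0)"
  proof
    fix x show "\<phi> x *\<^sub>R (if x \<in> K then f x else 0) = (if x \<in> \<Omega> then \<phi> x *\<^sub>R f x else 0)"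
      using K(2) K(3)[of x] by (cases "x \<in> K") auto
  qed
  ultimately show ?thesis using \<open>open \<Omega>\<close> by (simp add: Lebesgue_Measure.integrable_restrict_UNIV)
qed

lemma has_weak_partial_unique:
  fixes f :: "real ^ 'n::finite \<Rightarrow> 'b::euclidean_space"
  assumes "open \<Omega>" and g: "has_weak_partial \<Omega> i f g" and h: "has_weak_partial \<Omega> i f h"
  shows "AE x in lebesgue_on \<Omega>. g x = h x"
proof -
  have int: "integrable (lebesgue_on K) g" "integrable (lebesgue_on K) h" if "compact K" "K \<subseteq> \<Omega>" for K
    using g h that by (auto simp: has_weak_partial_def)
  have "AE x in lebesgue_on \<Omega>. g x - h x = 0"
  proof (rule weak_zero_imp_AE_0[OF \<open>open \<Omega>\<close>])
    fix \<phi> assume \<phi>: "test_function \<Omega> \<phi>"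
    note i = test_function_times_loc_integrable[OF \<open>open \<Omega>\<close> int(1) \<phi>] test_function_times_loc_integrable[OF \<open>open \<Omega>\<close> int(2) \<phi>]
    have "- (\<integral>x. \<phi> x *\<^sub>R g x \<partial>lebesgue_on \<Omega>) = (\<integral>x. pderiv_at i \<phi> x *\<^sub>R f x \<partial>lebesgue_on \<Omega>)"
      using g \<phi> by (simp add: has_weak_partial_def)
    also have "\<dots> = - (\<integral>x. \<phi> x *\<^sub>R h x \<partial>lebesgue_on \<Omega>)"
      using h \<phi> by (simp add: has_weak_partial_def)
    finally have "(\<integral>x. \<phi> x *\<^sub>R g x \<partial>lebesgue_on \<Omega>) = (\<integral>x. \<phi> x *\<^sub>R h x \<partial>lebesgue_on \<Omega>)" by simp
    then show "(\<integral>x. \<phi> x *\<^sub>R (g x - h x) \<partial>lebesgue_on \<Omega>) = 0"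
      using i by (simp add: scaleR_diff_right)
    show "integrable (lebesgue_on \<Omega>) (\<lambda>x. \<phi> x *\<^sub>R (g x - h x))"
      using i by (simp add: scaleR_diff_right)
  qed (use int in auto)
  then show ?thesis by simp
qed

text \<open>
  The choice in \<open>weak_partial\<close> is immaterial almost everywhere.
\<close>

lemma weak_partial_AE_eq:
  assumes "open \<Omega>" "has_weak_partial \<Omega> i f g"
  shows "AE x in lebesgue_on \<Omega>. weak_partial \<Omega> i f x = g x"
  using has_weak_partial_unique[OF assms(1) _ assms(2)] someI[of "has_weak_partial \<Omega> i f" g] assms(2)
  unfolding weak_partial_def by blast

lemma has_weak_partial_subset:
  fixes f :: "real ^ 'n::finite \<Rightarrow> 'b::euclidean_space"
  assumes f: "has_weak_partial \<Omega> i f g" and "open \<Omega>" "open U" "U \<subseteq> \<Omega>"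
  shows "has_weak_partial U i f g"
  unfolding has_weak_partial_def
proof (intro conjI allI impI)
  fix \<phi> assume \<phi>: "test_function U \<phi>"
  have restrict: "(\<integral>x. \<psi> x *\<^sub>R h x \<partial>lebesgue_on U) = (\<integral>x. \<psi> x *\<^sub>R h x \<partial>lebesgue_on \<Omega>)"
    if \<psi>: "test_function U \<psi>" for \<psi> and h :: "real ^ 'n \<Rightarrow> 'b"
  proof -
    obtain K where K: "compact K" "K \<subseteq> U" "\<And>x. x \<notin> K \<Longrightarrow> \<psi> x = 0"
      by (rule test_function_support[OF \<psi>]) (rule that)
    have "(\<lambda>x. if x \<in> U then \<psi> x *\<^sub>R h x else 0) = (\<lambda>x. if x \<in> \<Omega> then \<psi> x *\<^sub>R h x else 0)"
    proof
      fix x show "(if x \<in> U then \<psi> x *\<^sub>R h x else 0) = (if x \<in> \<Omega> then \<psi> x *\<^sub>R h x else 0)"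
        using assms(4) K(2) K(3)[of x] by (cases "x \<in> K") auto
    qed
    moreover have "U \<in> sets lebesgue" "\<Omega> \<in> sets lebesgue" using assms by auto
    ultimately show ?thesis by (simp flip: Lebesgue_Measure.integral_restrict_UNIV)
  qed
  show "(\<integral>x. pderiv_at i \<phi> x *\<^sub>R f x \<partial>lebesgue_on U) = - (\<integral>x. \<phi> x *\<^sub>R g x \<partial>lebesgue_on U)"
    using f test_function_mono[OF \<phi> assms(4)] restrict[OF \<phi>] restrict[OF test_function_pderiv[OF \<phi>]]
    by (simp add: has_weak_partial_def)
qed (use f assms(4) in \<open>auto simp: has_weak_partial_def\<close>)

lemma has_weak_partial_diff:
  fixes f :: "real ^ 'n::finite \<Rightarrow> 'b::euclidean_space"
  assumes "open \<Omega>" and f: "has_weak_partial \<Omega> i f g" and h: "has_weak_partial \<Omega> i h k"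
  shows "has_weak_partial \<Omega> i (\<lambda>x. f x - h x) (\<lambda>x. g x - k x)"
  unfolding has_weak_partial_def
proof (intro conjI allI impI)
  have int: "integrable (lebesgue_on K) g" "integrable (lebesgue_on K) k" "integrable (lebesgue_on K) f" "integrable (lebesgue_on K) h"
    if "compact K" "K \<subseteq> \<Omega>" for K
    using f h that by (auto simp: has_weak_partial_def)
  show "integrable (lebesgue_on K) (\<lambda>x. f x - h x)" "integrable (lebesgue_on K) (\<lambda>x. g x - k x)"
    if "compact K \<and> K \<subseteq> \<Omega>" for K using int that by auto
  fix \<phi> assume \<phi>: "test_function \<Omega> \<phi>"
  note i = test_function_times_loc_integrable[OF \<open>open \<Omega>\<close> int(1) \<phi>] test_function_times_loc_integrable[OF \<open>open \<Omega>\<close> int(2) \<phi>]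
    test_function_times_loc_integrable[OF \<open>open \<Omega>\<close> int(3) test_function_pderiv[OF \<phi>]]
    test_function_times_loc_integrable[OF \<open>open \<Omega>\<close> int(4) test_function_pderiv[OF \<phi>]]
  show "(\<integral>x. pderiv_at i \<phi> x *\<^sub>R (f x - h x) \<partial>lebesgue_on \<Omega>) = - (\<integral>x. \<phi> x *\<^sub>R (g x - k x) \<partial>lebesgue_on \<Omega>)"
    using f h \<phi> i unfolding scaleR_diff_right by (simp add: has_weak_partial_def)
qed

section \<open>The Caccioppoli inequality\<close>

lemma L2_loc_sq_integrable: "f \<in> L2_loc \<Omega> \<Longrightarrow> compact K \<Longrightarrow> K \<subseteq> \<Omega> \<Longrightarrow> sq_integrable (lebesgue_on K) f"
  by (simp add: L2_loc_def L2_iff)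

lemma test_function_times_L2_loc:
  fixes f :: "real ^ 'n::finite \<Rightarrow> 'b::euclidean_space"
  assumes f: "f \<in> L2_loc \<Omega>" and \<zeta>: "test_function \<Omega> \<zeta>"
  shows "sq_integrable lebesgue (\<lambda>x. \<zeta> x *\<^sub>R f x)"
proof -
  obtain K where K: "compact K" "K \<subseteq> \<Omega>" "\<And>x. x \<notin> K \<Longrightarrow> \<zeta> x = 0"
    by (rule test_function_support[OF \<zeta>]) (rule that)
  obtain B where B: "0 < B" "\<And>x. \<bar>\<zeta> x\<bar> \<le> B" by (rule test_function_bounded[OF \<zeta>]) (rule that)
  have Ks: "K \<in> sets lebesgue" using K(1) by (simp add: borel_compact)
  have s: "sq_integrable lebesgue (\<lambda>x. if x \<in> K then f x else 0)"
    using L2_loc_sq_integrable[OF f K(1,2)] by (simp add: sq_integrable_lebesgue_on[OF Ks])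
  have [measurable]: "\<zeta> \<in> borel_measurable lebesgue" by (rule borel_imp_lebesgue[OF test_function_measurable[OF \<zeta>]])
  have [measurable]: "(\<lambda>x. if x \<in> K then f x else 0) \<in> borel_measurable lebesgue"
    using s by (simp add: sq_integrable_def)
  have eq: "(\<lambda>x. \<zeta> x *\<^sub>R f x) = (\<lambda>x. \<zeta> x *\<^sub>R (if x \<in> K then f x else 0))"
  proof
    fix x show "\<zeta> x *\<^sub>R f x = \<zeta> x *\<^sub>R (if x \<in> K then f x else 0)" using K(3)[of x] by (cases "x \<in> K") auto
  qed
  show ?thesis unfolding eq
  proof (rule sq_integrable_bound[OF s])
    show "AE x in lebesgue. norm (\<zeta> x *\<^sub>R (if x \<in> K then f x else 0)) \<le> B * norm (if x \<in> K then f x else 0)"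
      using B by (auto intro!: mult_right_mono)
  qed measurable
qed

lemma test_function_lebesgue_sq_integrable: "test_function \<Omega> \<phi> \<Longrightarrow> sq_integrable lebesgue \<phi>"
  using test_function_sq_integrable[of \<Omega> \<phi>] sq_integrable_lborel_iff(1)[OF test_function_measurable, of \<Omega> \<phi>] by simp

lemma integral_lebesgue_on_eq_lebesgue:
  fixes h :: "real ^ 'n::finite \<Rightarrow> 'b::euclidean_space"
  assumes "open \<Omega>" "\<And>x. x \<notin> \<Omega> \<Longrightarrow> h x = 0"
  shows "(\<integral>x. h x \<partial>lebesgue_on \<Omega>) = (\<integral>x. h x \<partial>lebesgue)"
proof -
  have "\<Omega> \<in> sets lebesgue" using assms by simp
  moreover have "(\<lambda>x. if x \<in> \<Omega> then h x else 0) = h" using assms(2) by auto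
  ultimately show ?thesis using Lebesgue_Measure.integral_restrict_UNIV[of \<Omega> h] by simp
qed

text \<open>
  The product rule. For a test function \<open>\<phi>\<close> on the whole space, \<open>\<zeta>\<phi>\<close> is a test function on \<open>\<Omega>\<close>, and the
  weak derivative of \<open>f\<close> is tested against it.
\<close>

lemma localized_weak_deriv:
  fixes f :: "real ^ 'n::finite \<Rightarrow> real ^ 's::finite"
  assumes "open \<Omega>" and \<zeta>: "test_function \<Omega> \<zeta>" and f: "f \<in> L2_loc \<Omega>" and g: "g \<in> L2_loc \<Omega>"
    and wp: "has_weak_partial \<Omega> i f g"
    and U: "U \<in> borel_measurable borel" "AE x in lebesgue. U x = \<zeta> x *\<^sub>R f x"
    and P: "P \<in> borel_measurable borel" "AE x in lebesgue. P x = \<zeta> x *\<^sub>R g x + pderiv_at i \<zeta> x *\<^sub>R f x"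
  shows "weak_deriv_L2 i (\<lambda>x. U x $ S) (\<lambda>x. P x $ S)"
proof -
  note d\<zeta> = test_function_pderiv[OF \<zeta>, of i]
  note s\<zeta>f = test_function_times_L2_loc[OF f \<zeta>] and s\<zeta>g = test_function_times_L2_loc[OF g \<zeta>] and sd\<zeta>f = test_function_times_L2_loc[OF f d\<zeta>]
  have UB: "U \<in> borel_measurable lebesgue" "P \<in> borel_measurable lebesgue" using U(1) P(1) by (auto intro: borel_imp_lebesgue)
  have sU: "sq_integrable lborel U"
    unfolding sq_integrable_lborel_iff(1)[OF U(1)] by (rule sq_integrable_cong_AE(1)[OF UB(1) s\<zeta>f U(2)])
  have sP: "sq_integrable lborel P"
    unfolding sq_integrable_lborel_iff(1)[OF P(1)]
    by (rule sq_integrable_cong_AE(1)[OF UB(2) sq_integrable_add[OF s\<zeta>g sd\<zeta>f] P(2)])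
  have comp: "(\<lambda>x. h x $ S) \<in> borel_measurable M" if "h \<in> borel_measurable M" for h :: "real ^ 'n \<Rightarrow> real ^ 's" and M
    using borel_measurable_inner[OF that borel_measurable_const, of "axis S 1"] by (simp add: inner_axis)
  show ?thesis
    unfolding weak_deriv_L2_def
  proof (intro conjI allI impI sq_integrable_component sU sP)
    fix \<phi> :: "real ^ 'n \<Rightarrow> real" assume \<phi>: "test_function UNIV \<phi>"
    note d\<phi> = test_function_pderiv[OF \<phi>, of i]
    have \<zeta>\<phi>: "test_function \<Omega> (\<lambda>x. \<zeta> x * \<phi> x)" by (rule test_function_mult_smooth[OF \<zeta> test_function_smooth[OF \<phi>]])
    have bor: "\<phi> \<in> borel_measurable borel" "pderiv_at i \<phi> \<in> borel_measurable borel"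
      using test_function_measurable[OF \<phi>] test_function_measurable[OF d\<phi>] by auto
    note bor_leb = bor[THEN borel_imp_lebesgue]
    have to_leb: "(\<integral>x. \<psi> x * h x $ S \<partial>lborel) = (\<integral>x. \<psi> x * k x $ S \<partial>lebesgue)"
      if "\<psi> \<in> borel_measurable borel" "h \<in> borel_measurable borel" "k \<in> borel_measurable lebesgue" "AE x in lebesgue. h x = k x"
      for \<psi> and h k :: "real ^ 'n \<Rightarrow> real ^ 's"
    proof -
      have "(\<integral>x. \<psi> x * h x $ S \<partial>lborel) = (\<integral>x. \<psi> x * h x $ S \<partial>lebesgue)"
        by (rule integral_completion[symmetric]) (simp add: borel_measurable_times comp that)
      also have "\<dots> = (\<integral>x. \<psi> x * k x $ S \<partial>lebesgue)"
      proof (rule integral_cong_AE)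
        show "(\<lambda>x. \<psi> x * h x $ S) \<in> borel_measurable lebesgue" "(\<lambda>x. \<psi> x * k x $ S) \<in> borel_measurable lebesgue"
          by (intro borel_measurable_times comp that borel_imp_lebesgue[OF that(1)] borel_imp_lebesgue[OF that(2)])+
        show "AE x in lebesgue. \<psi> x * h x $ S = \<psi> x * k x $ S" using that(4) by eventually_elim simp
      qed
      finally show ?thesis .
    qed
    have i1: "integrable lebesgue (\<lambda>x. pderiv_at i \<phi> x * (\<zeta> x *\<^sub>R f x) $ S)"
      and i2: "integrable lebesgue (\<lambda>x. \<phi> x * (pderiv_at i \<zeta> x *\<^sub>R f x) $ S)"
      and i3: "integrable lebesgue (\<lambda>x. \<phi> x * (\<zeta> x *\<^sub>R g x) $ S)"
      by (intro sq_integrable_mult sq_integrable_component s\<zeta>f s\<zeta>g sd\<zeta>f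
          test_function_lebesgue_sq_integrable[OF \<phi>] test_function_lebesgue_sq_integrable[OF d\<phi>])+
    have int_loc: "integrable (lebesgue_on K) f" "integrable (lebesgue_on K) g" if "compact K" "K \<subseteq> \<Omega>" for K
      using wp that by (auto simp: has_weak_partial_def)
    obtain K where K: "compact K" "K \<subseteq> \<Omega>" "\<And>x. x \<notin> K \<Longrightarrow> \<zeta> x = 0"
      by (rule test_function_support[OF \<zeta>]) (rule that)
    have out: "\<zeta> x = 0" "pderiv_at i \<zeta> x = 0" if "x \<notin> \<Omega>" for x
    proof -
      have "x \<notin> K" using K(2) that by blast
      then show "\<zeta> x = 0" "pderiv_at i \<zeta> x = 0"
        by (auto intro: K(3) pderiv_at_eq_0[OF compact_imp_closed[OF K(1)] K(3)])
    qed
    have vec: "(\<integral>x. \<psi> x *\<^sub>R h x \<partial>lebesgue_on \<Omega>) $ S = (\<integral>x. \<psi> x * h x $ S \<partial>lebesgue)"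
      if \<psi>: "test_function \<Omega> \<psi>" and h: "\<And>K. compact K \<Longrightarrow> K \<subseteq> \<Omega> \<Longrightarrow> integrable (lebesgue_on K) h"
      for \<psi> and h :: "real ^ 'n \<Rightarrow> real ^ 's"
    proof -
      obtain L where L: "compact L" "L \<subseteq> \<Omega>" "\<And>x. x \<notin> L \<Longrightarrow> \<psi> x = 0"
        by (rule test_function_support[OF \<psi>]) (rule that)
      have "(\<integral>x. \<psi> x *\<^sub>R h x \<partial>lebesgue_on \<Omega>) $ S = (\<integral>x. \<psi> x *\<^sub>R h x \<partial>lebesgue_on \<Omega>) \<bullet> axis S 1" by (simp add: inner_axis)
      also have "\<dots> = (\<integral>x. (\<psi> x *\<^sub>R h x) \<bullet> axis S 1 \<partial>lebesgue_on \<Omega>)"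
        by (rule integral_inner_left[symmetric]) (rule test_function_times_loc_integrable[OF \<open>open \<Omega>\<close> h \<psi>])
      also have "\<dots> = (\<integral>x. \<psi> x * h x $ S \<partial>lebesgue_on \<Omega>)" by (simp add: inner_axis)
      also have "\<dots> = (\<integral>x. \<psi> x * h x $ S \<partial>lebesgue)"
        using L by (intro integral_lebesgue_on_eq_lebesgue \<open>open \<Omega>\<close>) auto
      finally show ?thesis .
    qed
    have "(\<integral>x. pderiv_at i \<phi> x * U x $ S \<partial>lborel) = (\<integral>x. pderiv_at i \<phi> x * (\<zeta> x *\<^sub>R f x) $ S \<partial>lebesgue)"
      using s\<zeta>f by (intro to_leb bor U) (simp add: sq_integrable_def)
    also have "\<dots> = (\<integral>x. pderiv_at i (\<lambda>x. \<zeta> x * \<phi> x) x * f x $ S - \<phi> x * (pderiv_at i \<zeta> x *\<^sub>R f x) $ S \<partial>lebesgue)"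
      unfolding pderiv_at_mult[OF test_function_smooth[OF \<zeta>] test_function_smooth[OF \<phi>]]
      by (intro Bochner_Integration.integral_cong refl) (simp add: algebra_simps)
    also have "\<dots> = (\<integral>x. pderiv_at i (\<lambda>x. \<zeta> x * \<phi> x) x * f x $ S \<partial>lebesgue) - (\<integral>x. \<phi> x * (pderiv_at i \<zeta> x *\<^sub>R f x) $ S \<partial>lebesgue)"
    proof (rule Bochner_Integration.integral_diff[OF _ i2])
      have "pderiv_at i (\<lambda>x. \<zeta> x * \<phi> x) x * f x $ S =
          pderiv_at i \<phi> x * (\<zeta> x *\<^sub>R f x) $ S + \<phi> x * (pderiv_at i \<zeta> x *\<^sub>R f x) $ S" for x
        unfolding pderiv_at_mult[OF test_function_smooth[OF \<zeta>] test_function_smooth[OF \<phi>]] by (simp add: algebra_simps)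
      then show "integrable lebesgue (\<lambda>x. pderiv_at i (\<lambda>x. \<zeta> x * \<phi> x) x * f x $ S)"
        using Bochner_Integration.integrable_add[OF i1 i2] by (simp only:)
    qed
    also have "(\<integral>x. pderiv_at i (\<lambda>x. \<zeta> x * \<phi> x) x * f x $ S \<partial>lebesgue) = - (\<integral>x. \<zeta> x * \<phi> x * g x $ S \<partial>lebesgue)"
    proof -
      have "(\<integral>x. pderiv_at i (\<lambda>x. \<zeta> x * \<phi> x) x *\<^sub>R f x \<partial>lebesgue_on \<Omega>) = - (\<integral>x. (\<zeta> x * \<phi> x) *\<^sub>R g x \<partial>lebesgue_on \<Omega>)"
        using wp \<zeta>\<phi> by (simp add: has_weak_partial_def)
      then have "(\<integral>x. pderiv_at i (\<lambda>x. \<zeta> x * \<phi> x) x *\<^sub>R f x \<partial>lebesgue_on \<Omega>) $ S = - ((\<integral>x. (\<zeta> x * \<phi> x) *\<^sub>R g x \<partial>lebesgue_on \<Omega>) $ S)"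
        by simp
      then show ?thesis
        by (simp only: vec[OF test_function_pderiv[OF \<zeta>\<phi>, of i] int_loc(1)] vec[OF \<zeta>\<phi> int_loc(2)])
    qed
    also have "- (\<integral>x. \<zeta> x * \<phi> x * g x $ S \<partial>lebesgue) - (\<integral>x. \<phi> x * (pderiv_at i \<zeta> x *\<^sub>R f x) $ S \<partial>lebesgue)
      = - (\<integral>x. \<phi> x * (\<zeta> x *\<^sub>R g x) $ S + \<phi> x * (pderiv_at i \<zeta> x *\<^sub>R f x) $ S \<partial>lebesgue)"
      using i2 i3 by (subst Bochner_Integration.integral_add) (auto simp: mult_ac)
    also have "(\<integral>x. \<phi> x * (\<zeta> x *\<^sub>R g x) $ S + \<phi> x * (pderiv_at i \<zeta> x *\<^sub>R f x) $ S \<partial>lebesgue) =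
        (\<integral>x. \<phi> x * (\<zeta> x *\<^sub>R g x + pderiv_at i \<zeta> x *\<^sub>R f x) $ S \<partial>lebesgue)"
      by (simp add: algebra_simps)
    also have "\<dots> = (\<integral>x. \<phi> x * P x $ S \<partial>lborel)"
      using sq_integrable_add[OF s\<zeta>g sd\<zeta>f] by (intro to_leb[symmetric] bor P) (simp add: sq_integrable_def)
    finally show "(\<integral>x. pderiv_at i \<phi> x * U x $ S \<partial>lborel) = - (\<integral>x. \<phi> x * P x $ S \<partial>lborel)" .
  qed
qed

text \<open>
  All components of the gradient refer to the same Borel representative \<open>U\<close>, which vanishes exactly
  outside of \<open>K\<close> and not only almost everywhere; the compactness criterion asks for this.
\<close>

lemma borel_localization:
  fixes f :: "real ^ 'n::finite \<Rightarrow> real ^ 's::finite"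
  assumes "open \<Omega>" and \<zeta>: "test_function \<Omega> \<zeta>" and f: "f \<in> L2_loc \<Omega>" and g: "\<And>i. g i \<in> L2_loc \<Omega>"
    and wp: "\<And>i. has_weak_partial \<Omega> i f (g i)" and K: "closed K" "\<And>x. x \<notin> K \<Longrightarrow> \<zeta> x = 0"
  obtains U P where "sq_integrable lborel U" "\<And>i. sq_integrable lborel (P i)"
    "AE x in lebesgue. U x = \<zeta> x *\<^sub>R f x" "\<And>x. x \<notin> K \<Longrightarrow> U x = 0"
    "\<And>i. AE x in lebesgue. P i x = \<zeta> x *\<^sub>R g i x + pderiv_at i \<zeta> x *\<^sub>R f x"
    "\<And>i S. weak_deriv_L2 i (\<lambda>x. U x $ S) (\<lambda>x. P i x $ S)"
proof -
  note s\<zeta>f = test_function_times_L2_loc[OF f \<zeta>]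
  have sP: "sq_integrable lebesgue (\<lambda>x. \<zeta> x *\<^sub>R g i x + pderiv_at i \<zeta> x *\<^sub>R f x)" for i
    by (intro sq_integrable_add test_function_times_L2_loc[OF g \<zeta>] test_function_times_L2_loc[OF f test_function_pderiv[OF \<zeta>]])
  obtain U0 where U0: "U0 \<in> borel_measurable borel" "AE x in lebesgue. \<zeta> x *\<^sub>R f x = U0 x"
    by (rule lebesgue_ex_borel[OF sq_integrable_measurable[OF s\<zeta>f]])
  have "\<exists>p. p \<in> borel_measurable borel \<and> (AE x in lebesgue. \<zeta> x *\<^sub>R g i x + pderiv_at i \<zeta> x *\<^sub>R f x = p x)" for i
    by (rule lebesgue_ex_borel[OF sq_integrable_measurable[OF sP[of i]]]) (intro exI conjI)
  then have "\<forall>i. \<exists>p. p \<in> borel_measurable borel \<and> (AE x in lebesgue. \<zeta> x *\<^sub>R g i x + pderiv_at i \<zeta> x *\<^sub>R f x = p x)" by blast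
  from choice[OF this] obtain P where P: "\<And>i. P i \<in> borel_measurable borel"
    "\<And>i. AE x in lebesgue. \<zeta> x *\<^sub>R g i x + pderiv_at i \<zeta> x *\<^sub>R f x = P i x" by auto
  define U where "U x = indicator K x *\<^sub>R U0 x" for x
  have [measurable]: "U0 \<in> borel_measurable borel" "K \<in> sets borel" using U0 K(1) by auto
  have U: "U \<in> borel_measurable borel" unfolding U_def by measurable
  have AE_U: "AE x in lebesgue. U x = \<zeta> x *\<^sub>R f x"
    using U0(2)
  proof eventually_elim
    case (elim x)
    then show ?case using K(2)[of x] by (cases "x \<in> K") (auto simp: U_def)
  qed
  have AE_P: "AE x in lebesgue. P i x = \<zeta> x *\<^sub>R g i x + pderiv_at i \<zeta> x *\<^sub>R f x" for i
    using P(2)[of i] by eventually_elim simp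
  show ?thesis
  proof
    show "sq_integrable lborel U"
      unfolding sq_integrable_lborel_iff(1)[OF U] by (rule sq_integrable_cong_AE(1)[OF borel_imp_lebesgue[OF U] s\<zeta>f AE_U])
    show "sq_integrable lborel (P i)" for i
      unfolding sq_integrable_lborel_iff(1)[OF P(1)] by (rule sq_integrable_cong_AE(1)[OF borel_imp_lebesgue[OF P(1)] sP AE_P])
    show "weak_deriv_L2 i (\<lambda>x. U x $ S) (\<lambda>x. P i x $ S)" for i S
      by (rule localized_weak_deriv[OF \<open>open \<Omega>\<close> \<zeta> f g wp U AE_U P(1) AE_P])
    show "U x = 0" if "x \<notin> K" for x using that by (simp add: U_def)
  qed (fact AE_U AE_P)+
qed

text \<open>
  Convexity of the square at \<open>m a + (1 - m) (b / (1 - m))\<close>. The coefficient of \<open>a\<^sup>2\<close> stays below 1, so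
  that the term can be absorbed.
\<close>

lemma convex_square_bound:
  fixes a b m :: real
  assumes "0 \<le> m" "m < 1"
  shows "(m * a + b)\<^sup>2 \<le> m * a\<^sup>2 + b\<^sup>2 / (1 - m)"
proof -
  have "0 \<le> m * ((1 - m) * a - b)\<^sup>2 / (1 - m)" using assms by simp
  also have "\<dots> = m * a\<^sup>2 + b\<^sup>2 / (1 - m) - (m * a + b)\<^sup>2"
    using assms by (simp add: field_simps power2_eq_square)
  finally show ?thesis by simp
qed

lemma ext_div_add: "ext_div (\<lambda>i. p i + q i) = ext_div p + ext_div q"
  by (simp add: ext_div_def linear_add[OF linear_wedge_right] sum.distrib)

lemma int_div_add: "int_div (\<lambda>i. p i + q i) = int_div p + int_div q"
  by (simp add: int_div_def linear_add[OF linear_interior_mult] sum.distrib)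

lemma ext_div_scale: "ext_div (\<lambda>i. c *\<^sub>R p i) = c *\<^sub>R ext_div p"
  by (simp add: ext_div_def linear_cmul[OF linear_wedge_right] scaleR_sum_right)

lemma int_div_scale: "int_div (\<lambda>i. c *\<^sub>R p i) = c *\<^sub>R int_div p"
  by (simp add: int_div_def linear_cmul[OF linear_interior_mult] scaleR_sum_right)

lemma ext_div_diff: "ext_div (\<lambda>i. p i - q i) = ext_div p - ext_div q"
  using ext_div_add[of p "\<lambda>i. (- 1) *\<^sub>R q i"] ext_div_scale[of "- 1" q] by simp

lemma int_div_diff: "int_div (\<lambda>i. p i - q i) = int_div p - int_div q"
  using int_div_add[of p "\<lambda>i. (- 1) *\<^sub>R q i"] int_div_scale[of "- 1" q] by simp

lemma dirac_symbol_bounded: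
  obtains L where "0 \<le> L" "\<And>p :: 'n::{finite,linorder} \<Rightarrow> 'n ext. norm (ext_div p) \<le> L * (\<Sum>i\<in>UNIV. norm (p i))"
    "\<And>p :: 'n::{finite,linorder} \<Rightarrow> 'n ext. norm (int_div p) \<le> L * (\<Sum>i\<in>UNIV. norm (p i))"
proof -
  have "\<exists>B>0. \<forall>x. norm (ext_e i \<and>\<^sub>e x) \<le> B * norm x" for i :: 'n
    using linear_bounded_pos[OF linear_wedge_right] by metis
  then obtain B where B: "\<And>i. 0 < B i" "\<And>i x. norm (ext_e (i::'n) \<and>\<^sub>e x) \<le> B i * norm x" by metis
  have "\<exists>B>0. \<forall>x. norm (interior_mult i x) \<le> B * norm x" for i :: 'n
    using linear_bounded_pos[OF linear_interior_mult] by metis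
  then obtain B' where B': "\<And>i. 0 < B' i" "\<And>i x. norm (interior_mult (i::'n) x) \<le> B' i * norm x" by metis
  define L where "L = (\<Sum>i\<in>UNIV. B i + B' i)"
  have le: "B i \<le> L" "B' i \<le> L" for i
  proof -
    have "B i + B' i \<le> L" unfolding L_def
      by (rule member_le_sum) (use B(1) B'(1) in \<open>auto intro: add_nonneg_nonneg less_imp_le\<close>)
    then show "B i \<le> L" "B' i \<le> L" using B(1)[of i] B'(1)[of i] by linarith+
  qed
  show ?thesis
  proof
    show "0 \<le> L" unfolding L_def using B(1) B'(1) by (intro sum_nonneg) (auto intro: add_nonneg_nonneg less_imp_le)
    fix p :: "'n \<Rightarrow> 'n ext"
    have "norm (ext_div p) \<le> (\<Sum>i\<in>UNIV. L * norm (p i))" unfolding ext_div_def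
      by (intro sum_norm_le order_trans[OF B(2)] mult_right_mono le) auto
    then show "norm (ext_div p) \<le> L * (\<Sum>i\<in>UNIV. norm (p i))" by (simp add: sum_distrib_left)
    have "norm (int_div p) \<le> (\<Sum>i\<in>UNIV. L * norm (p i))" unfolding int_div_def
      by (intro sum_norm_le order_trans[OF B'(2)] mult_right_mono le) auto
    then show "norm (int_div p) \<le> L * (\<Sum>i\<in>UNIV. norm (p i))" by (simp add: sum_distrib_left)
  qed
qed

text \<open>
  The pointwise inequality \<open>|\<D>\<^sup>-f| \<le> m |\<D>\<^sup>+f|\<close> is what the energy estimate needs from the equation. The
  weak gradient \<open>g\<close> is a parameter, so that locally square integrable representatives can be used in
  place of \<open>weak_partial\<close>.
\<close>

definition dirac_bounded ::
    "(real ^ 'n::{finite,linorder}) set \<Rightarrow> real \<Rightarrow> (real ^ 'n::{finite,linorder} \<Rightarrow> 'n::{finite,linorder} ext)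
      \<Rightarrow> ('n::{finite,linorder} \<Rightarrow> real ^ 'n::{finite,linorder} \<Rightarrow> 'n::{finite,linorder} ext) \<Rightarrow> bool" where
  "dirac_bounded \<Omega> m f g \<longleftrightarrow> f \<in> L2_loc \<Omega> \<and> (\<forall>i. g i \<in> L2_loc \<Omega> \<and> has_weak_partial \<Omega> i f (g i)) \<and>
     (AE x in lebesgue_on \<Omega>. norm (ext_div (\<lambda>i. g i x) - int_div (\<lambda>i. g i x))
        \<le> m * norm (ext_div (\<lambda>i. g i x) + int_div (\<lambda>i. g i x)))"

text \<open>
  For \<open>G = \<zeta>f\<close> the product rule gives \<open>|\<D>\<^sup>-G| \<le> m |\<D>\<^sup>+G| + 4A |f|\<close> on \<open>K\<close>, where \<open>A\<close> bounds the symbols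
  of \<open>\<nabla>\<zeta>\<close>. Integrating the squares, both Dirac energies of \<open>G\<close> are equal to the energy \<open>S\<close> of its
  gradient, so \<open>(1 - m) S\<close> is bounded by a multiple of the integral of \<open>|f|\<^sup>2\<close>. The constant depends on
  \<open>\<zeta>\<close> and \<open>m\<close> but not on \<open>f\<close>.
\<close>

lemma caccioppoli:
  fixes \<zeta> :: "real ^ 'n::{finite,linorder} \<Rightarrow> real"
  assumes "open \<Omega>" and \<zeta>: "test_function \<Omega> \<zeta>" and K: "compact K" "K \<subseteq> \<Omega>" "\<And>x. x \<notin> K \<Longrightarrow> \<zeta> x = 0"
    and m: "0 \<le> m" "m < 1"
  obtains C where "0 \<le> C" "\<And>f g i. dirac_bounded \<Omega> m f g \<Longrightarrow>
      (\<integral>x. (norm (\<zeta> x *\<^sub>R g i x + pderiv_at i \<zeta> x *\<^sub>R f x))\<^sup>2 \<partial>lebesgue) \<le> C * (\<integral>x. (norm (f x))\<^sup>2 \<partial>lebesgue_on K)"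
proof -
  obtain L where L: "0 \<le> L" "\<And>p :: 'n \<Rightarrow> 'n ext. norm (ext_div p) \<le> L * (\<Sum>i\<in>UNIV. norm (p i))"
    "\<And>p :: 'n \<Rightarrow> 'n ext. norm (int_div p) \<le> L * (\<Sum>i\<in>UNIV. norm (p i))"
    by (rule dirac_symbol_bounded) (rule that)
  have "\<exists>B>0. \<forall>x. \<bar>pderiv_at i \<zeta> x\<bar> \<le> B" for i
    by (rule test_function_bounded[OF test_function_pderiv[OF \<zeta>, of i]]) blast
  then obtain B where B: "\<And>i. 0 < B i" "\<And>i x. \<bar>pderiv_at i \<zeta> x\<bar> \<le> B i" by metis
  define A where "A = L * (\<Sum>i\<in>UNIV. B i)"
  have A0: "0 \<le> A" unfolding A_def using L(1) B(1) by (intro mult_nonneg_nonneg sum_nonneg) (auto intro: less_imp_le)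
  (* One factor 1 / (1 - m) comes from the convexity of the square, the other one from absorbing
     m times the energy. *)
  define C where "C = (4 * A)\<^sup>2 / (1 - m) / (1 - m)"
  have Ks: "K \<in> sets lebesgue" using K(1) by (simp add: borel_compact)
  show ?thesis
  proof
    show "0 \<le> C" using m by (simp add: C_def)
    fix f :: "real ^ 'n::{finite,linorder} \<Rightarrow> 'n::{finite,linorder} ext" and g i
    assume Q: "dirac_bounded \<Omega> m f g"
    then have f: "f \<in> L2_loc \<Omega>" and g: "\<And>i. g i \<in> L2_loc \<Omega>" and wp: "\<And>i. has_weak_partial \<Omega> i f (g i)"
      and belt: "AE x in lebesgue_on \<Omega>. norm (ext_div (\<lambda>i. g i x) - int_div (\<lambda>i. g i x)) \<le> m * norm (ext_div (\<lambda>i. g i x) + int_div (\<lambda>i. g i x))"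
      by (auto simp: dirac_bounded_def)
    obtain U P where P1: "sq_integrable lborel U" "\<And>i. sq_integrable lborel (P i)"
      "AE x in lebesgue. U x = \<zeta> x *\<^sub>R f x" "\<And>x. x \<notin> K \<Longrightarrow> U x = 0"
      and P2: "\<And>i. AE x in lebesgue. P i x = \<zeta> x *\<^sub>R g i x + pderiv_at i \<zeta> x *\<^sub>R f x"
      and wd: "\<And>i S. weak_deriv_L2 i (\<lambda>x. U x $ S) (\<lambda>x. P i x $ S)"
      by (rule borel_localization[OF \<open>open \<Omega>\<close> \<zeta> f g wp compact_imp_closed[OF K(1)]]) (erule K(3), rule that)
    note P = P1(2) P2
    define fK where "fK x = (if x \<in> K then f x else 0)" for x
    have fK: "sq_integrable lebesgue fK"
      unfolding fK_def using L2_loc_sq_integrable[OF f K(1,2)] by (simp add: sq_integrable_lebesgue_on[OF Ks])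
    define S where "S = (\<Sum>i\<in>UNIV. \<integral>x. (norm (P i x))\<^sup>2 \<partial>lborel)"
    define Dp where "Dp x = ext_div (\<lambda>i. P i x) + int_div (\<lambda>i. P i x)" for x
    define Dm where "Dm x = ext_div (\<lambda>i. P i x) - int_div (\<lambda>i. P i x)" for x
    have sym: "(\<integral>x. P i x $ S * P j x $ T \<partial>lborel) = (\<integral>x. P j x $ S * P i x $ T \<partial>lborel)" for i j S T
      by (rule weak_deriv_mixed_commute[OF wd wd wd wd])
    have Dp_int: "(\<integral>x. (norm (Dp x))\<^sup>2 \<partial>lborel) = S" and Dm_int: "(\<integral>x. (norm (Dm x))\<^sup>2 \<partial>lborel) = S"
      unfolding Dp_def Dm_def S_def by (rule integral_dirac_symbol[OF P(1) sym])+
    have ed: "sq_integrable lborel (\<lambda>x. ext_div (\<lambda>i. P i x))" unfolding ext_div_def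
      by (intro sq_integrable_sum sq_integrable_linear[OF linear_wedge_right] P)
    have id: "sq_integrable lborel (\<lambda>x. int_div (\<lambda>i. P i x))" unfolding int_div_def
      by (intro sq_integrable_sum sq_integrable_linear[OF linear_interior_mult] P)
    have sDp: "sq_integrable lborel Dp" and sDm: "sq_integrable lborel Dm"
      unfolding Dp_def[abs_def] Dm_def[abs_def] by (intro sq_integrable_add sq_integrable_diff ed id)+
    have bDp: "Dp \<in> borel_measurable borel" and bDm: "Dm \<in> borel_measurable borel" using sDp sDm by (auto simp: sq_integrable_def)
    note sDp' = sDp[unfolded sq_integrable_lborel_iff(1)[OF bDp]]
    note sDm' = sDm[unfolded sq_integrable_lborel_iff(1)[OF bDm]]
    have "AE x in lebesgue. \<forall>i\<in>UNIV. P i x = \<zeta> x *\<^sub>R g i x + pderiv_at i \<zeta> x *\<^sub>R f x"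
      by (subst AE_ball_countable) (auto intro: countable_finite P(2))
    moreover have "AE x in lebesgue. x \<in> \<Omega> \<longrightarrow> norm (ext_div (\<lambda>i. g i x) - int_div (\<lambda>i. g i x)) \<le> m * norm (ext_div (\<lambda>i. g i x) + int_div (\<lambda>i. g i x))"
      using belt \<open>open \<Omega>\<close> by (simp add: AE_restrict_space_iff)
    ultimately have "AE x in lebesgue. norm (Dm x) \<le> m * norm (Dp x) + 4 * A * norm (fK x)"
    proof eventually_elim
      case (elim x)
      define p where "p = (\<lambda>i. g i x)"
      define q where "q = (\<lambda>i. pderiv_at i \<zeta> x *\<^sub>R f x)"
      have Pe: "(\<lambda>i. P i x) = (\<lambda>i. \<zeta> x *\<^sub>R p i + q i)" using elim(1) by (auto simp: p_def q_def)
      have Dpe: "Dp x = \<zeta> x *\<^sub>R (ext_div p + int_div p) + (ext_div q + int_div q)"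
        unfolding Dp_def Pe by (simp add: ext_div_add int_div_add ext_div_scale int_div_scale algebra_simps)
      have Dme: "Dm x = \<zeta> x *\<^sub>R (ext_div p - int_div p) + (ext_div q - int_div q)"
        unfolding Dm_def Pe by (simp add: ext_div_add int_div_add ext_div_scale int_div_scale algebra_simps)
      have q0: "(\<Sum>i\<in>UNIV. norm (q i)) \<le> (\<Sum>i\<in>UNIV. B i) * norm (fK x)"
      proof (cases "x \<in> K")
        case True
        then show ?thesis unfolding q_def fK_def sum_distrib_right
          by (auto intro!: sum_mono mult_right_mono B(2))
      next
        case False
        then have "pderiv_at i \<zeta> x = 0" for i
          by (auto intro: K(3) pderiv_at_eq_0[OF compact_imp_closed[OF K(1)] K(3)])
        then show ?thesis using False by (simp add: q_def fK_def)
      qed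
      have q1: "norm (ext_div q) \<le> A * norm (fK x)" "norm (int_div q) \<le> A * norm (fK x)"
        using L(2)[of q] L(3)[of q] mult_left_mono[OF q0 L(1)] unfolding A_def mult.assoc by linarith+
      have "norm (\<zeta> x *\<^sub>R (ext_div p - int_div p)) \<le> m * norm (\<zeta> x *\<^sub>R (ext_div p + int_div p))"
      proof (cases "x \<in> \<Omega>")
        case True
        then have "\<bar>\<zeta> x\<bar> * norm (ext_div p - int_div p) \<le> \<bar>\<zeta> x\<bar> * (m * norm (ext_div p + int_div p))"
          using elim(2) unfolding p_def by (intro mult_left_mono) auto
        then show ?thesis by (simp add: mult_ac)
      next
        case False
        then have "\<zeta> x = 0" using K(2,3) by blast
        then show ?thesis by simp
      qed
      (* Passing from the symbol of g to the one of G costs 2 A |f| on either side, hence 4 A. *)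
      also have "\<zeta> x *\<^sub>R (ext_div p + int_div p) = Dp x - (ext_div q + int_div q)" using Dpe by simp
      also have "m * norm (Dp x - (ext_div q + int_div q)) \<le> m * norm (Dp x) + 2 * A * norm (fK x)"
      proof -
        have "norm (ext_div q + int_div q) \<le> 2 * A * norm (fK x)" using q1 norm_triangle_ineq[of "ext_div q" "int_div q"] by linarith
        then have "m * norm (ext_div q + int_div q) \<le> 1 * (2 * A * norm (fK x))" using m by (intro mult_mono) auto
        moreover have "m * norm (Dp x - (ext_div q + int_div q)) \<le> m * (norm (Dp x) + norm (ext_div q + int_div q))"
          using m by (intro mult_left_mono norm_triangle_ineq4) auto
        ultimately show ?thesis by (simp add: algebra_simps)
      qed
      finally have "norm (\<zeta> x *\<^sub>R (ext_div p - int_div p)) \<le> m * norm (Dp x) + 2 * A * norm (fK x)" .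
      moreover have "norm (ext_div q - int_div q) \<le> 2 * A * norm (fK x)" using q1 norm_triangle_ineq4[of "ext_div q" "int_div q"] by linarith
      moreover have "norm (Dm x) \<le> norm (\<zeta> x *\<^sub>R (ext_div p - int_div p)) + norm (ext_div q - int_div q)"
        unfolding Dme by (rule norm_triangle_ineq)
      ultimately show ?case by linarith
    qed
    then have ptw: "AE x in lebesgue. (norm (Dm x))\<^sup>2 \<le> m * (norm (Dp x))\<^sup>2 + (4 * A)\<^sup>2 / (1 - m) * (norm (fK x))\<^sup>2"
    proof eventually_elim
      case (elim x)
      then have "(norm (Dm x))\<^sup>2 \<le> (m * norm (Dp x) + 4 * A * norm (fK x))\<^sup>2" by (intro power_mono) auto
      also have "\<dots> \<le> m * (norm (Dp x))\<^sup>2 + (4 * A * norm (fK x))\<^sup>2 / (1 - m)" by (rule convex_square_bound[OF m])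
      finally show ?case by (simp add: power_mult_distrib)
    qed
    have "S = (\<integral>x. (norm (Dm x))\<^sup>2 \<partial>lebesgue)" using Dm_int sq_integrable_lborel_iff(2)[OF bDm] by simp
    also have "\<dots> \<le> (\<integral>x. m * (norm (Dp x))\<^sup>2 + (4 * A)\<^sup>2 / (1 - m) * (norm (fK x))\<^sup>2 \<partial>lebesgue)"
      using sDm' sDp' fK ptw by (intro integral_mono_AE) (auto simp: sq_integrable_def)
    also have "\<dots> = m * (\<integral>x. (norm (Dp x))\<^sup>2 \<partial>lebesgue) + (4 * A)\<^sup>2 / (1 - m) * (\<integral>x. (norm (fK x))\<^sup>2 \<partial>lebesgue)"
      using sDp' fK by (simp add: sq_integrable_def)
    also have "(\<integral>x. (norm (Dp x))\<^sup>2 \<partial>lebesgue) = S" using Dp_int sq_integrable_lborel_iff(2)[OF bDp] by simp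
    also have "(\<integral>x. (norm (fK x))\<^sup>2 \<partial>lebesgue) = (\<integral>x. (norm (f x))\<^sup>2 \<partial>lebesgue_on K)"
      unfolding fK_def by (rule sq_integrable_lebesgue_on(2)[OF Ks, symmetric])
    finally have "S \<le> m * S + (4 * A)\<^sup>2 / (1 - m) * (\<integral>x. (norm (f x))\<^sup>2 \<partial>lebesgue_on K)" .
    then have "(1 - m) * S \<le> (4 * A)\<^sup>2 / (1 - m) * (\<integral>x. (norm (f x))\<^sup>2 \<partial>lebesgue_on K)" by (simp add: algebra_simps)
    then have "(1 - m) * S / (1 - m) \<le> (4 * A)\<^sup>2 / (1 - m) * (\<integral>x. (norm (f x))\<^sup>2 \<partial>lebesgue_on K) / (1 - m)"
      using m by (intro divide_right_mono) auto
    then have S_le: "S \<le> C * (\<integral>x. (norm (f x))\<^sup>2 \<partial>lebesgue_on K)"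
      unfolding C_def using m by simp
    have Pb: "P i \<in> borel_measurable borel" using P(1) by (simp add: sq_integrable_def)
    have Pl: "P i \<in> borel_measurable lebesgue" by (rule borel_imp_lebesgue[OF Pb])
    have "(\<integral>x. (norm (\<zeta> x *\<^sub>R g i x + pderiv_at i \<zeta> x *\<^sub>R f x))\<^sup>2 \<partial>lebesgue) = (\<integral>x. (norm (P i x))\<^sup>2 \<partial>lebesgue)"
      by (rule sq_integrable_cong_AE(2)[OF Pl _ P(2), symmetric])
         (intro sq_integrable_add test_function_times_L2_loc[OF g \<zeta>] test_function_times_L2_loc[OF f test_function_pderiv[OF \<zeta>]])
    also have "\<dots> = (\<integral>x. (norm (P i x))\<^sup>2 \<partial>lborel)" using sq_integrable_lborel_iff(2)[OF Pb] by simp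
    also have "\<dots> \<le> S" unfolding S_def by (rule member_le_sum) auto
    finally show "(\<integral>x. (norm (\<zeta> x *\<^sub>R g i x + pderiv_at i \<zeta> x *\<^sub>R f x))\<^sup>2 \<partial>lebesgue) \<le> C * (\<integral>x. (norm (f x))\<^sup>2 \<partial>lebesgue_on K)"
      using S_le by simp
  qed
qed

section \<open>Compactness of solutions\<close>

lemma l2_sum_le:
  "finite I \<Longrightarrow> (\<And>i. i \<in> I \<Longrightarrow> sq_integrable M (f i)) \<Longrightarrow> l2 M (\<lambda>x. \<Sum>i\<in>I. f i x) \<le> (\<Sum>i\<in>I. l2 M (f i))"
proof (induction I rule: finite_induct)
  case empty
  show ?case by (simp add: l2_0)
next
  case (insert j I)
  have "l2 M (\<lambda>x. f j x + (\<Sum>i\<in>I. f i x)) \<le> l2 M (f j) + l2 M (\<lambda>x. \<Sum>i\<in>I. f i x)"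
    by (intro l2_triangle sq_integrable_sum insert) auto
  then show ?case using insert by fastforce
qed

lemma l2_mono:
  assumes "sq_integrable M f" "sq_integrable M g" "\<And>x. norm (f x) \<le> norm (g x)"
  shows "l2 M f \<le> l2 M g"
  unfolding l2_def using assms by (intro real_sqrt_le_mono integral_mono power_mono) (auto simp: sq_integrable_def)

lemma l2_vec_le:
  fixes w :: "'a \<Rightarrow> real ^ 's::finite"
  assumes w: "sq_integrable M w"
  shows "l2 M w \<le> (\<Sum>S\<in>UNIV. l2 M (\<lambda>x. w x $ S))"
proof -
  have lin: "linear (\<lambda>t::real. t *\<^sub>R (axis S 1 :: real ^ 's))" for S by (simp add: linear_iff algebra_simps)
  have "w = (\<lambda>x. \<Sum>S\<in>UNIV. (w x $ S) *\<^sub>R (axis S 1 :: real ^ 's))"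
  proof
    fix x show "w x = (\<Sum>S\<in>UNIV. (w x $ S) *\<^sub>R (axis S 1 :: real ^ 's))"
      using basis_expansion[of "w x"] by (simp add: scalar_mult_eq_scaleR)
  qed
  then have "l2 M w = l2 M (\<lambda>x. \<Sum>S\<in>UNIV. (w x $ S) *\<^sub>R (axis S 1 :: real ^ 's))" by (rule arg_cong)
  also have "\<dots> \<le> (\<Sum>S\<in>UNIV. l2 M (\<lambda>x. (w x $ S) *\<^sub>R (axis S 1 :: real ^ 's)))"
    by (intro l2_sum_le sq_integrable_linear[OF lin] sq_integrable_component w) simp
  also have "\<dots> = (\<Sum>S\<in>UNIV. l2 M (\<lambda>x. w x $ S))" by (simp add: l2_def)
  finally show ?thesis .
qed

lemma l2_translation_vec:
  fixes U :: "real ^ 'n::finite \<Rightarrow> real ^ 's::finite"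
  assumes U: "sq_integrable lborel U" and P: "\<And>i. sq_integrable lborel (P i)"
    and wd: "\<And>i S. weak_deriv_L2 i (\<lambda>x. U x $ S) (\<lambda>x. P i x $ S)"
  shows "l2 lborel (\<lambda>x. U (x + a) - U x) \<le> real CARD('s) * (\<Sum>i\<in>UNIV. l2 lborel (P i)) * norm a"
proof -
  have "l2 lborel (\<lambda>x. U (x + a) - U x) \<le> (\<Sum>S\<in>UNIV. l2 lborel (\<lambda>x. (U (x + a) - U x) $ S))"
    by (intro l2_vec_le sq_integrable_diff sq_integrable_shift U)
  also have "\<dots> \<le> (\<Sum>S\<in>(UNIV::'s set). (\<Sum>i\<in>UNIV. l2 lborel (P i)) * norm a)"
  proof (rule sum_mono)
    fix S :: 's
    have "l2 lborel (\<lambda>x. (U (x + a) - U x) $ S) = l2 lborel (\<lambda>x. U (x + a) $ S - U x $ S)" by simp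
    also have "\<dots> \<le> (\<Sum>i\<in>UNIV. \<bar>a $ i\<bar> * l2 lborel (\<lambda>x. P i x $ S))" by (rule l2_translation[OF wd])
    also have "\<dots> \<le> (\<Sum>i\<in>UNIV. norm a * l2 lborel (P i))"
    proof (intro sum_mono mult_mono component_le_norm_cart)
      show "l2 lborel (\<lambda>x. P i x $ S) \<le> l2 lborel (P i)" for i
        using component_le_norm_cart[of "P i _" S] by (intro l2_mono sq_integrable_component P) simp
    qed (auto simp: l2_nonneg)
    finally show "l2 lborel (\<lambda>x. (U (x + a) - U x) $ S) \<le> (\<Sum>i\<in>UNIV. l2 lborel (P i)) * norm a"
      by (simp only: sum_distrib_right mult.commute[of "norm a"])
  qed
  also have "\<dots> = real CARD('s) * (\<Sum>i\<in>UNIV. l2 lborel (P i)) * norm a" by simp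
  finally show ?thesis .
qed

text \<open>
  The cut-off \<open>\<eta>\<close> is 1 on \<open>K\<close>. By \<open>caccioppoli\<close> the gradients of the fields \<open>\<eta>F\<^sub>j\<close> are bounded in \<open>L\<^sup>2\<close>, so
  their translations are equicontinuous and the compactness criterion applies.
\<close>

lemma dirac_bounded_L2_precompact:
  fixes F :: "nat \<Rightarrow> real ^ 'n::{finite,linorder} \<Rightarrow> 'n::{finite,linorder} ext"
  assumes "open \<Omega>" and m: "0 \<le> m" "m < 1" and F: "\<And>j. dirac_bounded \<Omega> m (F j) (G j)"
    and bd: "\<And>K. compact K \<Longrightarrow> K \<subseteq> \<Omega> \<Longrightarrow> \<exists>B. \<forall>j. (\<integral>x. (norm (F j x))\<^sup>2 \<partial>lebesgue_on K) \<le> B"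
    and K: "compact K" "K \<subseteq> \<Omega>"
  obtains r where "strict_mono (r :: nat \<Rightarrow> nat)"
    "\<And>e. e > 0 \<Longrightarrow> \<exists>N. \<forall>j\<ge>N. \<forall>k\<ge>N. (\<integral>x. (norm (F (r j) x - F (r k) x))\<^sup>2 \<partial>lebesgue_on K) < e"
proof -
  obtain \<eta> where \<eta>: "test_function \<Omega> \<eta>" "\<And>x. x \<in> K \<Longrightarrow> \<eta> x = 1"
    by (rule test_function_cutoff[OF K(1) \<open>open \<Omega>\<close> K(2)]) (rule that)
  obtain L where L: "compact L" "L \<subseteq> \<Omega>" "\<And>x. x \<notin> L \<Longrightarrow> \<eta> x = 0"
    by (rule test_function_support[OF \<eta>(1)]) (rule that)
  obtain T where T: "0 < T" "\<And>x. \<bar>\<eta> x\<bar> \<le> T" by (rule test_function_bounded[OF \<eta>(1)]) (rule that)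
  obtain C where C: "0 \<le> C" "\<And>f g i. dirac_bounded \<Omega> m f g \<Longrightarrow>
      (\<integral>x. (norm (\<eta> x *\<^sub>R g i x + pderiv_at i \<eta> x *\<^sub>R f x))\<^sup>2 \<partial>lebesgue) \<le> C * (\<integral>x. (norm (f x))\<^sup>2 \<partial>lebesgue_on L)"
    by (rule caccioppoli[OF \<open>open \<Omega>\<close> \<eta>(1) L(1,2) _ m]) (erule L(3), rule that)
  obtain B where B: "\<And>j. (\<integral>x. (norm (F j x))\<^sup>2 \<partial>lebesgue_on L) \<le> B" using bd[OF L(1,2)] by blast
  have Fl: "F j \<in> L2_loc \<Omega>" and Gl: "G j i \<in> L2_loc \<Omega>" and wp: "has_weak_partial \<Omega> i (F j) (G j i)" for j i
    using F[of j] by (auto simp: dirac_bounded_def)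
  have Ls: "L \<in> sets lebesgue" and Ks: "K \<in> sets lebesgue" using L(1) K(1) by (auto simp: borel_compact)
  define Q where "Q = real CARD('n set) * (\<Sum>i\<in>(UNIV::'n set). sqrt (C * B))"
  have "\<exists>U. sq_integrable lborel U \<and> (AE x in lebesgue. U x = \<eta> x *\<^sub>R F j x) \<and> (\<forall>x. x \<notin> L \<longrightarrow> U x = 0) \<and>
      (\<forall>a. l2 lborel (\<lambda>x. U (x + a) - U x) \<le> Q * norm a)" for j
  proof -
    obtain U P where U: "sq_integrable lborel U" "\<And>i. sq_integrable lborel (P i)"
      "AE x in lebesgue. U x = \<eta> x *\<^sub>R F j x" "\<And>x. x \<notin> L \<Longrightarrow> U x = 0"
      and P: "\<And>i. AE x in lebesgue. P i x = \<eta> x *\<^sub>R G j i x + pderiv_at i \<eta> x *\<^sub>R F j x"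
      and wd: "\<And>i S. weak_deriv_L2 i (\<lambda>x. U x $ S) (\<lambda>x. P i x $ S)"
      by (rule borel_localization[OF \<open>open \<Omega>\<close> \<eta>(1) Fl Gl wp compact_imp_closed[OF L(1)]]) (erule L(3), rule that)
    have P_le: "l2 lborel (P i) \<le> sqrt (C * B)" for i
    proof -
      have Pb: "P i \<in> borel_measurable borel" using U(2) by (simp add: sq_integrable_def)
      have "(\<integral>x. (norm (P i x))\<^sup>2 \<partial>lborel) = (\<integral>x. (norm (P i x))\<^sup>2 \<partial>lebesgue)" by (rule sq_integrable_lborel_iff(2)[OF Pb])
      also have "\<dots> = (\<integral>x. (norm (\<eta> x *\<^sub>R G j i x + pderiv_at i \<eta> x *\<^sub>R F j x))\<^sup>2 \<partial>lebesgue)"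
        by (rule sq_integrable_cong_AE(2)[OF borel_imp_lebesgue[OF Pb] _ P])
           (intro sq_integrable_add test_function_times_L2_loc[OF Gl \<eta>(1)] test_function_times_L2_loc[OF Fl test_function_pderiv[OF \<eta>(1)]])
      also have "\<dots> \<le> C * (\<integral>x. (norm (F j x))\<^sup>2 \<partial>lebesgue_on L)" by (rule C(2)[OF F])
      also have "\<dots> \<le> C * B" by (intro mult_left_mono B C(1))
      finally show ?thesis by (simp add: l2_def)
    qed
    have "l2 lborel (\<lambda>x. U (x + a) - U x) \<le> Q * norm a" for a
    proof -
      have "l2 lborel (\<lambda>x. U (x + a) - U x) \<le> real CARD('n set) * (\<Sum>i\<in>UNIV. l2 lborel (P i)) * norm a"
        by (rule l2_translation_vec[OF U(1,2) wd])
      also have "\<dots> \<le> Q * norm a" unfolding Q_def by (intro mult_right_mono mult_left_mono sum_mono P_le) auto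
      finally show ?thesis .
    qed
    then show ?thesis using U by blast
  qed
  then have "\<forall>j. \<exists>U. sq_integrable lborel U \<and> (AE x in lebesgue. U x = \<eta> x *\<^sub>R F j x) \<and> (\<forall>x. x \<notin> L \<longrightarrow> U x = 0) \<and>
      (\<forall>a. l2 lborel (\<lambda>x. U (x + a) - U x) \<le> Q * norm a)" by blast
  from choice[OF this] obtain U where U: "\<And>j. sq_integrable lborel (U j)" "\<And>j. AE x in lebesgue. U j x = \<eta> x *\<^sub>R F j x"
    "\<And>j x. x \<notin> L \<Longrightarrow> U j x = 0" "\<And>j a. l2 lborel (\<lambda>x. U j (x + a) - U j x) \<le> Q * norm a"
    by auto
  have Ub: "U j \<in> borel_measurable borel" for j using U(1)[of j] by (simp add: sq_integrable_def)
  have U_bound: "(\<integral>x. (norm (U j x))\<^sup>2 \<partial>lborel) \<le> T\<^sup>2 * B" for j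
  proof -
    have FL: "sq_integrable lebesgue (\<lambda>x. if x \<in> L then F j x else 0)"
      using L2_loc_sq_integrable[OF Fl L(1,2)] by (simp add: sq_integrable_lebesgue_on[OF Ls])
    have "(\<integral>x. (norm (U j x))\<^sup>2 \<partial>lborel) = (\<integral>x. (norm (U j x))\<^sup>2 \<partial>lebesgue)" by (rule sq_integrable_lborel_iff(2)[OF Ub])
    also have "\<dots> \<le> (\<integral>x. T\<^sup>2 * (norm (if x \<in> L then F j x else 0))\<^sup>2 \<partial>lebesgue)"
    proof (rule integral_mono_AE)
      show "integrable lebesgue (\<lambda>x. (norm (U j x))\<^sup>2)"
        using U(1)[of j] sq_integrable_lborel_iff(1)[OF Ub, of j] by (simp add: sq_integrable_def)
      show "integrable lebesgue (\<lambda>x. T\<^sup>2 * (norm (if x \<in> L then F j x else 0))\<^sup>2)" using FL by (simp add: sq_integrable_def)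
      show "AE x in lebesgue. (norm (U j x))\<^sup>2 \<le> T\<^sup>2 * (norm (if x \<in> L then F j x else 0))\<^sup>2"
        using U(2)[of j]
      proof eventually_elim
        case (elim x)
        have "norm (U j x) \<le> T * norm (if x \<in> L then F j x else 0)"
          using elim T(2)[of x] U(3)[of x j] by (auto intro!: mult_right_mono)
        then have "(norm (U j x))\<^sup>2 \<le> (T * norm (if x \<in> L then F j x else 0))\<^sup>2" by (intro power_mono) auto
        then show ?case by (simp add: power_mult_distrib)
      qed
    qed
    also have "\<dots> = T\<^sup>2 * (\<integral>x. (norm (F j x))\<^sup>2 \<partial>lebesgue_on L)" by (simp add: sq_integrable_lebesgue_on(2)[OF Ls])
    also have "\<dots> \<le> T\<^sup>2 * B" by (intro mult_left_mono B) simp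
    finally show ?thesis .
  qed
  obtain r where r: "strict_mono (r :: nat \<Rightarrow> nat)"
    "\<And>e. e > 0 \<Longrightarrow> \<exists>N. \<forall>j\<ge>N. \<forall>k\<ge>N. (\<integral>x. (norm (U (r j) x - U (r k) x))\<^sup>2 \<partial>lborel) < e"
    by (rule L2_precompact_if_equitranslatable[OF U(1) compact_imp_bounded[OF L(1)] U(3) U_bound U(4)]) (assumption, rule that)
  have le: "(\<integral>x. (norm (F j x - F k x))\<^sup>2 \<partial>lebesgue_on K) \<le> (\<integral>x. (norm (U j x - U k x))\<^sup>2 \<partial>lborel)" for j k
  proof -
    have FK: "sq_integrable lebesgue (\<lambda>x. if x \<in> K then F j x - F k x else 0)"
      using sq_integrable_diff[OF L2_loc_sq_integrable[OF Fl K, of j] L2_loc_sq_integrable[OF Fl K, of k]]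
      by (simp add: sq_integrable_lebesgue_on[OF Ks])
    have Ubd: "(\<lambda>x. U j x - U k x) \<in> borel_measurable borel" using Ub by simp
    have "(\<integral>x. (norm (F j x - F k x))\<^sup>2 \<partial>lebesgue_on K) = (\<integral>x. (norm (if x \<in> K then F j x - F k x else 0))\<^sup>2 \<partial>lebesgue)"
      by (rule sq_integrable_lebesgue_on(2)[OF Ks])
    also have "\<dots> \<le> (\<integral>x. (norm (U j x - U k x))\<^sup>2 \<partial>lebesgue)"
    proof (rule integral_mono_AE)
      show "integrable lebesgue (\<lambda>x. (norm (if x \<in> K then F j x - F k x else 0))\<^sup>2)" using FK by (simp add: sq_integrable_def)
      show "integrable lebesgue (\<lambda>x. (norm (U j x - U k x))\<^sup>2)"
        using sq_integrable_diff[OF U(1) U(1)] sq_integrable_lborel_iff(1)[OF Ubd] by (simp add: sq_integrable_def)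
      show "AE x in lebesgue. (norm (if x \<in> K then F j x - F k x else 0))\<^sup>2 \<le> (norm (U j x - U k x))\<^sup>2"
        using U(2)[of j] U(2)[of k] by eventually_elim (auto simp: \<eta>(2))
    qed
    also have "\<dots> = (\<integral>x. (norm (U j x - U k x))\<^sup>2 \<partial>lborel)" by (rule sq_integrable_lborel_iff(2)[OF Ubd, symmetric])
    finally show ?thesis .
  qed
  have "\<exists>N. \<forall>j\<ge>N. \<forall>k\<ge>N. (\<integral>x. (norm (F (r j) x - F (r k) x))\<^sup>2 \<partial>lebesgue_on K) < e" if "e > 0" for e
    using r(2)[OF that] le by (meson le_less_trans)
  then show ?thesis using that r(1) by blast
qed

text \<open>
  The cut-off in \<open>caccioppoli\<close> is 1 on the open set \<open>U\<close>, so there the gradient of \<open>\<zeta>f\<close> is the gradient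
  of \<open>f\<close>.
\<close>

lemma dirac_bounded_gradient_estimate:
  fixes \<Omega> :: "(real ^ 'n::{finite,linorder}) set"
  assumes "open \<Omega>" and m: "0 \<le> m" "m < 1" and U: "open U" "compact (closure U)" "closure U \<subseteq> \<Omega>"
  obtains K C where "compact K" "K \<subseteq> \<Omega>" "closure U \<subseteq> K" "0 \<le> C"
    "\<And>f g i. dirac_bounded \<Omega> m f g \<Longrightarrow>
      (\<integral>x. (norm (g i x))\<^sup>2 \<partial>lebesgue_on U) \<le> C * (\<integral>x. (norm (f x))\<^sup>2 \<partial>lebesgue_on K)"
proof -
  obtain \<zeta> where \<zeta>: "test_function \<Omega> \<zeta>" "\<And>x. x \<in> closure U \<Longrightarrow> \<zeta> x = 1"
    by (rule test_function_cutoff[OF U(2) \<open>open \<Omega>\<close> U(3)]) (rule that)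
  obtain K where K: "compact K" "K \<subseteq> \<Omega>" "\<And>x. x \<notin> K \<Longrightarrow> \<zeta> x = 0"
    by (rule test_function_support[OF \<zeta>(1)]) (rule that)
  obtain C where C: "0 \<le> C" "\<And>f g i. dirac_bounded \<Omega> m f g \<Longrightarrow>
      (\<integral>x. (norm (\<zeta> x *\<^sub>R g i x + pderiv_at i \<zeta> x *\<^sub>R f x))\<^sup>2 \<partial>lebesgue) \<le> C * (\<integral>x. (norm (f x))\<^sup>2 \<partial>lebesgue_on K)"
    by (rule caccioppoli[OF \<open>open \<Omega>\<close> \<zeta>(1) K(1,2) _ m]) (erule K(3), rule that)
  have Us: "U \<in> sets lebesgue" using U(1) by simp
  have U1: "\<zeta> x = 1" if "x \<in> U" for x using \<zeta>(2) closure_subset that by blast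
  have U0: "pderiv_at i \<zeta> x = 0" if "x \<in> U" for x i
  proof -
    have "(\<zeta> has_derivative (\<lambda>v. 0)) (at x)"
      by (rule has_derivative_transform_within_open[of "\<lambda>x. 1" _ _ _ U]) (use that U(1) U1 in auto)
    then show ?thesis using frechet_derivative_at by metis
  qed
  show ?thesis
  proof
    show "closure U \<subseteq> K" using \<zeta>(2) K(3) by force
    fix f :: "real ^ 'n::{finite,linorder} \<Rightarrow> 'n::{finite,linorder} ext" and g i
    assume Q: "dirac_bounded \<Omega> m f g"
    then have f: "f \<in> L2_loc \<Omega>" and g: "g i \<in> L2_loc \<Omega>" by (auto simp: dirac_bounded_def)
    have s: "sq_integrable lebesgue (\<lambda>x. \<zeta> x *\<^sub>R g i x + pderiv_at i \<zeta> x *\<^sub>R f x)"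
      by (intro sq_integrable_add test_function_times_L2_loc[OF g \<zeta>(1)] test_function_times_L2_loc[OF f test_function_pderiv[OF \<zeta>(1)]])
    have gU: "sq_integrable (lebesgue_on U) (g i)"
      using sq_integrable_lebesgue_on_subset(1)[OF L2_loc_sq_integrable[OF g U(2,3)] Us _ closure_subset] by (simp add: borel_compact U(2))
    have "(\<integral>x. (norm (g i x))\<^sup>2 \<partial>lebesgue_on U) = (\<integral>x. (norm (if x \<in> U then g i x else 0))\<^sup>2 \<partial>lebesgue)"
      by (rule sq_integrable_lebesgue_on(2)[OF Us])
    also have "\<dots> \<le> (\<integral>x. (norm (\<zeta> x *\<^sub>R g i x + pderiv_at i \<zeta> x *\<^sub>R f x))\<^sup>2 \<partial>lebesgue)"
    proof (rule integral_mono)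
      show "integrable lebesgue (\<lambda>x. (norm (if x \<in> U then g i x else 0))\<^sup>2)"
        using gU[unfolded sq_integrable_lebesgue_on(1)[OF Us]] by (simp add: sq_integrable_def)
      show "integrable lebesgue (\<lambda>x. (norm (\<zeta> x *\<^sub>R g i x + pderiv_at i \<zeta> x *\<^sub>R f x))\<^sup>2)"
        using s by (simp add: sq_integrable_def)
    qed (auto simp: U0 U1)
    also have "\<dots> \<le> C * (\<integral>x. (norm (f x))\<^sup>2 \<partial>lebesgue_on K)" by (rule C(2)[OF Q])
    finally show "(\<integral>x. (norm (g i x))\<^sup>2 \<partial>lebesgue_on U) \<le> C * (\<integral>x. (norm (f x))\<^sup>2 \<partial>lebesgue_on K)" .
  qed (fact K(1) K(2) C(1))+
qed

lemma sq_integrable_imp_loc_integrable: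
  fixes f :: "real ^ 'n::finite \<Rightarrow> 'b::euclidean_space"
  assumes f: "sq_integrable (lebesgue_on U) f" and U: "U \<in> sets lebesgue" and K: "compact K" "K \<subseteq> U"
  shows "integrable (lebesgue_on K) f"
proof -
  have Ks: "K \<in> sets lebesgue" using K(1) by (simp add: borel_compact)
  have s: "sq_integrable lebesgue (\<lambda>x. if x \<in> K then f x else 0)"
    using sq_integrable_lebesgue_on_subset(1)[OF f Ks U K(2)] by (simp add: sq_integrable_lebesgue_on[OF Ks])
  have "emeasure lebesgue K < \<infinity>" using lmeasurable_compact[OF K(1)] by (auto simp only: fmeasurable_def)
  then have "integrable lebesgue (\<lambda>x. indicator K x *\<^sub>R (if x \<in> K then f x else 0))"
    by (rule sq_integrable_imp_integrable_on(1)[OF s Ks])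
  also have "(\<lambda>x. indicator K x *\<^sub>R (if x \<in> K then f x else 0)) = (\<lambda>x. if x \<in> K then f x else 0)"
    by (auto simp: indicator_def)
  finally show ?thesis by (simp add: Lebesgue_Measure.integrable_restrict_UNIV[OF Ks])
qed

lemma integral_scaleR_tendsto:
  fixes f :: "nat \<Rightarrow> 'a \<Rightarrow> 'b::euclidean_space"
  assumes \<phi>: "sq_integrable M (\<phi> :: 'a \<Rightarrow> real)" and f: "\<And>n. sq_integrable M (f n)" and h: "sq_integrable M h"
    and int: "\<And>k :: 'a \<Rightarrow> 'b. sq_integrable M k \<Longrightarrow> integrable M (\<lambda>x. \<phi> x *\<^sub>R k x)"
    and lim: "(\<lambda>n. \<integral>x. (norm (f n x - h x))\<^sup>2 \<partial>M) \<longlonglongrightarrow> 0"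
  shows "(\<lambda>n. \<integral>x. \<phi> x *\<^sub>R f n x \<partial>M) \<longlonglongrightarrow> (\<integral>x. \<phi> x *\<^sub>R h x \<partial>M)"
proof -
  have bound: "norm ((\<integral>x. \<phi> x *\<^sub>R f n x \<partial>M) - (\<integral>x. \<phi> x *\<^sub>R h x \<partial>M)) \<le> l2 M \<phi> * l2 M (\<lambda>x. f n x - h x)" for n
  proof -
    note d = sq_integrable_diff[OF f[of n] h]
    have n\<phi>: "sq_integrable M (\<lambda>x. \<bar>\<phi> x\<bar>)" and nd: "sq_integrable M (\<lambda>x. norm (f n x - h x))"
      using \<phi> d by (auto simp: sq_integrable_def)
    have "(\<integral>x. \<phi> x *\<^sub>R f n x \<partial>M) - (\<integral>x. \<phi> x *\<^sub>R h x \<partial>M) = (\<integral>x. \<phi> x *\<^sub>R (f n x - h x) \<partial>M)"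
      unfolding scaleR_diff_right by (intro Bochner_Integration.integral_diff[symmetric] int f h)
    also have "norm \<dots> \<le> (\<integral>x. norm (\<phi> x *\<^sub>R (f n x - h x)) \<partial>M)" by (rule integral_norm_bound)
    also have "\<dots> = (\<integral>x. \<bar>\<phi> x\<bar> * norm (f n x - h x) \<partial>M)" by simp
    also have "\<dots> \<le> l2 M (\<lambda>x. \<bar>\<phi> x\<bar>) * l2 M (\<lambda>x. norm (f n x - h x))"
      using l2_Cauchy_Schwarz[OF n\<phi> nd] by linarith
    also have "\<dots> = l2 M \<phi> * l2 M (\<lambda>x. f n x - h x)" by (simp add: l2_def)
    finally show ?thesis .
  qed
  have null: "(\<lambda>n. l2 M \<phi> * l2 M (\<lambda>x. f n x - h x)) \<longlonglongrightarrow> 0"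
  proof -
    have "(\<lambda>n. l2 M (\<lambda>x. f n x - h x)) \<longlonglongrightarrow> 0"
      unfolding l2_def using tendsto_real_sqrt[OF lim] by (simp only: real_sqrt_zero)
    then show ?thesis by (rule tendsto_mult_right_zero)
  qed
  have "(\<lambda>n. (\<integral>x. \<phi> x *\<^sub>R f n x \<partial>M) - (\<integral>x. \<phi> x *\<^sub>R h x \<partial>M)) \<longlonglongrightarrow> 0"
    by (rule Lim_null_comparison[OF always_eventually[OF allI[OF bound]] null])
  then show ?thesis by (simp add: LIM_zero_iff)
qed

lemma has_weak_partial_limit:
  fixes f :: "nat \<Rightarrow> real ^ 'n::finite \<Rightarrow> 'b::euclidean_space"
  assumes "open U" and wp: "\<And>n. has_weak_partial U i (f n) (g n)"
    and s: "\<And>n. sq_integrable (lebesgue_on U) (f n)" "\<And>n. sq_integrable (lebesgue_on U) (g n)"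
      "sq_integrable (lebesgue_on U) f'" "sq_integrable (lebesgue_on U) g'"
    and lim: "(\<lambda>n. \<integral>x. (norm (f n x - f' x))\<^sup>2 \<partial>lebesgue_on U) \<longlonglongrightarrow> 0"
      "(\<lambda>n. \<integral>x. (norm (g n x - g' x))\<^sup>2 \<partial>lebesgue_on U) \<longlonglongrightarrow> 0"
  shows "has_weak_partial U i f' g'"
  unfolding has_weak_partial_def
proof (intro conjI allI impI)
  have Us: "U \<in> sets lebesgue" using \<open>open U\<close> by simp
  show "integrable (lebesgue_on K) f'" "integrable (lebesgue_on K) g'" if "compact K \<and> K \<subseteq> U" for K
    using that by (auto intro: sq_integrable_imp_loc_integrable[OF s(3) Us] sq_integrable_imp_loc_integrable[OF s(4) Us])
  fix \<phi> assume \<phi>: "test_function U \<phi>"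
  have sq: "sq_integrable (lebesgue_on U) \<psi>" if "test_function U \<psi>" for \<psi>
    using sq_integrable_lebesgue_on_subset(1)[of UNIV \<psi> U] test_function_lebesgue_sq_integrable[OF that] Us
    by (simp add: lebesgue_on_UNIV_eq)
  have int: "integrable (lebesgue_on U) (\<lambda>x. \<psi> x *\<^sub>R k x)"
    if "test_function U \<psi>" "sq_integrable (lebesgue_on U) k" for \<psi> and k :: "real ^ 'n \<Rightarrow> 'b"
    by (rule test_function_times_loc_integrable[OF \<open>open U\<close> _ that(1)])
       (rule sq_integrable_imp_loc_integrable[OF that(2) Us])
  have lim1: "(\<lambda>n. \<integral>x. pderiv_at i \<phi> x *\<^sub>R f n x \<partial>lebesgue_on U) \<longlonglongrightarrow> (\<integral>x. pderiv_at i \<phi> x *\<^sub>R f' x \<partial>lebesgue_on U)"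
    using test_function_pderiv[OF \<phi>] by (intro integral_scaleR_tendsto sq s lim int)
  have eq: "(\<lambda>n. \<integral>x. pderiv_at i \<phi> x *\<^sub>R f n x \<partial>lebesgue_on U) = (\<lambda>n. - (\<integral>x. \<phi> x *\<^sub>R g n x \<partial>lebesgue_on U))"
    using wp \<phi> by (simp add: has_weak_partial_def)
  have lim2: "(\<lambda>n. - (\<integral>x. \<phi> x *\<^sub>R g n x \<partial>lebesgue_on U)) \<longlonglongrightarrow> - (\<integral>x. \<phi> x *\<^sub>R g' x \<partial>lebesgue_on U)"
    using \<phi> by (intro tendsto_minus integral_scaleR_tendsto sq s lim int)
  show "(\<integral>x. pderiv_at i \<phi> x *\<^sub>R f' x \<partial>lebesgue_on U) = - (\<integral>x. \<phi> x *\<^sub>R g' x \<partial>lebesgue_on U)"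
    by (rule LIMSEQ_unique[OF lim1[unfolded eq] lim2])
qed

lemma dirac_operators_AE:
  assumes "\<And>i. AE x in M. weak_partial \<Omega> i f x = g i x"
  shows "AE x in M. dirac_minus \<Omega> f x = ext_div (\<lambda>i. g i x) - int_div (\<lambda>i. g i x) \<and>
    dirac_plus \<Omega> f x = ext_div (\<lambda>i. g i x) + int_div (\<lambda>i. g i x)"
proof -
  have "AE x in M. \<forall>i\<in>UNIV. weak_partial \<Omega> i f x = g i x"
    by (subst AE_ball_countable) (auto intro: countable_finite assms)
  then show ?thesis
    by eventually_elim (simp add: dirac_minus_def dirac_plus_def ext_deriv_def int_deriv_def ext_div_def int_div_def)
qed

text \<open>
  The function \<open>f\<close> is meant to be a weak partial derivative, whose measurability on \<open>U\<close> follows from the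
  completeness of Lebesgue measure.
\<close>

lemma L2_norm_cong_AE:
  fixes f :: "real ^ 'n::finite \<Rightarrow> 'b::euclidean_space"
  assumes U: "open U" and g: "sq_integrable (lebesgue_on U) g" and AE: "AE x in lebesgue_on U. f x = g x"
  shows "(L2_norm U f)\<^sup>2 = (\<integral>x. (norm (g x))\<^sup>2 \<partial>lebesgue_on U)"
proof -
  have Us: "U \<in> sets lebesgue" using U by simp
  have gm: "(\<lambda>x. if x \<in> U then g x else 0) \<in> borel_measurable lebesgue"
    using g[unfolded sq_integrable_lebesgue_on(1)[OF Us]] by (simp add: sq_integrable_def)
  have "AE x in lebesgue. (if x \<in> U then g x else 0) = (if x \<in> U then f x else 0)"
    using AE Us by (simp add: AE_restrict_space_iff) (auto elim: eventually_mono)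
  from borel_measurable_AE[OF gm this] have "f \<in> borel_measurable (lebesgue_on U)"
    by (simp add: borel_measurable_if[OF Us])
  from sq_integrable_cong_AE(2)[OF this g AE] show ?thesis by (simp add: L2_norm_def)
qed

theorem theorem0p3:
  fixes \<Omega> :: "(real ^ 'n::{finite,linorder}) set"
    and M :: "real ^ 'n::{finite,linorder} \<Rightarrow> 'n ext \<Rightarrow>\<^sub>L 'n ext"
    and F :: "nat \<Rightarrow> real ^ 'n::{finite,linorder} \<Rightarrow> 'n ext"
  assumes "open \<Omega>" and "connected \<Omega>" and "bounded \<Omega>"
    and "M \<in> Linf \<Omega>"
    and "esssup (lebesgue_on \<Omega>) (\<lambda>x. ereal (norm (M x))) < 1"
    and "\<And>j. F j \<in> W12_loc \<Omega>"
    and "\<And>j. beltrami_solution \<Omega> M (F j)"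
    and "locally_bounded_L2 \<Omega> F"
  shows "\<forall>U. open U \<and> smooth_boundary U \<and> U \<Subset> \<Omega> \<longrightarrow>
    (\<exists>(r :: nat \<Rightarrow> nat) F\<^sub>U. strict_mono r \<and> F\<^sub>U \<in> W12 U \<and>
       tendsto_W12 U (\<lambda>k. F (r k)) F\<^sub>U \<and> beltrami_solution U M F\<^sub>U)"
proof (intro allI impI)
  fix U assume "open U \<and> smooth_boundary U \<and> U \<Subset> \<Omega>"
  then have U: "open U" "compact (closure U)" "closure U \<subseteq> \<Omega>" by (auto simp: relatively_compact_in_def)
  have U\<Omega>: "U \<subseteq> \<Omega>" using U(3) closure_subset by blast
  have Us: "U \<in> sets lebesgue" and \<Omega>s: "\<Omega> \<in> sets lebesgue" using U(1) assms(1) by auto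
  obtain q where q: "esssup (lebesgue_on \<Omega>) (\<lambda>x. ereal (norm (M x))) < ereal q" "ereal q < 1"
    using ereal_dense2[OF assms(5)] by auto
  (* If Omega is empty, the essential supremum is minus infinity and q may be negative. *)
  define m where "m = max 0 q"
  have m: "0 \<le> m" "m < 1" using q(2) by (auto simp: m_def one_ereal_def)
  have AE_M: "AE x in lebesgue_on \<Omega>. norm (M x) \<le> m"
    using esssup_AE[where M = "lebesgue_on \<Omega>" and f = "\<lambda>x. ereal (norm (M x))"]
  proof eventually_elim
    case (elim x)
    then have "ereal (norm (M x)) < ereal q" using q(1) by (rule le_less_trans)
    then show ?case by (simp add: m_def)
  qed
  have Fl: "F j \<in> L2_loc \<Omega>" for j using assms(6)[of j] by (simp add: W12_loc_def)
  have "\<forall>p. \<exists>g. g \<in> L2_loc \<Omega> \<and> has_weak_partial \<Omega> (snd p) (F (fst p)) g"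
    using assms(6) by (auto simp: W12_loc_def)
  from choice[OF this] obtain G0
    where G0': "\<forall>p. G0 p \<in> L2_loc \<Omega> \<and> has_weak_partial \<Omega> (snd p) (F (fst p)) (G0 p)" ..
  note G0 = G0'[rule_format, THEN conjunct1] G0'[rule_format, THEN conjunct2]
  define G where "G j i = G0 (j, i)" for j i
  have Gl: "G j i \<in> L2_loc \<Omega>" and wp: "has_weak_partial \<Omega> i (F j) (G j i)" for j i
    using G0(1)[of "(j, i)"] G0(2)[of "(j, i)"] by (auto simp: G_def)
  define Dm where "Dm p = ext_div p - int_div p" for p :: "'n::{finite,linorder} \<Rightarrow> 'n::{finite,linorder} ext"
  define Dp where "Dp p = ext_div p + int_div p" for p :: "'n::{finite,linorder} \<Rightarrow> 'n::{finite,linorder} ext"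
  have eq: "AE x in lebesgue_on \<Omega>. Dm (\<lambda>i. G j i x) = M x (Dp (\<lambda>i. G j i x))" for j
    using assms(7)[of j, unfolded beltrami_solution_def] dirac_operators_AE[OF weak_partial_AE_eq[OF assms(1) wp], of j]
    unfolding Dm_def Dp_def by eventually_elim simp
  have D_diff: "Dm (\<lambda>i. p i - r i) = Dm p - Dm r" "Dp (\<lambda>i. p i - r i) = Dp p - Dp r" for p r
    by (simp_all add: Dm_def Dp_def ext_div_diff int_div_diff)
  have L2_loc_diff: "(\<lambda>x. f x - g x) \<in> L2_loc \<Omega>" if "f \<in> L2_loc \<Omega>" "g \<in> L2_loc \<Omega>" for f g :: "real ^ 'n::{finite,linorder} \<Rightarrow> 'n::{finite,linorder} ext"
    using that by (auto simp: L2_loc_def L2_iff intro: sq_integrable_diff)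
  have bd_single: "dirac_bounded \<Omega> m (F j) (G j)" for j
    unfolding dirac_bounded_def Dm_def[symmetric] Dp_def[symmetric]
  proof (intro conjI allI Fl Gl wp)
    show "AE x in lebesgue_on \<Omega>. norm (Dm (\<lambda>i. G j i x)) \<le> m * norm (Dp (\<lambda>i. G j i x))"
      using eq[of j] AE_M
    proof eventually_elim
      case (elim x)
      have "norm (M x (Dp (\<lambda>i. G j i x))) \<le> norm (M x) * norm (Dp (\<lambda>i. G j i x))" by (rule norm_blinfun)
      also have "\<dots> \<le> m * norm (Dp (\<lambda>i. G j i x))" by (intro mult_right_mono elim) simp
      finally show ?case using elim(1) by simp
    qed
  qed
  have bd_diff: "dirac_bounded \<Omega> m (\<lambda>x. F j x - F k x) (\<lambda>i x. G j i x - G k i x)" for j k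
    unfolding dirac_bounded_def Dm_def[symmetric] Dp_def[symmetric]
  proof (intro conjI allI L2_loc_diff Fl Gl has_weak_partial_diff[OF assms(1)] wp)
    show "AE x in lebesgue_on \<Omega>. norm (Dm (\<lambda>i. G j i x - G k i x)) \<le> m * norm (Dp (\<lambda>i. G j i x - G k i x))"
      using eq[of j] eq[of k] AE_M
    proof eventually_elim
      case (elim x)
      have "norm (M x (Dp (\<lambda>i. G j i x - G k i x))) \<le> norm (M x) * norm (Dp (\<lambda>i. G j i x - G k i x))" by (rule norm_blinfun)
      also have "\<dots> \<le> m * norm (Dp (\<lambda>i. G j i x - G k i x))" by (intro mult_right_mono elim) simp
      finally show ?case using elim(1,2) by (simp add: D_diff blinfun.diff_right)
    qed
  qed
  obtain K C where K: "compact K" "K \<subseteq> \<Omega>" "closure U \<subseteq> K" "0 \<le> C"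
    and grad: "\<And>f g i. dirac_bounded \<Omega> m f g \<Longrightarrow>
      (\<integral>x. (norm (g i x))\<^sup>2 \<partial>lebesgue_on U) \<le> C * (\<integral>x. (norm (f x))\<^sup>2 \<partial>lebesgue_on K)"
    by (rule dirac_bounded_gradient_estimate[OF assms(1) m U]) (rule that)
  have Ks: "K \<in> sets lebesgue" and UK: "U \<subseteq> K" using K(1,3) closure_subset[of U] by (auto simp: borel_compact)
  have bd: "\<exists>B. \<forall>j. (\<integral>x. (norm (F j x))\<^sup>2 \<partial>lebesgue_on L) \<le> B" if "compact L" "L \<subseteq> \<Omega>" for L
  proof -
    have "bdd_above (range (\<lambda>j. L2_norm L (F j)))" using assms(8) that by (simp add: locally_bounded_L2_def)
    then obtain b where "\<forall>y\<in>range (\<lambda>j. L2_norm L (F j)). y \<le> b" unfolding bdd_above_def ..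
    then have b: "L2_norm L (F j) \<le> b" for j by simp
    have "(\<integral>x. (norm (F j x))\<^sup>2 \<partial>lebesgue_on L) \<le> b\<^sup>2" for j
    proof -
      have "(\<integral>x. (norm (F j x))\<^sup>2 \<partial>lebesgue_on L) = (L2_norm L (F j))\<^sup>2" by (simp add: L2_norm_def)
      also have "\<dots> \<le> b\<^sup>2" by (intro power_mono b) (simp add: L2_norm_def)
      finally show ?thesis .
    qed
    then show ?thesis by blast
  qed
  obtain r where r: "strict_mono (r :: nat \<Rightarrow> nat)"
    "\<And>e. e > 0 \<Longrightarrow> \<exists>N. \<forall>j\<ge>N. \<forall>k\<ge>N. (\<integral>x. (norm (F (r j) x - F (r k) x))\<^sup>2 \<partial>lebesgue_on K) < e"
    by (rule dirac_bounded_L2_precompact[OF assms(1) m bd_single _ K(1,2)]) (erule (1) bd, rule that)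

  have sub: "sq_integrable (lebesgue_on U) f" if "f \<in> L2_loc \<Omega>" for f :: "real ^ 'n::{finite,linorder} \<Rightarrow> 'n::{finite,linorder} ext"
    by (rule sq_integrable_lebesgue_on_subset(1)[OF L2_loc_sq_integrable[OF that K(1,2)] Us Ks UK])
  (* A field and its gradient form one vector valued function, so that a single application of
     completeness provides both limits and a common subsequence converging almost everywhere. *)
  define H where "H k x = (F (r k) x, \<chi> i. G (r k) i x)" for k x
  have lin: "linear (\<lambda>v. (v, 0))" "linear (\<lambda>v. (0, axis i v))"
    "linear (fst :: 'n::{finite,linorder} ext \<times> ('n::{finite,linorder} ext ^ 'n::{finite,linorder}) \<Rightarrow> _)" "linear (\<lambda>p :: 'n::{finite,linorder} ext \<times> ('n::{finite,linorder} ext ^ 'n::{finite,linorder}). snd p $ i)" for i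
    by (auto simp: linear_iff axis_def vec_eq_iff)
  have H: "sq_integrable (lebesgue_on U) (H k)" for k
  proof -
    have "H k = (\<lambda>x. (F (r k) x, 0) + (\<Sum>i\<in>UNIV. (0, axis i (G (r k) i x))))"
    proof
      fix x
      have "(\<Sum>i\<in>UNIV. axis i (G (r k) i x)) = (\<chi> i. G (r k) i x)"
        by (simp add: vec_eq_iff axis_def if_distrib[of "\<lambda>v. v $ _"] cong: if_cong)
      then show "H k x = (F (r k) x, 0) + (\<Sum>i\<in>UNIV. (0, axis i (G (r k) i x)))"
        by (simp add: H_def sum_prod)
    qed
    then show ?thesis
      by (simp only:) (intro sq_integrable_add sq_integrable_sum sq_integrable_linear[OF lin(1)] sq_integrable_linear[OF lin(2)] sub Fl Gl)
  qed
  have normH: "(norm (p :: 'n::{finite,linorder} ext \<times> ('n::{finite,linorder} ext ^ 'n::{finite,linorder})))\<^sup>2 = (norm (fst p))\<^sup>2 + (\<Sum>i\<in>UNIV. (norm (snd p $ i))\<^sup>2)" for p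
    by (cases p) (simp add: norm_Pair norm_vec_def L2_set_def sum_nonneg)
  have norm_int: "(\<integral>x. (norm (h x))\<^sup>2 \<partial>lebesgue_on U) =
      (\<integral>x. (norm (fst (h x)))\<^sup>2 \<partial>lebesgue_on U) + (\<Sum>i\<in>UNIV. \<integral>x. (norm (snd (h x) $ i))\<^sup>2 \<partial>lebesgue_on U)"
    if "sq_integrable (lebesgue_on U) h" for h :: "real ^ 'n::{finite,linorder} \<Rightarrow> 'n::{finite,linorder} ext \<times> ('n::{finite,linorder} ext ^ 'n::{finite,linorder})"
    using sq_integrable_norm_sq[OF sq_integrable_linear[OF lin(3) that]] sq_integrable_norm_sq[OF sq_integrable_linear[OF lin(4) that]]
    unfolding normH by (simp add: Bochner_Integration.integral_add Bochner_Integration.integral_sum Bochner_Integration.integrable_sum)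
  (* The energy estimate for differences of solutions bounds the gradient part. *)
  have H_Cauchy: "\<exists>N. \<forall>j\<ge>N. \<forall>k\<ge>N. (\<integral>x. (norm (H j x - H k x))\<^sup>2 \<partial>lebesgue_on U) < e" if "0 < e" for e
  proof -
    define A where "A = 1 + real CARD('n) * C"
    have A: "0 < A" using K(4) by (simp add: A_def add_pos_nonneg)
    have le: "(\<integral>x. (norm (H j x - H k x))\<^sup>2 \<partial>lebesgue_on U) \<le> A * (\<integral>x. (norm (F (r j) x - F (r k) x))\<^sup>2 \<partial>lebesgue_on K)" for j k
    proof -
      define X where "X = (\<integral>x. (norm (F (r j) x - F (r k) x))\<^sup>2 \<partial>lebesgue_on K)"
      have "(\<integral>x. (norm (H j x - H k x))\<^sup>2 \<partial>lebesgue_on U) =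
        (\<integral>x. (norm (F (r j) x - F (r k) x))\<^sup>2 \<partial>lebesgue_on U) + (\<Sum>i\<in>UNIV. \<integral>x. (norm (G (r j) i x - G (r k) i x))\<^sup>2 \<partial>lebesgue_on U)"
        using norm_int[OF sq_integrable_diff[OF H H]] by (simp add: H_def)
      also have "\<dots> \<le> X + (\<Sum>i\<in>(UNIV::'n set). C * X)"
        unfolding X_def
      proof (intro add_mono sum_mono)
        show "(\<integral>x. (norm (F (r j) x - F (r k) x))\<^sup>2 \<partial>lebesgue_on U) \<le> (\<integral>x. (norm (F (r j) x - F (r k) x))\<^sup>2 \<partial>lebesgue_on K)"
          by (rule sq_integrable_lebesgue_on_subset(2)[OF L2_loc_sq_integrable[OF L2_loc_diff[OF Fl Fl] K(1,2)] Us Ks UK])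
        show "(\<integral>x. (norm (G (r j) i x - G (r k) i x))\<^sup>2 \<partial>lebesgue_on U) \<le> C * (\<integral>x. (norm (F (r j) x - F (r k) x))\<^sup>2 \<partial>lebesgue_on K)" for i
          by (rule grad[OF bd_diff])
      qed
      finally show ?thesis by (simp add: A_def X_def algebra_simps)
    qed
    have "0 < e / A" using A that by simp
    from r(2)[OF this] obtain N
      where N: "\<forall>j\<ge>N. \<forall>k\<ge>N. (\<integral>x. (norm (F (r j) x - F (r k) x))\<^sup>2 \<partial>lebesgue_on K) < e / A" ..
    have "(\<integral>x. (norm (H j x - H k x))\<^sup>2 \<partial>lebesgue_on U) < e" if "j \<ge> N" "k \<ge> N" for j k
    proof -
      have "A * (\<integral>x. (norm (F (r j) x - F (r k) x))\<^sup>2 \<partial>lebesgue_on K) < A * (e / A)"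
        by (intro mult_strict_left_mono N[rule_format] that A)
      then show ?thesis using le[of j k] A by simp
    qed
    then show ?thesis by blast
  qed
  obtain h s where h: "sq_integrable (lebesgue_on U) h" "strict_mono (s :: nat \<Rightarrow> nat)"
    "AE x in lebesgue_on U. (\<lambda>n. H (s n) x) \<longlonglongrightarrow> h x"
    "(\<lambda>n. \<integral>x. (norm (H n x - h x))\<^sup>2 \<partial>lebesgue_on U) \<longlonglongrightarrow> 0"
    by (rule L2_complete[OF H H_Cauchy])
  define FU where "FU x = fst (h x)" for x
  define GU where "GU i x = snd (h x) $ i" for i x
  have FU: "sq_integrable (lebesgue_on U) FU" and GU: "sq_integrable (lebesgue_on U) (GU i)" for i
    unfolding FU_def[abs_def] GU_def[abs_def] using sq_integrable_linear[OF lin(3) h(1)] sq_integrable_linear[OF lin(4) h(1)] by auto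
  have H_int: "(\<integral>x. (norm (H n x - h x))\<^sup>2 \<partial>lebesgue_on U) =
      (\<integral>x. (norm (F (r n) x - FU x))\<^sup>2 \<partial>lebesgue_on U) + (\<Sum>i\<in>UNIV. \<integral>x. (norm (G (r n) i x - GU i x))\<^sup>2 \<partial>lebesgue_on U)" for n
    using norm_int[OF sq_integrable_diff[OF H h(1)]] by (simp add: H_def FU_def GU_def)
  have lim_F: "(\<lambda>n. \<integral>x. (norm (F (r n) x - FU x))\<^sup>2 \<partial>lebesgue_on U) \<longlonglongrightarrow> 0"
    by (rule tendsto_sandwich[OF _ _ tendsto_const h(4)]) (auto simp: H_int intro!: always_eventually sum_nonneg)
  have lim_G: "(\<lambda>n. \<integral>x. (norm (G (r n) i x - GU i x))\<^sup>2 \<partial>lebesgue_on U) \<longlonglongrightarrow> 0" for i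
  proof (rule tendsto_sandwich[OF _ _ tendsto_const h(4)])
    have "(\<integral>x. (norm (G (r n) i x - GU i x))\<^sup>2 \<partial>lebesgue_on U) \<le> (\<Sum>i\<in>UNIV. \<integral>x. (norm (G (r n) i x - GU i x))\<^sup>2 \<partial>lebesgue_on U)" for n
      by (rule member_le_sum) auto
    then show "\<forall>\<^sub>F n in sequentially. (\<integral>x. (norm (G (r n) i x - GU i x))\<^sup>2 \<partial>lebesgue_on U) \<le> (\<integral>x. (norm (H n x - h x))\<^sup>2 \<partial>lebesgue_on U)"
      unfolding H_int by (intro always_eventually allI add_increasing) auto
  qed auto
  have wpU: "has_weak_partial U i (F (r n)) (G (r n) i)" for n i
    by (rule has_weak_partial_subset[OF wp assms(1) U(1) U\<Omega>])
  have wpFU: "has_weak_partial U i FU (GU i)" for i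
    by (rule has_weak_partial_limit[OF U(1) wpU sub[OF Fl] sub[OF Gl] FU GU lim_F lim_G])
  have W12I: "f \<in> W12 U" if "sq_integrable (lebesgue_on U) f" "\<And>i. sq_integrable (lebesgue_on U) (g i)"
    "\<And>i. has_weak_partial U i f (g i)" for f g
    unfolding W12_def mem_Collect_eq
  proof (intro conjI allI)
    show "f \<in> L2 U" using that(1) by (simp add: L2_iff)
    show "\<exists>g\<in>L2 U. has_weak_partial U i f g" for i
      by (rule bexI[where x = "g i"]) (simp_all add: L2_iff that)
  qed
  have W12_FU: "FU \<in> W12 U" by (rule W12I[OF FU GU wpFU])
  have W12_F: "F (r k) \<in> W12 U" for k by (rule W12I[OF sub[OF Fl] sub[OF Gl] wpU])
  have norm_eq: "W12_norm U (\<lambda>x. F (r k) x - FU x) = sqrt (\<integral>x. (norm (H k x - h x))\<^sup>2 \<partial>lebesgue_on U)" for k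
  proof -
    have "(L2_norm U (weak_partial U i (\<lambda>x. F (r k) x - FU x)))\<^sup>2 = (\<integral>x. (norm (G (r k) i x - GU i x))\<^sup>2 \<partial>lebesgue_on U)" for i
      by (rule L2_norm_cong_AE[OF U(1) sq_integrable_diff[OF sub[OF Gl] GU]])
         (rule weak_partial_AE_eq[OF U(1) has_weak_partial_diff[OF U(1) wpU wpFU]])
    moreover have "(L2_norm U (\<lambda>x. F (r k) x - FU x))\<^sup>2 = (\<integral>x. (norm (F (r k) x - FU x))\<^sup>2 \<partial>lebesgue_on U)"
      by (simp add: L2_norm_def)
    ultimately show ?thesis unfolding W12_norm_def H_int by simp
  qed
  have "(\<lambda>k. W12_norm U (\<lambda>x. F (r k) x - FU x)) \<longlonglongrightarrow> 0"
    unfolding norm_eq using tendsto_real_sqrt[OF h(4)] by (simp only: real_sqrt_zero)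
  then have conv: "tendsto_W12 U (\<lambda>k. F (r k)) FU" using W12_F W12_FU by (simp add: tendsto_W12_def)
  have "AE x in lebesgue_on U. \<forall>j. Dm (\<lambda>i. G j i x) = M x (Dp (\<lambda>i. G j i x))"
  proof -
    have "AE x in lebesgue_on \<Omega>. \<forall>j. Dm (\<lambda>i. G j i x) = M x (Dp (\<lambda>i. G j i x))"
      by (simp add: AE_all_countable eq)
    then have "AE x in lebesgue. x \<in> \<Omega> \<longrightarrow> (\<forall>j. Dm (\<lambda>i. G j i x) = M x (Dp (\<lambda>i. G j i x)))"
      using \<Omega>s by (simp add: AE_restrict_space_iff)
    then have "AE x in lebesgue. x \<in> U \<longrightarrow> (\<forall>j. Dm (\<lambda>i. G j i x) = M x (Dp (\<lambda>i. G j i x)))"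
      by eventually_elim (use U\<Omega> in blast)
    then show ?thesis using Us by (simp add: AE_restrict_space_iff)
  qed
  then have "AE x in lebesgue_on U. Dm (\<lambda>i. GU i x) = M x (Dp (\<lambda>i. GU i x))"
    using h(3)
  proof eventually_elim
    case (elim x)
    have lim: "(\<lambda>n. G (r (s n)) i x) \<longlonglongrightarrow> GU i x" for i
      using tendsto_vec_nth[OF tendsto_snd[OF elim(2)], of i] by (simp add: H_def GU_def)
    have w: "(\<lambda>n. A (G (r (s n)) i x)) \<longlonglongrightarrow> A (GU i x)" if "linear A" for A :: "'n::{finite,linorder} ext \<Rightarrow> 'n::{finite,linorder} ext" and i
      by (rule bounded_linear.tendsto[OF linear_conv_bounded_linear[THEN iffD1, OF that] lim])
    have e: "(\<lambda>n. ext_div (\<lambda>i. G (r (s n)) i x)) \<longlonglongrightarrow> ext_div (\<lambda>i. GU i x)"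
      unfolding ext_div_def by (intro tendsto_sum w linear_wedge_right)
    have i: "(\<lambda>n. int_div (\<lambda>i. G (r (s n)) i x)) \<longlonglongrightarrow> int_div (\<lambda>i. GU i x)"
      unfolding int_div_def by (intro tendsto_sum w linear_interior_mult)
    have l1: "(\<lambda>n. Dm (\<lambda>i. G (r (s n)) i x)) \<longlonglongrightarrow> Dm (\<lambda>i. GU i x)"
      unfolding Dm_def by (intro tendsto_diff e i)
    have l2: "(\<lambda>n. M x (Dp (\<lambda>i. G (r (s n)) i x))) \<longlonglongrightarrow> M x (Dp (\<lambda>i. GU i x))"
      unfolding Dp_def by (intro bounded_linear.tendsto[OF blinfun.bounded_linear_right] tendsto_add e i)
    have "(\<lambda>n. Dm (\<lambda>i. G (r (s n)) i x)) = (\<lambda>n. M x (Dp (\<lambda>i. G (r (s n)) i x)))" using elim(1) by simp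
    then show ?case using LIMSEQ_unique[OF l1] l2 by simp
  qed
  then have belt: "beltrami_solution U M FU"
    unfolding beltrami_solution_def using dirac_operators_AE[OF weak_partial_AE_eq[OF U(1) wpFU]]
    unfolding Dm_def Dp_def by eventually_elim simp
  show "\<exists>(r :: nat \<Rightarrow> nat) F\<^sub>U. strict_mono r \<and> F\<^sub>U \<in> W12 U \<and>
       tendsto_W12 U (\<lambda>k. F (r k)) F\<^sub>U \<and> beltrami_solution U M F\<^sub>U"
    using r(1) W12_FU conv belt by blast
qed

end
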